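(* Let $(\mathcal{C},\mathbb{E},\mathfrak{s})$ be an extriangulated category satisfying Condition (WIC), and let $\xi$ be a proper class of $\mathbb{E}$-triangles such that $\mathcal{C}$ has enough $\xi$-projectives and enough $\xi$-injectives. Suppose that $\sup\{\xi\text{-}\mathcal G\mathrm{id}\,M\mid M\in\mathcal C\}<\infty$. Let $n\geqslant0$ be an integer. Then for any object $M\in\mathbf{Res}(\mathcal{GP}(\xi))\cap\widehat{\mathcal{GP}}(\xi)$, the following are equivalent: (1) $\xi\text{-}\mathcal G\mathrm{pd}\,M\leqslant n$. (2) $\xi\mathrm{xt}^{n+i}_{\mathcal{GP}(\xi)}(M,N)=0$ for all $i\geqslant1$ and all $N\in\mathcal C$. (3) $\xi\mathrm{xt}^{n+i}_{\mathcal{GP}(\xi)}(M,P)=0$ for all $i\geqslant1$ and all $P\in\mathcal P(\xi)$.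
   Context: Extriangulated category: an additive category $\mathcal C$ with (ET1) a biadditive functor $\mathbb E:\mathcal C^{op}\times\mathcal C\to\mathbf{Ab}$ and a correspondence $\mathfrak s$ sending each $\delta\in\mathbb E(C,A)$ to a class $[A\xrightarrow{x}B\xrightarrow{y}C]$ of sequences modulo isomorphisms that are the identity on $A$ and $C$. Write $a_*\delta=\mathbb E(C,a)(\delta)$, $c^*\delta=\mathbb E(c,A)(\delta)$; a morphism from $\delta\in\mathbb E(C,A)$ to $\delta'\in\mathbb E(C',A')$ is a pair $(a:A\to A',c:C\to C')$ with $a_*\delta=c^*\delta'$. Axioms: (ET2) every morphism $(a,c)$ of extensions is realized by some $b$ making both squares between the realizing sequences commute, $\mathfrak s(0)=[A\to A\oplus C\to C]$, and $\mathfrak s(\delta\oplus\delta')=\mathfrak s(\delta)\oplus\mathfrak s(\delta')$; (ET3) if $\mathfrak s(\delta)=[A\xrightarrow{x}B\xrightarrow{y}C]$, $\mathfrak s(\delta')=[A'\xrightarrow{x'}B'\xrightarrow{y'}C']$ and $bx=x'a$, there is $c$ with $cy=y'b$ and $(a,c):\delta\to\delta'$ a morphism; (ET4) if $\delta\in\mathbb E(D,A)$, $\delta'\in\mathbb E(F,B)$ are realized by $A\xrightarrow{f}B\xrightarrow{f'}D$ and $B\xrightarrow{g}C\xrightarrow{g'}F$, there are an object $E$, $\delta''\in\mathbb E(E,A)$ realized by $A\xrightarrow{gf}C\xrightarrow{h'}E$, and $D\xrightarrow{d}E\xrightarrow{e}F$ realizing $f'_*\delta'$, with $h'g=df'$,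 $eh'=g'$, $d^*\delta''=\delta$, $f_*\delta''=e^*\delta'$; and the duals (ET3)$^{op}$, (ET4)$^{op}$. If $\mathfrak s(\delta)=[A\xrightarrow{x}B\xrightarrow{y}C]$, then $A\xrightarrow{x}B\xrightarrow{y}C\overset{\delta}{\dashrightarrow}$ is called an $\mathbb E$-triangle, $x$ an inflation, $y$ a deflation; it is split if $\delta=0$. Condition (WIC): for composable $f,g$, if $gf$ is an inflation so is $f$; if $gf$ is a deflation so is $g$. Proper class: a class $\xi$ of $\mathbb E$-triangles closed under isomorphisms such that (1) $\xi$ contains the split $\mathbb E$-triangles and is closed under finite coproducts; (2) if $A\to B\to C\overset{\delta}{\dashrightarrow}$ is in $\xi$, so is every $\mathbb E$-triangle realizing $c^*\delta$ or $a_*\delta$, for any $c:C'\to C$, $a:A\to A'$; (3) (saturated) for $\mathbb E$-triangles $A_i\xrightarrow{x_i}B_i\xrightarrow{y_i}C\overset{\delta_i}{\dashrightarrow}$, $i=1,2$, if the second one and the $\mathbb E$-triangle $A_1\to M\to B_2\overset{y_2^*\delta_1}{\dashrightarrow}$ are in $\xi$, then the first one is in $\xi$. $P$ is $\xi$-projective if $0\to\mathcal C(P,A)\to\mathcal C(P,B)\to\mathcal C(P,C)\to0$ is exact for every $\mathbb E$-triangle $A\to B\to C\dashrightarrow$ in $\xi$; $\xi$-injective is dual. $\mathcal P(\xi)$, $\mathcal I(\xi)$ denote the corresponding classes. Enough $\xi$-projectives: each $A$ admits an $\mathbb E$-triangle $K\to P\to A\dashrightarrow$ in $\xi$ with $P\in\mathcal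 P(\xi)$; enough $\xi$-injectives is dual. For a class $\mathcal W$, an $\mathbb E$-triangle $A\to B\to C\dashrightarrow$ in $\xi$ is $\mathcal C(\mathcal W,-)$-exact if $0\to\mathcal C(W,A)\to\mathcal C(W,B)\to\mathcal C(W,C)\to0$ is exact for all $W\in\mathcal W$, and $\mathcal C(-,\mathcal W)$-exact if $0\to\mathcal C(C,W)\to\mathcal C(B,W)\to\mathcal C(A,W)\to0$ is exact for all $W\in\mathcal W$. A complex $\cdots\to X_1\xrightarrow{d_1}X_0\xrightarrow{d_0}X_{-1}\to\cdots$ is $\xi$-exact if there are $\mathbb E$-triangles $K_{n+1}\xrightarrow{g_n}X_n\xrightarrow{f_n}K_n\dashrightarrow$ in $\xi$ (resolution $\mathbb E$-triangles) with $d_n=g_{n-1}f_n$ for all $n$. A complete $\xi$-projective resolution is a $\xi$-exact complex of $\xi$-projectives whose resolution $\mathbb E$-triangles are $\mathcal C(-,\mathcal P(\xi))$-exact; the objects $K_n$ occurring are called $\xi$-$\mathcal G$projective, forming $\mathcal{GP}(\xi)$. Dually ($\xi$-exact complexes of $\xi$-injectives with $\mathcal C(\mathcal I(\xi),-)$-exact resolution $\mathbb E$-triangles) one defines $\xi$-$\mathcal G$injective objects, forming $\mathcal{GI}(\xi)$. $\xi\text{-}\mathcal G\mathrm{pd}$ is defined inductively: $\xi\text{-}\mathcal G\mathrm{pd}\,0=-1$; it is $0$ for nonzero objects of $\mathcal{GP}(\xi)$; $\xi\text{-}\mathcal G\mathrm{pd}A\leqslant n$ if there is an $\mathbb E$-triangle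 $K\to G\to A\dashrightarrow$ in $\xi$ with $G\in\mathcal{GP}(\xi)$ and $\xi\text{-}\mathcal G\mathrm{pd}K\leqslant n-1$; $\infty$ if no such $n$. $\xi\text{-}\mathcal G\mathrm{id}$ is defined dually via $\mathcal{GI}(\xi)$. $\widehat{\mathcal{GP}}(\xi)$ is the full subcategory of objects of finite $\xi\text{-}\mathcal G\mathrm{pd}$. A proper $\xi$-$\mathcal G$projective resolution of $A$ is a $\xi$-exact complex $\cdots\to G_1\to G_0\to A\to0$ with all $G_i\in\mathcal{GP}(\xi)$ whose resolution $\mathbb E$-triangles $K_{i+1}\to G_i\to K_i\dashrightarrow$ ($K_0=A$) are $\mathcal C(\mathcal{GP}(\xi),-)$-exact; its deleted complex $\mathbf G^\sharp$ is $\cdots\to G_1\to G_0\to0$. $\mathbf{Res}(\mathcal{GP}(\xi))$ is the full subcategory of objects having a proper $\xi$-$\mathcal G$projective resolution. For $A\in\mathbf{Res}(\mathcal{GP}(\xi))$ and any $B$, $\xi\mathrm{xt}^n_{\mathcal{GP}(\xi)}(A,B):=H^n(\mathcal C(\mathbf G^\sharp,B))$, independent of the choice of resolution up to isomorphism. *)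

theory Defs
  imports "HOL-Algebra.Exact_Sequence" "HOL-Library.Extended_Real"
begin

section \<open>Additive categories\<close>

text \<open>
  Hom-groups are HOL-Algebra commutative groups, hence written multiplicatively:
  the sum of two parallel arrows is \<open>f \<otimes>\<^bsub>Hom \<C> A B\<^esub> g\<close> and the zero arrow is
  \<open>\<one>\<^bsub>Hom \<C> A B\<^esub>\<close>.  Composition \<open>g \<cdot>\<^bsub>\<C>\<^esub> f\<close> means ``first \<open>f\<close>, then \<open>g\<close>''.
\<close>

record ('o, 'm) precat =
  Obj  :: "'o set"
  Hom  :: "'o \<Rightarrow> 'o \<Rightarrow> 'm monoid"
  Comp :: "'m \<Rightarrow> 'm \<Rightarrow> 'm"  (infixr "\<cdot>\<index>" 75)
  ide  :: "'o \<Rightarrow> 'm"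

abbreviation arr :: "('o, 'm, 'z) precat_scheme \<Rightarrow> 'o \<Rightarrow> 'o \<Rightarrow> 'm set" where
  "arr \<C> A B \<equiv> carrier (Hom \<C> A B)"

definition is_iso_arr :: "('o, 'm, 'z) precat_scheme \<Rightarrow> 'o \<Rightarrow> 'o \<Rightarrow> 'm \<Rightarrow> bool" where
  "is_iso_arr \<C> A B f \<longleftrightarrow>
     f \<in> arr \<C> A B \<and> (\<exists>g \<in> arr \<C> B A. g \<cdot>\<^bsub>\<C>\<^esub> f = ide \<C> A \<and> f \<cdot>\<^bsub>\<C>\<^esub> g = ide \<C> B)"

definition is_zero_obj :: "('o, 'm, 'z) precat_scheme \<Rightarrow> 'o \<Rightarrow> bool" where
  "is_zero_obj \<C> Z \<longleftrightarrow>
     Z \<in> Obj \<C> \<and> (\<forall>A \<in> Obj \<C>. (\<exists>!f. f \<in> arr \<C> Z A) \<and> (\<exists>!f. f \<in> arr \<C> A Z))"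

record ('o, 'm) biproduct =
  bobj :: 'o
  inj1 :: 'm
  inj2 :: 'm
  pr1  :: 'm
  pr2  :: 'm

definition is_biproduct ::
  "('o, 'm, 'z) precat_scheme \<Rightarrow> 'o \<Rightarrow> 'o \<Rightarrow> ('o, 'm) biproduct \<Rightarrow> bool" where
  "is_biproduct \<C> A B S \<longleftrightarrow>
     A \<in> Obj \<C> \<and> B \<in> Obj \<C> \<and> bobj S \<in> Obj \<C> \<and>
     inj1 S \<in> arr \<C> A (bobj S) \<and> inj2 S \<in> arr \<C> B (bobj S) \<and>
     pr1 S \<in> arr \<C> (bobj S) A \<and> pr2 S \<in> arr \<C> (bobj S) B \<and>
     pr1 S \<cdot>\<^bsub>\<C>\<^esub> inj1 S = ide \<C> A \<and> pr2 S \<cdot>\<^bsub>\<C>\<^esub> inj2 S = ide \<C> B \<and>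
     pr1 S \<cdot>\<^bsub>\<C>\<^esub> inj2 S = \<one>\<^bsub>Hom \<C> B A\<^esub> \<and> pr2 S \<cdot>\<^bsub>\<C>\<^esub> inj1 S = \<one>\<^bsub>Hom \<C> A B\<^esub> \<and>
     (inj1 S \<cdot>\<^bsub>\<C>\<^esub> pr1 S) \<otimes>\<^bsub>Hom \<C> (bobj S) (bobj S)\<^esub> (inj2 S \<cdot>\<^bsub>\<C>\<^esub> pr2 S) = ide \<C> (bobj S)"

text \<open>The arrow \<open>x \<oplus> x'\<close> between two biproduct objects.\<close>

definition sum_arr ::
  "('o, 'm, 'z) precat_scheme \<Rightarrow> ('o, 'm) biproduct \<Rightarrow> ('o, 'm) biproduct \<Rightarrow> 'm \<Rightarrow> 'm \<Rightarrow> 'm" where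
  "sum_arr \<C> S T x x' =
     (inj1 T \<cdot>\<^bsub>\<C>\<^esub> x \<cdot>\<^bsub>\<C>\<^esub> pr1 S) \<otimes>\<^bsub>Hom \<C> (bobj S) (bobj T)\<^esub> (inj2 T \<cdot>\<^bsub>\<C>\<^esub> x' \<cdot>\<^bsub>\<C>\<^esub> pr2 S)"

text \<open>
  Assumption \<open>hom_disjoint\<close> is the usual convention that an arrow determines its domain and
  codomain; it is what allows \<open>Comp\<close> to take no object arguments.
\<close>

locale additive_category =
  fixes \<C> :: "('o, 'm, 'z) precat_scheme" (structure)
  assumes hom_comm_group: "A \<in> Obj \<C> \<Longrightarrow> B \<in> Obj \<C> \<Longrightarrow> comm_group (Hom \<C> A B)"
    and hom_disjoint:
      "\<lbrakk>A \<in> Obj \<C>; B \<in> Obj \<C>; A' \<in> Obj \<C>; B' \<in> Obj \<C>; f \<in> arr \<C> A B; f \<in> arr \<C> A' B'\<rbrakk>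
        \<Longrightarrow> A = A' \<and> B = B'"
    and comp_closed:
      "\<lbrakk>A \<in> Obj \<C>; B \<in> Obj \<C>; D \<in> Obj \<C>; f \<in> arr \<C> A B; g \<in> arr \<C> B D\<rbrakk>
        \<Longrightarrow> g \<cdot> f \<in> arr \<C> A D"
    and comp_assoc:
      "\<lbrakk>A \<in> Obj \<C>; B \<in> Obj \<C>; D \<in> Obj \<C>; E \<in> Obj \<C>;
        f \<in> arr \<C> A B; g \<in> arr \<C> B D; h \<in> arr \<C> D E\<rbrakk>
        \<Longrightarrow> (h \<cdot> g) \<cdot> f = h \<cdot> (g \<cdot> f)"
    and ide_closed: "A \<in> Obj \<C> \<Longrightarrow> ide \<C> A \<in> arr \<C> A A"
    and ide_right: "\<lbrakk>A \<in> Obj \<C>; B \<in> Obj \<C>; f \<in> arr \<C> A B\<rbrakk> \<Longrightarrow> f \<cdot> ide \<C> A = f"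
    and ide_left: "\<lbrakk>A \<in> Obj \<C>; B \<in> Obj \<C>; f \<in> arr \<C> A B\<rbrakk> \<Longrightarrow> ide \<C> B \<cdot> f = f"
    and comp_add_right:
      "\<lbrakk>A \<in> Obj \<C>; B \<in> Obj \<C>; D \<in> Obj \<C>; f \<in> arr \<C> A B; f' \<in> arr \<C> A B; g \<in> arr \<C> B D\<rbrakk>
        \<Longrightarrow> g \<cdot> (f \<otimes>\<^bsub>Hom \<C> A B\<^esub> f') = (g \<cdot> f) \<otimes>\<^bsub>Hom \<C> A D\<^esub> (g \<cdot> f')"
    and comp_add_left:
      "\<lbrakk>A \<in> Obj \<C>; B \<in> Obj \<C>; D \<in> Obj \<C>; f \<in> arr \<C> A B; g \<in> arr \<C> B D; g' \<in> arr \<C> B D\<rbrakk>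
        \<Longrightarrow> (g \<otimes>\<^bsub>Hom \<C> B D\<^esub> g') \<cdot> f = (g \<cdot> f) \<otimes>\<^bsub>Hom \<C> A D\<^esub> (g' \<cdot> f)"
    and zero_exists: "\<exists>Z. is_zero_obj \<C> Z"
    and biproduct_exists: "\<lbrakk>A \<in> Obj \<C>; B \<in> Obj \<C>\<rbrakk> \<Longrightarrow> \<exists>S. is_biproduct \<C> A B S"


section \<open>Extriangulated categories\<close>

text \<open>
  \<open>Ext \<C> C A\<close> is the group \<open>\<E>(C, A)\<close> (contravariant argument first), \<open>Emap \<C> c a\<close> is the
  homomorphism \<open>\<E>(c, a)\<close>, and \<open>Realiz \<C> C A \<delta>\<close> is the class \<open>\<s>(\<delta>)\<close>, a set of
  sequences \<open>A \<rightarrow> B \<rightarrow> C\<close> given as triples \<open>(B, x, y)\<close>.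
\<close>

record ('o, 'm, 'e) extri = "('o, 'm) precat" +
  Ext  :: "'o \<Rightarrow> 'o \<Rightarrow> 'e monoid"
  Emap :: "'m \<Rightarrow> 'm \<Rightarrow> 'e \<Rightarrow> 'e"
  Realiz :: "'o \<Rightarrow> 'o \<Rightarrow> 'e \<Rightarrow> ('o \<times> 'm \<times> 'm) set"

text \<open>For \<open>\<delta> \<in> \<E>(C, A)\<close>: \<open>push \<C> C a \<delta> = a\<^sub>* \<delta>\<close> and \<open>pull \<C> A c \<delta> = c\<^sup>* \<delta>\<close>.\<close>

abbreviation push :: "('o, 'm, 'e) extri \<Rightarrow> 'o \<Rightarrow> 'm \<Rightarrow> 'e \<Rightarrow> 'e" where
  "push \<C> C a \<delta> \<equiv> Emap \<C> (ide \<C> C) a \<delta>"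

abbreviation pull :: "('o, 'm, 'e) extri \<Rightarrow> 'o \<Rightarrow> 'm \<Rightarrow> 'e \<Rightarrow> 'e" where
  "pull \<C> A c \<delta> \<equiv> Emap \<C> c (ide \<C> A) \<delta>"

text \<open>The class \<open>[A \<rightarrow> B \<rightarrow> C]\<close> modulo isomorphisms that are the identity on \<open>A\<close> and \<open>C\<close>.\<close>

definition seq_class ::
  "('o, 'm, 'e) extri \<Rightarrow> 'o \<Rightarrow> 'o \<Rightarrow> 'o \<Rightarrow> 'm \<Rightarrow> 'm \<Rightarrow> ('o \<times> 'm \<times> 'm) set" where
  "seq_class \<C> A B C x y =
     {(B', x', y'). B' \<in> Obj \<C> \<and> x' \<in> arr \<C> A B' \<and> y' \<in> arr \<C> B' C \<and>
        (\<exists>b. is_iso_arr \<C> B B' b \<and> b \<cdot>\<^bsub>\<C>\<^esub> x = x' \<and> y' \<cdot>\<^bsub>\<C>\<^esub> b = y)}"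

text \<open>
  \<open>\<delta> \<oplus> \<delta>'\<close> is the element of \<open>\<E>(C \<oplus> C', A \<oplus> A')\<close> with components \<open>(\<delta>, 0, 0, \<delta>')\<close> under
  biadditivity.
\<close>

definition sum_ext ::
  "('o, 'm, 'e) extri \<Rightarrow> ('o, 'm) biproduct \<Rightarrow> ('o, 'm) biproduct \<Rightarrow> 'e \<Rightarrow> 'e \<Rightarrow> 'e" where
  "sum_ext \<C> SC SA \<delta> \<delta>' =
     Emap \<C> (pr1 SC) (inj1 SA) \<delta> \<otimes>\<^bsub>Ext \<C> (bobj SC) (bobj SA)\<^esub> Emap \<C> (pr2 SC) (inj2 SA) \<delta>'"

text \<open>
  \<open>ETri A B C x y \<delta>\<close> stands for \<open>A \<rightarrow> B \<rightarrow> C\<close> together with the extension \<open>\<delta>\<close>; being an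
  \<open>\<E>\<close>-triangle is the following predicate.
\<close>

datatype ('o, 'm, 'e) etri = ETri 'o 'o 'o 'm 'm 'e

fun is_etri :: "('o, 'm, 'e) extri \<Rightarrow> ('o, 'm, 'e) etri \<Rightarrow> bool" where
  "is_etri \<C> (ETri A B C x y \<delta>) \<longleftrightarrow>
     A \<in> Obj \<C> \<and> C \<in> Obj \<C> \<and> \<delta> \<in> carrier (Ext \<C> C A) \<and> (B, x, y) \<in> Realiz \<C> C A \<delta>"

locale extriangulated_category = additive_category \<C>
  for \<C> :: "('o, 'm, 'e) extri" (structure) +
  assumes
    \<comment> \<open>(ET1)\<close>
    ext_comm_group: "\<lbrakk>C \<in> Obj \<C>; A \<in> Obj \<C>\<rbrakk> \<Longrightarrow> comm_group (Ext \<C> C A)"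
    and emap_hom:
      "\<lbrakk>C \<in> Obj \<C>; C' \<in> Obj \<C>; A \<in> Obj \<C>; A' \<in> Obj \<C>; c \<in> arr \<C> C' C; a \<in> arr \<C> A A'\<rbrakk>
        \<Longrightarrow> Emap \<C> c a \<in> hom (Ext \<C> C A) (Ext \<C> C' A')"
    and emap_ide:
      "\<lbrakk>C \<in> Obj \<C>; A \<in> Obj \<C>; \<delta> \<in> carrier (Ext \<C> C A)\<rbrakk>
        \<Longrightarrow> Emap \<C> (ide \<C> C) (ide \<C> A) \<delta> = \<delta>"
    and emap_comp:
      "\<lbrakk>C \<in> Obj \<C>; C' \<in> Obj \<C>; C'' \<in> Obj \<C>; A \<in> Obj \<C>; A' \<in> Obj \<C>; A'' \<in> Obj \<C>;
        c \<in> arr \<C> C' C; c' \<in> arr \<C> C'' C'; a \<in> arr \<C> A A'; a' \<in> arr \<C> A' A'';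
        \<delta> \<in> carrier (Ext \<C> C A)\<rbrakk>
        \<Longrightarrow> Emap \<C> (c \<cdot> c') (a' \<cdot> a) \<delta> = Emap \<C> c' a' (Emap \<C> c a \<delta>)"
    and emap_add_left:
      "\<lbrakk>C \<in> Obj \<C>; C' \<in> Obj \<C>; A \<in> Obj \<C>; A' \<in> Obj \<C>;
        c \<in> arr \<C> C' C; d \<in> arr \<C> C' C; a \<in> arr \<C> A A'; \<delta> \<in> carrier (Ext \<C> C A)\<rbrakk>
        \<Longrightarrow> Emap \<C> (c \<otimes>\<^bsub>Hom \<C> C' C\<^esub> d) a \<delta> = Emap \<C> c a \<delta> \<otimes>\<^bsub>Ext \<C> C' A'\<^esub> Emap \<C> d a \<delta>"
    and emap_add_right:
      "\<lbrakk>C \<in> Obj \<C>; C' \<in> Obj \<C>; A \<in> Obj \<C>; A' \<in> Obj \<C>;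
        c \<in> arr \<C> C' C; a \<in> arr \<C> A A'; b \<in> arr \<C> A A'; \<delta> \<in> carrier (Ext \<C> C A)\<rbrakk>
        \<Longrightarrow> Emap \<C> c (a \<otimes>\<^bsub>Hom \<C> A A'\<^esub> b) \<delta> = Emap \<C> c a \<delta> \<otimes>\<^bsub>Ext \<C> C' A'\<^esub> Emap \<C> c b \<delta>"
    and realization_class:
      "\<lbrakk>C \<in> Obj \<C>; A \<in> Obj \<C>; \<delta> \<in> carrier (Ext \<C> C A)\<rbrakk>
        \<Longrightarrow> \<exists>B \<in> Obj \<C>. \<exists>x \<in> arr \<C> A B. \<exists>y \<in> arr \<C> B C. Realiz \<C> C A \<delta> = seq_class \<C> A B C x y"
    \<comment> \<open>(ET2)\<close>
    and realization_morphism: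
      "\<lbrakk>is_etri \<C> (ETri A B C x y \<delta>); is_etri \<C> (ETri A' B' C' x' y' \<delta>');
        a \<in> arr \<C> A A'; c \<in> arr \<C> C C'; push \<C> C a \<delta> = pull \<C> A' c \<delta>'\<rbrakk>
        \<Longrightarrow> \<exists>b \<in> arr \<C> B B'. b \<cdot> x = x' \<cdot> a \<and> y' \<cdot> b = c \<cdot> y"
    and realization_zero:
      "is_biproduct \<C> A C S
        \<Longrightarrow> Realiz \<C> C A \<one>\<^bsub>Ext \<C> C A\<^esub> = seq_class \<C> A (bobj S) C (inj1 S) (pr2 S)"
    and realization_sum:
      "\<lbrakk>is_etri \<C> (ETri A B C x y \<delta>); is_etri \<C> (ETri A' B' C' x' y' \<delta>');
        is_biproduct \<C> A A' SA; is_biproduct \<C> B B' SB; is_biproduct \<C> C C' SC\<rbrakk>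
        \<Longrightarrow> Realiz \<C> (bobj SC) (bobj SA) (sum_ext \<C> SC SA \<delta> \<delta>') =
            seq_class \<C> (bobj SA) (bobj SB) (bobj SC) (sum_arr \<C> SA SB x x') (sum_arr \<C> SB SC y y')"
    \<comment> \<open>(ET3) and its dual\<close>
    and ET3:
      "\<lbrakk>is_etri \<C> (ETri A B C x y \<delta>); is_etri \<C> (ETri A' B' C' x' y' \<delta>');
        a \<in> arr \<C> A A'; b \<in> arr \<C> B B'; b \<cdot> x = x' \<cdot> a\<rbrakk>
        \<Longrightarrow> \<exists>c \<in> arr \<C> C C'. c \<cdot> y = y' \<cdot> b \<and> push \<C> C a \<delta> = pull \<C> A' c \<delta>'"
    and ET3_op:
      "\<lbrakk>is_etri \<C> (ETri A B C x y \<delta>); is_etri \<C> (ETri A' B' C' x' y' \<delta>');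
        b \<in> arr \<C> B B'; c \<in> arr \<C> C C'; c \<cdot> y = y' \<cdot> b\<rbrakk>
        \<Longrightarrow> \<exists>a \<in> arr \<C> A A'. b \<cdot> x = x' \<cdot> a \<and> push \<C> C a \<delta> = pull \<C> A' c \<delta>'"
    \<comment> \<open>(ET4) and its dual\<close>
    and ET4:
      "\<lbrakk>is_etri \<C> (ETri A B D f f' \<delta>); is_etri \<C> (ETri B C F g g' \<delta>')\<rbrakk>
        \<Longrightarrow> \<exists>E \<delta>'' h' d e.
              is_etri \<C> (ETri A C E (g \<cdot> f) h' \<delta>'') \<and>
              is_etri \<C> (ETri D E F d e (push \<C> F f' \<delta>')) \<and>
              h' \<cdot> g = d \<cdot> f' \<and> e \<cdot> h' = g' \<and>
              pull \<C> A d \<delta>'' = \<delta> \<and> push \<C> E f \<delta>'' = pull \<C> B e \<delta>'"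
    and ET4_op:
      "\<lbrakk>is_etri \<C> (ETri D A B f' f \<delta>); is_etri \<C> (ETri F B C g' g \<delta>')\<rbrakk>
        \<Longrightarrow> \<exists>E \<delta>'' h' d e.
              is_etri \<C> (ETri E A C h' (g \<cdot> f) \<delta>'') \<and>
              is_etri \<C> (ETri D E F d e (pull \<C> D g' \<delta>)) \<and>
              f \<cdot> h' = g' \<cdot> e \<and> h' \<cdot> d = f' \<and>
              push \<C> C e \<delta>'' = \<delta>' \<and> push \<C> B d \<delta> = pull \<C> E g \<delta>''"

definition inflation :: "('o, 'm, 'e) extri \<Rightarrow> 'm \<Rightarrow> bool" where
  "inflation \<C> x \<longleftrightarrow> (\<exists>A B C y \<delta>. is_etri \<C> (ETri A B C x y \<delta>))"

definition deflation :: "('o, 'm, 'e) extri \<Rightarrow> 'm \<Rightarrow> bool" where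
  "deflation \<C> y \<longleftrightarrow> (\<exists>A B C x \<delta>. is_etri \<C> (ETri A B C x y \<delta>))"

definition WIC :: "('o, 'm, 'e) extri \<Rightarrow> bool" where
  "WIC \<C> \<longleftrightarrow>
     (\<forall>A \<in> Obj \<C>. \<forall>B \<in> Obj \<C>. \<forall>D \<in> Obj \<C>. \<forall>f \<in> arr \<C> A B. \<forall>g \<in> arr \<C> B D.
        (inflation \<C> (g \<cdot>\<^bsub>\<C>\<^esub> f) \<longrightarrow> inflation \<C> f) \<and>
        (deflation \<C> (g \<cdot>\<^bsub>\<C>\<^esub> f) \<longrightarrow> deflation \<C> g))"


section \<open>Proper classes\<close>

fun etri_iso :: "('o, 'm, 'e) extri \<Rightarrow> ('o, 'm, 'e) etri \<Rightarrow> ('o, 'm, 'e) etri \<Rightarrow> bool" where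
  "etri_iso \<C> (ETri A B C x y \<delta>) (ETri A' B' C' x' y' \<delta>') \<longleftrightarrow>
     (\<exists>a b c. is_iso_arr \<C> A A' a \<and> is_iso_arr \<C> B B' b \<and> is_iso_arr \<C> C C' c \<and>
        b \<cdot>\<^bsub>\<C>\<^esub> x = x' \<cdot>\<^bsub>\<C>\<^esub> a \<and> c \<cdot>\<^bsub>\<C>\<^esub> y = y' \<cdot>\<^bsub>\<C>\<^esub> b \<and> push \<C> C a \<delta> = pull \<C> A' c \<delta>')"

text \<open>
  Closure under finite coproducts is closure under binary ones: the empty coproduct
  \<open>0 \<rightarrow> 0 \<rightarrow> 0\<close> is split.
\<close>

locale proper_class =
  fixes \<C> :: "('o, 'm, 'e) extri" (structure) and \<xi> :: "('o, 'm, 'e) etri set"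
  assumes etri: "T \<in> \<xi> \<Longrightarrow> is_etri \<C> T"
    and iso_closed: "\<lbrakk>T \<in> \<xi>; is_etri \<C> T'; etri_iso \<C> T T'\<rbrakk> \<Longrightarrow> T' \<in> \<xi>"
    and split: "is_etri \<C> (ETri A B C x y \<one>\<^bsub>Ext \<C> C A\<^esub>) \<Longrightarrow> ETri A B C x y \<one>\<^bsub>Ext \<C> C A\<^esub> \<in> \<xi>"
    and coproduct:
      "\<lbrakk>ETri A B C x y \<delta> \<in> \<xi>; ETri A' B' C' x' y' \<delta>' \<in> \<xi>;
        is_biproduct \<C> A A' SA; is_biproduct \<C> B B' SB; is_biproduct \<C> C C' SC\<rbrakk>
        \<Longrightarrow> ETri (bobj SA) (bobj SB) (bobj SC)
              (sum_arr \<C> SA SB x x') (sum_arr \<C> SB SC y y') (sum_ext \<C> SC SA \<delta> \<delta>') \<in> \<xi>"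
    and base_change:
      "\<lbrakk>ETri A B C x y \<delta> \<in> \<xi>; C' \<in> Obj \<C>; c \<in> arr \<C> C' C;
        is_etri \<C> (ETri A B' C' x' y' (pull \<C> A c \<delta>))\<rbrakk>
        \<Longrightarrow> ETri A B' C' x' y' (pull \<C> A c \<delta>) \<in> \<xi>"
    and cobase_change:
      "\<lbrakk>ETri A B C x y \<delta> \<in> \<xi>; A' \<in> Obj \<C>; a \<in> arr \<C> A A';
        is_etri \<C> (ETri A' B' C x' y' (push \<C> C a \<delta>))\<rbrakk>
        \<Longrightarrow> ETri A' B' C x' y' (push \<C> C a \<delta>) \<in> \<xi>"
    and saturated:
      "\<lbrakk>is_etri \<C> (ETri A\<^sub>1 B\<^sub>1 C x\<^sub>1 y\<^sub>1 \<delta>\<^sub>1); ETri A\<^sub>2 B\<^sub>2 C x\<^sub>2 y\<^sub>2 \<delta>\<^sub>2 \<in> \<xi>;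
        ETri A\<^sub>1 M B\<^sub>2 m e (pull \<C> A\<^sub>1 y\<^sub>2 \<delta>\<^sub>1) \<in> \<xi>\<rbrakk>
        \<Longrightarrow> ETri A\<^sub>1 B\<^sub>1 C x\<^sub>1 y\<^sub>1 \<delta>\<^sub>1 \<in> \<xi>"


section \<open>Exactness, projectives and injectives\<close>

text \<open>
  Exactness of \<open>0 \<rightarrow> G \<rightarrow> H \<rightarrow> K \<rightarrow> 0\<close>; note that \<open>exact_seq\<close> lists groups and maps from right
  to left.
\<close>

definition short_exact ::
  "'a monoid \<Rightarrow> 'a monoid \<Rightarrow> 'a monoid \<Rightarrow> ('a \<Rightarrow> 'a) \<Rightarrow> ('a \<Rightarrow> 'a) \<Rightarrow> bool" where
  "short_exact G H K f g \<longleftrightarrow>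
     exact_seq ([singleton_group \<one>\<^bsub>K\<^esub>, K, H, G, singleton_group \<one>\<^bsub>G\<^esub>],
                [\<lambda>_. \<one>\<^bsub>K\<^esub>, g, f, \<lambda>_. \<one>\<^bsub>G\<^esub>])"

lemma short_exact_iff:
  "short_exact G H K f g \<longleftrightarrow>
     group_hom G H f \<and> group_hom H K g \<and>
     inj_on f (carrier G) \<and> kernel H K g = f ` carrier G \<and> g ` carrier H = carrier K"
proof -
  have l: "group_hom (singleton_group \<one>\<^bsub>G\<^esub>) G (\<lambda>_. \<one>\<^bsub>G\<^esub>)" if "group G"
    using that by (auto simp: group_hom_def group_hom_axioms_def hom_def group.is_monoid monoid.l_one)
  have r: "(\<lambda>_. \<one>\<^bsub>K\<^esub>) \<in> hom K (singleton_group \<one>\<^bsub>K\<^esub>)"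
    by (auto simp: hom_def singleton_group_def)
  have k: "kernel K (singleton_group \<one>\<^bsub>K\<^esub>) (\<lambda>_. \<one>\<^bsub>K\<^esub>) = carrier K"
    by (auto simp: kernel_def singleton_group_def)
  have i: "kernel G H f = {\<one>\<^bsub>G\<^esub>} \<longleftrightarrow> inj_on f (carrier G)" if "group_hom G H f"
    using group_hom.inj_iff_trivial_ker[OF that] by simp
  show ?thesis
    unfolding short_exact_def
    using l r k i by (auto simp: group_hom_def group_hom_axioms_def)
qed

text \<open>\<open>\<C>(W, -)\<close>- and \<open>\<C>(-, W)\<close>-exactness of a sequence \<open>A \<rightarrow> B \<rightarrow> C\<close>.\<close>

fun covariant_exact ::
  "('o, 'm, 'e) extri \<Rightarrow> 'o \<Rightarrow> ('o, 'm, 'e) etri \<Rightarrow> bool" where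
  "covariant_exact \<C> W (ETri A B C x y \<delta>) \<longleftrightarrow>
     short_exact (Hom \<C> W A) (Hom \<C> W B) (Hom \<C> W C) (\<lambda>h. x \<cdot>\<^bsub>\<C>\<^esub> h) (\<lambda>h. y \<cdot>\<^bsub>\<C>\<^esub> h)"

fun contravariant_exact ::
  "('o, 'm, 'e) extri \<Rightarrow> 'o \<Rightarrow> ('o, 'm, 'e) etri \<Rightarrow> bool" where
  "contravariant_exact \<C> W (ETri A B C x y \<delta>) \<longleftrightarrow>
     short_exact (Hom \<C> C W) (Hom \<C> B W) (Hom \<C> A W) (\<lambda>h. h \<cdot>\<^bsub>\<C>\<^esub> y) (\<lambda>h. h \<cdot>\<^bsub>\<C>\<^esub> x)"

definition Proj :: "('o, 'm, 'e) extri \<Rightarrow> ('o, 'm, 'e) etri set \<Rightarrow> 'o set" where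
  "Proj \<C> \<xi> = {P \<in> Obj \<C>. \<forall>T \<in> \<xi>. covariant_exact \<C> P T}"

definition Inj :: "('o, 'm, 'e) extri \<Rightarrow> ('o, 'm, 'e) etri set \<Rightarrow> 'o set" where
  "Inj \<C> \<xi> = {I \<in> Obj \<C>. \<forall>T \<in> \<xi>. contravariant_exact \<C> I T}"

definition enough_proj :: "('o, 'm, 'e) extri \<Rightarrow> ('o, 'm, 'e) etri set \<Rightarrow> bool" where
  "enough_proj \<C> \<xi> \<longleftrightarrow> (\<forall>A \<in> Obj \<C>. \<exists>K P x y \<delta>. P \<in> Proj \<C> \<xi> \<and> ETri K P A x y \<delta> \<in> \<xi>)"

definition enough_inj :: "('o, 'm, 'e) extri \<Rightarrow> ('o, 'm, 'e) etri set \<Rightarrow> bool" where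
  "enough_inj \<C> \<xi> \<longleftrightarrow> (\<forall>A \<in> Obj \<C>. \<exists>I K x y \<delta>. I \<in> Inj \<C> \<xi> \<and> ETri A I K x y \<delta> \<in> \<xi>)"


section \<open>Gorenstein projective and injective objects\<close>

text \<open>
  \<open>resolution_etri X K g f \<delta> n\<close> is the resolution triangle \<open>K\<^sub>n\<^sub>+\<^sub>1 \<rightarrow> X\<^sub>n \<rightarrow> K\<^sub>n\<close>.
\<close>

definition resolution_etri ::
  "(int \<Rightarrow> 'o) \<Rightarrow> (int \<Rightarrow> 'o) \<Rightarrow> (int \<Rightarrow> 'm) \<Rightarrow> (int \<Rightarrow> 'm) \<Rightarrow> (int \<Rightarrow> 'e) \<Rightarrow> int
     \<Rightarrow> ('o, 'm, 'e) etri" where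
  "resolution_etri X K g f \<delta> n = ETri (K (n + 1)) (X n) (K n) (g n) (f n) (\<delta> n)"

text \<open>
  The complex \<open>(X, d)\<close> with \<open>d n : X n \<rightarrow> X (n - 1)\<close> is \<open>\<xi>\<close>-exact with the given resolution
  triangles.
\<close>

definition xi_exact_complex ::
  "('o, 'm, 'e) extri \<Rightarrow> ('o, 'm, 'e) etri set \<Rightarrow> (int \<Rightarrow> 'o) \<Rightarrow> (int \<Rightarrow> 'm)
     \<Rightarrow> (int \<Rightarrow> 'o) \<Rightarrow> (int \<Rightarrow> 'm) \<Rightarrow> (int \<Rightarrow> 'm) \<Rightarrow> (int \<Rightarrow> 'e) \<Rightarrow> bool" where
  "xi_exact_complex \<C> \<xi> X d K g f \<delta> \<longleftrightarrow>
     (\<forall>n. resolution_etri X K g f \<delta> n \<in> \<xi> \<and> d n = g (n - 1) \<cdot>\<^bsub>\<C>\<^esub> f n)"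

definition complete_proj_resolution ::
  "('o, 'm, 'e) extri \<Rightarrow> ('o, 'm, 'e) etri set \<Rightarrow> (int \<Rightarrow> 'o) \<Rightarrow> (int \<Rightarrow> 'm)
     \<Rightarrow> (int \<Rightarrow> 'o) \<Rightarrow> (int \<Rightarrow> 'm) \<Rightarrow> (int \<Rightarrow> 'm) \<Rightarrow> (int \<Rightarrow> 'e) \<Rightarrow> bool" where
  "complete_proj_resolution \<C> \<xi> X d K g f \<delta> \<longleftrightarrow>
     xi_exact_complex \<C> \<xi> X d K g f \<delta> \<and> (\<forall>n. X n \<in> Proj \<C> \<xi>) \<and>
     (\<forall>n. \<forall>W \<in> Proj \<C> \<xi>. contravariant_exact \<C> W (resolution_etri X K g f \<delta> n))"

definition complete_inj_resolution ::
  "('o, 'm, 'e) extri \<Rightarrow> ('o, 'm, 'e) etri set \<Rightarrow> (int \<Rightarrow> 'o) \<Rightarrow> (int \<Rightarrow> 'm)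
     \<Rightarrow> (int \<Rightarrow> 'o) \<Rightarrow> (int \<Rightarrow> 'm) \<Rightarrow> (int \<Rightarrow> 'm) \<Rightarrow> (int \<Rightarrow> 'e) \<Rightarrow> bool" where
  "complete_inj_resolution \<C> \<xi> X d K g f \<delta> \<longleftrightarrow>
     xi_exact_complex \<C> \<xi> X d K g f \<delta> \<and> (\<forall>n. X n \<in> Inj \<C> \<xi>) \<and>
     (\<forall>n. \<forall>W \<in> Inj \<C> \<xi>. covariant_exact \<C> W (resolution_etri X K g f \<delta> n))"

definition GP :: "('o, 'm, 'e) extri \<Rightarrow> ('o, 'm, 'e) etri set \<Rightarrow> 'o set" where
  "GP \<C> \<xi> = {K n | X d K g f \<delta> n. complete_proj_resolution \<C> \<xi> X d K g f \<delta>}"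

definition GI :: "('o, 'm, 'e) extri \<Rightarrow> ('o, 'm, 'e) etri set \<Rightarrow> 'o set" where
  "GI \<C> \<xi> = {K n | X d K g f \<delta> n. complete_inj_resolution \<C> \<xi> X d K g f \<delta>}"


section \<open>Gorenstein dimensions\<close>

text \<open>
  \<open>Gpd_le \<C> \<xi> A n\<close> is the relation \<open>\<xi>-\<G>pd A \<le> n\<close> for \<open>n \<in> {-1, 0, 1, ...}\<close>;
  the value \<open>-1\<close> is attained exactly by zero objects.
\<close>

inductive Gpd_le :: "('o, 'm, 'e) extri \<Rightarrow> ('o, 'm, 'e) etri set \<Rightarrow> 'o \<Rightarrow> int \<Rightarrow> bool"
  for \<C> \<xi> where
  zero: "is_zero_obj \<C> A \<Longrightarrow> - 1 \<le> n \<Longrightarrow> Gpd_le \<C> \<xi> A n"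
| GP: "A \<in> GP \<C> \<xi> \<Longrightarrow> 0 \<le> n \<Longrightarrow> Gpd_le \<C> \<xi> A n"
| step: "ETri K G A x y \<delta> \<in> \<xi> \<Longrightarrow> G \<in> GP \<C> \<xi> \<Longrightarrow> Gpd_le \<C> \<xi> K (n - 1) \<Longrightarrow> Gpd_le \<C> \<xi> A n"

inductive Gid_le :: "('o, 'm, 'e) extri \<Rightarrow> ('o, 'm, 'e) etri set \<Rightarrow> 'o \<Rightarrow> int \<Rightarrow> bool"
  for \<C> \<xi> where
  zero: "is_zero_obj \<C> A \<Longrightarrow> - 1 \<le> n \<Longrightarrow> Gid_le \<C> \<xi> A n"
| GI: "A \<in> GI \<C> \<xi> \<Longrightarrow> 0 \<le> n \<Longrightarrow> Gid_le \<C> \<xi> A n"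
| step: "ETri A G K x y \<delta> \<in> \<xi> \<Longrightarrow> G \<in> GI \<C> \<xi> \<Longrightarrow> Gid_le \<C> \<xi> K (n - 1) \<Longrightarrow> Gid_le \<C> \<xi> A n"

text \<open>The infimum of the empty set is \<open>\<infinity>\<close>.\<close>

definition Gpd :: "('o, 'm, 'e) extri \<Rightarrow> ('o, 'm, 'e) etri set \<Rightarrow> 'o \<Rightarrow> ereal" where
  "Gpd \<C> \<xi> A = (INF n \<in> {n. Gpd_le \<C> \<xi> A n}. ereal (of_int n))"

definition Gid :: "('o, 'm, 'e) extri \<Rightarrow> ('o, 'm, 'e) etri set \<Rightarrow> 'o \<Rightarrow> ereal" where
  "Gid \<C> \<xi> A = (INF n \<in> {n. Gid_le \<C> \<xi> A n}. ereal (of_int n))"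

definition finite_Gpd :: "('o, 'm, 'e) extri \<Rightarrow> ('o, 'm, 'e) etri set \<Rightarrow> 'o set" where
  "finite_Gpd \<C> \<xi> = {A \<in> Obj \<C>. Gpd \<C> \<xi> A < \<infinity>}"


section \<open>Proper resolutions and relative Ext groups\<close>

text \<open>
  The complex \<open>\<dots> \<rightarrow> G 1 \<rightarrow> G 0 \<rightarrow> A \<rightarrow> 0\<close>, with augmentation \<open>d 0 : G 0 \<rightarrow> A\<close> and differentials
  \<open>d (n + 1) : G (n + 1) \<rightarrow> G n\<close>; the deleted complex forgets \<open>d 0\<close>.
\<close>

definition proper_GP_resolution ::
  "('o, 'm, 'e) extri \<Rightarrow> ('o, 'm, 'e) etri set \<Rightarrow> 'o \<Rightarrow> (nat \<Rightarrow> 'o) \<Rightarrow> (nat \<Rightarrow> 'm) \<Rightarrow> bool" where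
  "proper_GP_resolution \<C> \<xi> A G d \<longleftrightarrow>
     (\<forall>n. G n \<in> GP \<C> \<xi>) \<and>
     (\<exists>K g f \<delta>. K 0 = A \<and> d 0 = f 0 \<and> (\<forall>n. d (Suc n) = g n \<cdot>\<^bsub>\<C>\<^esub> f (Suc n)) \<and>
        (\<forall>n. ETri (K (Suc n)) (G n) (K n) (g n) (f n) (\<delta> n) \<in> \<xi> \<and>
             (\<forall>W \<in> GP \<C> \<xi>.
                covariant_exact \<C> W (ETri (K (Suc n)) (G n) (K n) (g n) (f n) (\<delta> n)))))"

definition Res_GP :: "('o, 'm, 'e) extri \<Rightarrow> ('o, 'm, 'e) etri set \<Rightarrow> 'o set" where
  "Res_GP \<C> \<xi> = {A \<in> Obj \<C>. \<exists>G d. proper_GP_resolution \<C> \<xi> A G d}"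

text \<open>
  Cohomology \<open>H\<^sup>n(\<C>(G\<^sup>\<sharp>, B))\<close>, with \<open>\<C>(G n, B)\<close> in degree \<open>n\<close>.
\<close>

definition hom_cocycles ::
  "('o, 'm, 'e) extri \<Rightarrow> (nat \<Rightarrow> 'o) \<Rightarrow> (nat \<Rightarrow> 'm) \<Rightarrow> 'o \<Rightarrow> nat \<Rightarrow> 'm set" where
  "hom_cocycles \<C> G d B n =
     kernel (Hom \<C> (G n) B) (Hom \<C> (G (Suc n)) B) (\<lambda>h. h \<cdot>\<^bsub>\<C>\<^esub> d (Suc n))"

fun hom_coboundaries ::
  "('o, 'm, 'e) extri \<Rightarrow> (nat \<Rightarrow> 'o) \<Rightarrow> (nat \<Rightarrow> 'm) \<Rightarrow> 'o \<Rightarrow> nat \<Rightarrow> 'm set" where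
  "hom_coboundaries \<C> G d B 0 = {\<one>\<^bsub>Hom \<C> (G 0) B\<^esub>}"
| "hom_coboundaries \<C> G d B (Suc n) = (\<lambda>h. h \<cdot>\<^bsub>\<C>\<^esub> d (Suc n)) ` arr \<C> (G n) B"

definition hom_cohomology ::
  "('o, 'm, 'e) extri \<Rightarrow> (nat \<Rightarrow> 'o) \<Rightarrow> (nat \<Rightarrow> 'm) \<Rightarrow> 'o \<Rightarrow> nat \<Rightarrow> 'm set monoid" where
  "hom_cohomology \<C> G d B n =
     (Hom \<C> (G n) B)\<lparr>carrier := hom_cocycles \<C> G d B n\<rparr> Mod hom_coboundaries \<C> G d B n"

text \<open>
  \<open>\<xi>xt\<^sup>n(A, B)\<close> for \<open>A\<close> in \<open>Res_GP\<close>.  Different proper resolutions give isomorphic groups, so one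
  is chosen.
\<close>

definition xi_xt ::
  "('o, 'm, 'e) extri \<Rightarrow> ('o, 'm, 'e) etri set \<Rightarrow> nat \<Rightarrow> 'o \<Rightarrow> 'o \<Rightarrow> 'm set monoid" where
  "xi_xt \<C> \<xi> n A B =
     (case SOME (G, d). proper_GP_resolution \<C> \<xi> A G d of (G, d) \<Rightarrow> hom_cohomology \<C> G d B n)"

end

theory Submission
  imports Defs
begin

text \<open>
  A projective cover and saturation show that an \<open>\<E>\<close>-triangle lies in \<open>\<xi>\<close> iff its extension is
  killed by pulling back to any \<open>\<xi>\<close>-projective.  Hence \<open>\<xi>\<close> is stable under the constructions of
  (ET4), pushouts and pullbacks, and \<open>\<G>\<P>(\<xi>)\<close>, which is the largest class with suitable one-step
  resolutions and coresolutions inside itself, is closed under extensions and under cokernels of split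
  monomorphisms from projectives.  This yields Auslander--Buchweitz approximations: if
  \<open>\<xi>-\<G>pd M \<le> n\<close>, then \<open>M\<close> has a resolution of length \<open>n\<close> with a Gorenstein projective in degree
  \<open>0\<close> and projectives elsewhere, over which all Gorenstein projectives lift.

  Such a resolution \<open>(G', K')\<close> and the chosen proper one \<open>(G, K)\<close> are compared by maps
  \<open>a : K \<rightarrow> K'\<close> and \<open>b : K' \<rightarrow> K\<close> with \<open>b a = 1 + f w\<close> in every degree.  If \<open>K'\<^sub>n\<close> is Gorenstein
  projective, \<open>b\<close> lifts along \<open>f\<^sub>n\<close>, so \<open>f\<^sub>n\<close> and all later \<open>f\<^sub>m\<close> are split epimorphisms and the cohomology
  vanishes above \<open>n\<close>.  Conversely, if \<open>K'\<^sub>m\<close> is projective with \<open>m > n\<close>, then \<open>a f\<^sub>m\<close> is a cocycle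
  with values in \<open>K'\<^sub>m\<close>; that it is a coboundary makes \<open>K'\<^sub>m \<rightarrow> G'\<^sub>m\<^sub>-\<^sub>1\<close> a split
  monomorphism, and the resolution can be shortened.
\<close>

section \<open>Arithmetic of arrows\<close>

text \<open>Inflations need not be monic nor deflations epic, and no higher extension groups are set
  up, so no long exact sequence can be chased. What remains are the half-exact sequences of an
  \<open>\<E>\<close>-triangle: an arrow lifts along the deflation iff it pulls the extension back
  to zero, and extends along the inflation iff it pushes it forward to zero; solutions are unique
  only up to an arrow through the neighbouring term. This indeterminacy is why the comparison maps
  satisfy \<open>b a = 1 + f w\<close> and not \<open>b a = 1\<close>: an endomorphism of a triangle
  that ends in \<open>1 + f w\<close> starts in \<open>1 + u g\<close>, and \<open>u\<close> factors
  through the next deflation because its source is Gorenstein projective, so the shape survives in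
  every degree.

  Kernels in the short resolution have finite projective dimension because relative extensions of
  Gorenstein projectives by such objects vanish, which is what makes Gorenstein projectives lift.
  Finiteness of the dimension provides a starting bound \<open>k \<ge> n\<close>: vanishing in
  degree \<open>k + 1\<close> lowers a bound \<open>k + 1\<close> to \<open>k\<close>, until
  \<open>n\<close> is reached.\<close>

text \<open>
  By \<open>hom_disjoint\<close> an arrow has a domain \<open>dm\<close> and a codomain \<open>cd\<close>, so that the axioms become
  rewrite rules whose side conditions the simplifier can discharge.
\<close>

context additive_category
begin

definition isarr :: "'m \<Rightarrow> bool" where
  "isarr f \<longleftrightarrow> (\<exists>A \<in> Obj \<C>. \<exists>B \<in> Obj \<C>. f \<in> arr \<C> A B)"

definition dm :: "'m \<Rightarrow> 'o" where
  "dm f = (THE A. A \<in> Obj \<C> \<and> (\<exists>B \<in> Obj \<C>. f \<in> arr \<C> A B))"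

definition cd :: "'m \<Rightarrow> 'o" where
  "cd f = (THE B. B \<in> Obj \<C> \<and> (\<exists>A \<in> Obj \<C>. f \<in> arr \<C> A B))"

definition zr :: "'o \<Rightarrow> 'o \<Rightarrow> 'm" where
  "zr A B = \<one>\<^bsub>Hom \<C> A B\<^esub>"

text \<open>The hom group is read off the first summand, so that sums, like composites, carry no
  object arguments; the rules below therefore ask for parallel arrows.\<close>

definition add :: "'m \<Rightarrow> 'm \<Rightarrow> 'm"  (infixl "\<boxplus>" 65) where
  "f \<boxplus> g = f \<otimes>\<^bsub>Hom \<C> (dm f) (cd f)\<^esub> g"

definition neg :: "'m \<Rightarrow> 'm" where
  "neg f = inv\<^bsub>Hom \<C> (dm f) (cd f)\<^esub> f"

abbreviation typed :: "'m \<Rightarrow> 'o \<Rightarrow> 'o \<Rightarrow> bool"  ("\<guillemotleft>_ : _ \<rightarrow> _\<guillemotright>") where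
  "\<guillemotleft>f : A \<rightarrow> B\<guillemotright> \<equiv> isarr f \<and> dm f = A \<and> cd f = B \<and> A \<in> Obj \<C> \<and> B \<in> Obj \<C>"

lemma typed_iff: "\<guillemotleft>f : A \<rightarrow> B\<guillemotright> \<longleftrightarrow> A \<in> Obj \<C> \<and> B \<in> Obj \<C> \<and> f \<in> arr \<C> A B"
proof
  assume f: "A \<in> Obj \<C> \<and> B \<in> Obj \<C> \<and> f \<in> arr \<C> A B"
  have "dm f = A" unfolding dm_def by (rule the_equality) (use f hom_disjoint in blast)+
  moreover have "cd f = B" unfolding cd_def by (rule the_equality) (use f hom_disjoint in blast)+
  ultimately show "\<guillemotleft>f : A \<rightarrow> B\<guillemotright>" using f by (auto simp: isarr_def)
next
  assume f: "\<guillemotleft>f : A \<rightarrow> B\<guillemotright>"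
  then obtain A' B' where AB: "A' \<in> Obj \<C>" "B' \<in> Obj \<C>" "f \<in> arr \<C> A' B'" by (auto simp: isarr_def)
  have "dm f = A'" unfolding dm_def by (rule the_equality) (use AB hom_disjoint in blast)+
  moreover have "cd f = B'" unfolding cd_def by (rule the_equality) (use AB hom_disjoint in blast)+
  ultimately show "A \<in> Obj \<C> \<and> B \<in> Obj \<C> \<and> f \<in> arr \<C> A B" using f AB by auto
qed

lemma arr_iff: "A \<in> Obj \<C> \<Longrightarrow> B \<in> Obj \<C> \<Longrightarrow> f \<in> arr \<C> A B \<longleftrightarrow> \<guillemotleft>f : A \<rightarrow> B\<guillemotright>"
  using typed_iff by blast

lemma isarr_typed: "isarr f \<Longrightarrow> dm f \<in> Obj \<C> \<and> cd f \<in> Obj \<C> \<and> f \<in> arr \<C> (dm f) (cd f)"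
  using typed_iff unfolding isarr_def by metis

lemma isarr_obj [simp]: "isarr f \<Longrightarrow> dm f \<in> Obj \<C>" "isarr f \<Longrightarrow> cd f \<in> Obj \<C>"
  using isarr_typed by auto

lemma comp_typed [simp]:
  assumes "isarr f" "isarr g" "cd f = dm g"
  shows "isarr (g \<cdot> f)" "dm (g \<cdot> f) = dm f" "cd (g \<cdot> f) = cd g"
proof -
  have "g \<cdot> f \<in> arr \<C> (dm f) (cd g)"
    using comp_closed isarr_typed[OF assms(1)] isarr_typed[OF assms(2)] assms(3) by metis
  then have "\<guillemotleft>g \<cdot> f : dm f \<rightarrow> cd g\<guillemotright>" using assms by (subst typed_iff) simp
  then show "isarr (g \<cdot> f)" "dm (g \<cdot> f) = dm f" "cd (g \<cdot> f) = cd g" by auto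
qed

lemma ide_typed [simp]:
  assumes "A \<in> Obj \<C>"
  shows "isarr (ide \<C> A)" "dm (ide \<C> A) = A" "cd (ide \<C> A) = A"
  using ide_closed[OF assms] typed_iff[of "ide \<C> A" A A] assms by auto

lemma zr_typed [simp]:
  assumes "A \<in> Obj \<C>" "B \<in> Obj \<C>"
  shows "isarr (zr A B)" "dm (zr A B) = A" "cd (zr A B) = B"
proof -
  interpret H: comm_group "Hom \<C> A B" by (rule hom_comm_group[OF assms])
  have "\<guillemotleft>zr A B : A \<rightarrow> B\<guillemotright>" using assms by (subst typed_iff) (simp add: zr_def)
  then show "isarr (zr A B)" "dm (zr A B) = A" "cd (zr A B) = B" by auto
qed

lemma add_typed [simp]:
  assumes "isarr f" "isarr g" "dm f = dm g" "cd f = cd g"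
  shows "isarr (f \<boxplus> g)" "dm (f \<boxplus> g) = dm g" "cd (f \<boxplus> g) = cd g"
proof -
  interpret H: comm_group "Hom \<C> (dm g) (cd g)" by (rule hom_comm_group) (use assms in auto)
  have "f \<boxplus> g \<in> arr \<C> (dm g) (cd g)"
    using isarr_typed[OF assms(1)] isarr_typed[OF assms(2)] assms by (auto simp: add_def)
  then have "\<guillemotleft>f \<boxplus> g : dm g \<rightarrow> cd g\<guillemotright>" using assms by (subst typed_iff) simp
  then show "isarr (f \<boxplus> g)" "dm (f \<boxplus> g) = dm g" "cd (f \<boxplus> g) = cd g" by auto
qed

lemma neg_typed [simp]:
  assumes "isarr f"
  shows "isarr (neg f)" "dm (neg f) = dm f" "cd (neg f) = cd f"
proof -
  interpret H: comm_group "Hom \<C> (dm f) (cd f)" by (rule hom_comm_group) (use assms in auto)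
  have "\<guillemotleft>neg f : dm f \<rightarrow> cd f\<guillemotright>"
    using isarr_typed[OF assms] by (subst typed_iff) (auto simp: neg_def)
  then show "isarr (neg f)" "dm (neg f) = dm f" "cd (neg f) = cd f" by auto
qed

lemma comp_assoc' [simp]:
  assumes "isarr f" "isarr g" "isarr h" "cd f = dm g" "cd g = dm h"
  shows "(h \<cdot> g) \<cdot> f = h \<cdot> (g \<cdot> f)"
  using comp_assoc isarr_typed[OF assms(1)] isarr_typed[OF assms(2)] isarr_typed[OF assms(3)] assms(4,5)
  by metis

lemma comp_ide [simp]:
  "isarr f \<Longrightarrow> dm f = A \<Longrightarrow> f \<cdot> ide \<C> A = f"
  "isarr f \<Longrightarrow> cd f = A \<Longrightarrow> ide \<C> A \<cdot> f = f"
  using ide_left ide_right isarr_typed by metis+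

lemma add_comm:
  assumes "isarr f" "isarr g" "dm f = dm g" "cd f = cd g"
  shows "f \<boxplus> g = g \<boxplus> f"
proof -
  interpret H: comm_group "Hom \<C> (dm g) (cd g)" by (rule hom_comm_group) (use assms in auto)
  show ?thesis
    using isarr_typed[OF assms(1)] isarr_typed[OF assms(2)] assms H.m_comm by (simp add: add_def)
qed

lemma add_assoc:
  assumes "isarr f" "isarr g" "isarr h" "dm f = dm g" "cd f = cd g" "dm g = dm h" "cd g = cd h"
  shows "(f \<boxplus> g) \<boxplus> h = f \<boxplus> (g \<boxplus> h)"
proof -
  interpret H: comm_group "Hom \<C> (dm g) (cd g)" by (rule hom_comm_group) (use assms in auto)
  have "(f \<boxplus> g) \<boxplus> h = (f \<otimes>\<^bsub>Hom \<C> (dm g) (cd g)\<^esub> g) \<otimes>\<^bsub>Hom \<C> (dm g) (cd g)\<^esub> h"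
    using add_typed[of f g] assms by (simp add: add_def)
  then show ?thesis
    using isarr_typed[OF assms(1)] isarr_typed[OF assms(2)] isarr_typed[OF assms(3)] assms H.m_assoc
    by (simp add: add_def)
qed

lemma add_zr [simp]:
  assumes "isarr f" "dm f = A" "cd f = B"
  shows "f \<boxplus> zr A B = f" "zr A B \<boxplus> f = f"
proof -
  interpret H: comm_group "Hom \<C> A B" by (rule hom_comm_group) (use assms in auto)
  show "f \<boxplus> zr A B = f"
    using isarr_typed[OF assms(1)] assms by (auto simp: add_def zr_def)
  then show "zr A B \<boxplus> f = f" using add_comm[of f "zr A B"] assms by auto
qed

lemma add_neg [simp]:
  assumes "isarr f"
  shows "f \<boxplus> neg f = zr (dm f) (cd f)" "neg f \<boxplus> f = zr (dm f) (cd f)"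
proof -
  interpret H: comm_group "Hom \<C> (dm f) (cd f)" by (rule hom_comm_group) (use assms in auto)
  show "f \<boxplus> neg f = zr (dm f) (cd f)"
    using isarr_typed[OF assms(1)] assms by (auto simp: add_def zr_def neg_def)
  then show "neg f \<boxplus> f = zr (dm f) (cd f)" using add_comm[of f "neg f"] assms by auto
qed

lemma comp_add [simp]:
  assumes "isarr f" "isarr f'" "isarr g" "dm f = dm f'" "cd f = cd f'" "cd f' = dm g"
  shows "g \<cdot> (f \<boxplus> f') = g \<cdot> f \<boxplus> g \<cdot> f'"
  using comp_add_right[of "dm f'" "cd f'" "cd g" f f' g] isarr_typed[of f] isarr_typed[of f']
    isarr_typed[of g] assms by (simp add: add_def)

lemma add_comp [simp]:
  assumes "isarr f" "isarr g" "isarr g'" "dm g = dm g'" "cd g = cd g'" "cd f = dm g'"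
  shows "(g \<boxplus> g') \<cdot> f = g \<cdot> f \<boxplus> g' \<cdot> f"
  using comp_add_left[of "dm f" "dm g'" "cd g'" f g g'] isarr_typed[of f] isarr_typed[of g]
    isarr_typed[of g'] assms by (simp add: add_def)

lemma add_cancel:
  assumes "isarr f" "isarr g" "dm f = dm g" "cd f = cd g" "f \<boxplus> g = g"
  shows "f = zr (dm g) (cd g)"
proof -
  have "f = f \<boxplus> (g \<boxplus> neg g)" using assms by simp
  also have "\<dots> = (f \<boxplus> g) \<boxplus> neg g" using assms by (subst add_assoc) auto
  also have "\<dots> = zr (dm g) (cd g)" using assms by simp
  finally show ?thesis .
qed

lemma comp_zr [simp]:
  assumes "isarr g" "dm g = B" "A \<in> Obj \<C>"
  shows "g \<cdot> zr A B = zr A (cd g)"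
proof -
  have B: "B \<in> Obj \<C>" using assms by auto
  have "g \<cdot> zr A B = g \<cdot> zr A B \<boxplus> g \<cdot> zr A B"
    using assms B by (subst comp_add[symmetric]) auto
  then have "g \<cdot> zr A B = zr (dm (g \<cdot> zr A B)) (cd (g \<cdot> zr A B))"
    using assms B by (intro add_cancel) auto
  then show ?thesis using assms B by simp
qed

lemma zr_comp [simp]:
  assumes "isarr f" "cd f = A" "B \<in> Obj \<C>"
  shows "zr A B \<cdot> f = zr (dm f) B"
proof -
  have A: "A \<in> Obj \<C>" using assms by auto
  have "zr A B \<cdot> f = zr A B \<cdot> f \<boxplus> zr A B \<cdot> f"
    using assms A by (subst add_comp[symmetric]) auto
  then have "zr A B \<cdot> f = zr (dm (zr A B \<cdot> f)) (cd (zr A B \<cdot> f))"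
    using assms A by (intro add_cancel) auto
  then show ?thesis using assms A by simp
qed

lemma add_solve:
  assumes "isarr f" "isarr g" "isarr h" "dm f = dm g" "cd f = cd g" "dm g = dm h" "cd g = cd h"
  shows "f = g \<boxplus> h \<longleftrightarrow> f \<boxplus> neg h = g"
proof
  assume "f = g \<boxplus> h"
  then show "f \<boxplus> neg h = g" using assms by (simp add: add_assoc)
next
  assume "f \<boxplus> neg h = g"
  then have "g \<boxplus> h = f \<boxplus> neg h \<boxplus> h" by simp
  also have "\<dots> = f" using assms by (simp add: add_assoc)
  finally show "f = g \<boxplus> h" by simp
qed

lemma neg_unique:
  assumes "isarr f" "isarr g" "dm f = dm g" "cd f = cd g" "f \<boxplus> g = zr (dm g) (cd g)"
  shows "f = neg g"
  using add_solve[of "zr (dm g) (cd g)" f g] assms by auto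

lemma comp_neg [simp]:
  assumes "isarr f" "isarr g" "cd f = dm g"
  shows "g \<cdot> neg f = neg (g \<cdot> f)"
  using assms by (intro neg_unique) (auto simp flip: comp_add)

lemma neg_comp [simp]:
  assumes "isarr f" "isarr g" "cd f = dm g"
  shows "neg g \<cdot> f = neg (g \<cdot> f)"
  using assms by (intro neg_unique) (auto simp flip: add_comp)

text \<open>Composites are normalised to the right, so an equation for \<open>g \<cdot> f\<close> no
  longer matches inside \<open>g \<cdot> (f \<cdot> t)\<close>; this instance restores it.\<close>

lemma comp_subst:
  assumes "g \<cdot> f = h" "isarr f" "isarr g" "isarr t" "cd f = dm g" "cd t = dm f"
  shows "g \<cdot> (f \<cdot> t) = h \<cdot> t"
  using assms comp_assoc'[of t f g] by simp

lemma zero_obj_typed: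
  assumes "is_zero_obj \<C> Z"
  shows "Z \<in> Obj \<C>" "\<guillemotleft>f : A \<rightarrow> Z\<guillemotright> \<Longrightarrow> f = zr A Z" "\<guillemotleft>f : Z \<rightarrow> A\<guillemotright> \<Longrightarrow> f = zr Z A"
    "zr Z Z = ide \<C> Z"
proof -
  have Z: "Z \<in> Obj \<C>" "\<And>A. A \<in> Obj \<C> \<Longrightarrow> \<exists>!f. f \<in> arr \<C> Z A" "\<And>A. A \<in> Obj \<C> \<Longrightarrow> \<exists>!f. f \<in> arr \<C> A Z"
    using assms by (auto simp: is_zero_obj_def)
  show Z1: "Z \<in> Obj \<C>" by (rule Z)
  have *: "f = zr A Z" if "\<guillemotleft>f : A \<rightarrow> Z\<guillemotright>" for f A
  proof -
    have "A \<in> Obj \<C>" "\<guillemotleft>zr A Z : A \<rightarrow> Z\<guillemotright>" using that Z1 by auto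
    then show ?thesis using that Z(3)[of A] typed_iff by metis
  qed
  then show "\<guillemotleft>f : A \<rightarrow> Z\<guillemotright> \<Longrightarrow> f = zr A Z" .
  show "f = zr Z A" if "\<guillemotleft>f : Z \<rightarrow> A\<guillemotright>" for f A
  proof -
    have "A \<in> Obj \<C>" "\<guillemotleft>zr Z A : Z \<rightarrow> A\<guillemotright>" using that Z1 by auto
    then show ?thesis using that Z(2)[of A] typed_iff by metis
  qed
  show "zr Z Z = ide \<C> Z" using *[where f = "ide \<C> Z" and A = Z] Z1 by auto
qed

section \<open>Isomorphisms as pairs of mutually inverse arrows\<close>

definition inverse_arrows :: "'m \<Rightarrow> 'm \<Rightarrow> 'o \<Rightarrow> 'o \<Rightarrow> bool" where
  "inverse_arrows f g A B \<longleftrightarrow> \<guillemotleft>f : A \<rightarrow> B\<guillemotright> \<and> \<guillemotleft>g : B \<rightarrow> A\<guillemotright> \<and> g \<cdot> f = ide \<C> A \<and> f \<cdot> g = ide \<C> B"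

lemma is_iso_arr_iff:
  "A \<in> Obj \<C> \<Longrightarrow> B \<in> Obj \<C> \<Longrightarrow> is_iso_arr \<C> A B f \<longleftrightarrow> (\<exists>g. inverse_arrows f g A B)"
  by (auto simp: is_iso_arr_def inverse_arrows_def arr_iff)

lemma inverse_arrows_sym: "inverse_arrows f g A B \<Longrightarrow> inverse_arrows g f B A"
  by (auto simp: inverse_arrows_def)

lemma inverse_arrows_of_one_sided:
  assumes "\<guillemotleft>f : A \<rightarrow> B\<guillemotright>" "\<guillemotleft>g : B \<rightarrow> A\<guillemotright>" "\<guillemotleft>h : B \<rightarrow> A\<guillemotright>" "g \<cdot> f = ide \<C> A" "f \<cdot> h = ide \<C> B"
  shows "inverse_arrows f g A B"
proof -
  have "g = g \<cdot> (f \<cdot> h)" using assms by simp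
  also have "\<dots> = h" using assms comp_subst[of g f "ide \<C> A" h] by simp
  finally show ?thesis using assms by (auto simp: inverse_arrows_def)
qed

end

section \<open>Extensions and triangles\<close>

declare is_etri.simps [simp del]

context extriangulated_category
begin

abbreviation tri :: "'o \<Rightarrow> 'o \<Rightarrow> 'o \<Rightarrow> 'm \<Rightarrow> 'm \<Rightarrow> 'e \<Rightarrow> bool" where
  "tri A B C x y \<delta> \<equiv> is_etri \<C> (ETri A B C x y \<delta>)"

abbreviation E :: "'o \<Rightarrow> 'o \<Rightarrow> 'e set" where
  "E C A \<equiv> carrier (Ext \<C> C A)"

section \<open>Pushforward and pullback of extensions\<close>

definition ze :: "'o \<Rightarrow> 'o \<Rightarrow> 'e" where
  "ze C A = \<one>\<^bsub>Ext \<C> C A\<^esub>"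

lemma Emap_typed:
  assumes "\<guillemotleft>c : C' \<rightarrow> C\<guillemotright>" "\<guillemotleft>a : A \<rightarrow> A'\<guillemotright>" "\<delta> \<in> E C A"
  shows "Emap \<C> c a \<delta> \<in> E C' A'" "Emap \<C> c a (ze C A) = ze C' A'"
proof -
  have h: "Emap \<C> c a \<in> hom (Ext \<C> C A) (Ext \<C> C' A')"
    using assms emap_hom typed_iff by metis
  interpret group_hom "Ext \<C> C A" "Ext \<C> C' A'" "Emap \<C> c a"
    using h ext_comm_group assms
    by (auto simp: group_hom_def group_hom_axioms_def comm_group_def)
  show "Emap \<C> c a \<delta> \<in> E C' A'" "Emap \<C> c a (ze C A) = ze C' A'"
    using assms by (auto simp: ze_def)
qed

lemma ze_closed [simp]: "C \<in> Obj \<C> \<Longrightarrow> A \<in> Obj \<C> \<Longrightarrow> ze C A \<in> E C A"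
  using ext_comm_group[of C A] by (simp add: ze_def comm_group_def group.is_monoid)

lemma pull_closed [simp]:
  assumes "isarr c" "dm c = C'" "A \<in> Obj \<C>" "\<delta> \<in> E (cd c) A"
  shows "pull \<C> A c \<delta> \<in> E C' A"
  by (rule Emap_typed) (use assms in auto)

lemma push_closed [simp]:
  assumes "isarr a" "cd a = A'" "C \<in> Obj \<C>" "\<delta> \<in> E C (dm a)"
  shows "push \<C> C a \<delta> \<in> E C A'"
  by (rule Emap_typed) (use assms in auto)

lemma pull_ze [simp]:
  assumes "isarr c" "cd c = C" "A \<in> Obj \<C>"
  shows "pull \<C> A c (ze C A) = ze (dm c) A"
  by (rule Emap_typed(2)[where \<delta> = "ze C A"]) (use assms in auto)

lemma push_ze [simp]:
  assumes "isarr a" "dm a = A" "C \<in> Obj \<C>"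
  shows "push \<C> C a (ze C A) = ze C (cd a)"
  by (rule Emap_typed(2)[where \<delta> = "ze C A"]) (use assms in auto)

lemma push_ide [simp]:
  "C \<in> Obj \<C> \<Longrightarrow> A \<in> Obj \<C> \<Longrightarrow> \<delta> \<in> E C A \<Longrightarrow> push \<C> C (ide \<C> A) \<delta> = \<delta>"
  by (rule emap_ide)

lemma pull_comp:
  assumes "isarr c" "isarr c'" "cd c' = dm c" "A \<in> Obj \<C>" "\<delta> \<in> E (cd c) A"
  shows "pull \<C> A (c \<cdot> c') \<delta> = pull \<C> A c' (pull \<C> A c \<delta>)"
  using emap_comp[of "cd c" "dm c" "dm c'" A A A c c' "ide \<C> A" "ide \<C> A" \<delta>]
    isarr_typed[OF assms(1)] isarr_typed[OF assms(2)] assms by (simp add: arr_iff)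

lemma push_comp:
  assumes "isarr a" "isarr a'" "cd a = dm a'" "C \<in> Obj \<C>" "\<delta> \<in> E C (dm a)"
  shows "push \<C> C (a' \<cdot> a) \<delta> = push \<C> C a' (push \<C> C a \<delta>)"
  using emap_comp[of C C C "dm a" "cd a" "cd a'" "ide \<C> C" "ide \<C> C" a a' \<delta>]
    isarr_typed[OF assms(1)] isarr_typed[OF assms(2)] assms by (simp add: arr_iff)

lemma push_pull:
  assumes "\<guillemotleft>c : C' \<rightarrow> C\<guillemotright>" "\<guillemotleft>a : A \<rightarrow> A'\<guillemotright>" "\<delta> \<in> E C A"
  shows "push \<C> C' a (pull \<C> A c \<delta>) = pull \<C> A' c (push \<C> C a \<delta>)"
proof -
  have "push \<C> C' a (pull \<C> A c \<delta>) = Emap \<C> (c \<cdot> ide \<C> C') (a \<cdot> ide \<C> A) \<delta>"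
    by (rule emap_comp[symmetric, where C = C and C' = C' and C'' = C' and A = A and A' = A and A'' = A']) (use assms in \<open>auto simp: arr_iff\<close>)
  also have "\<dots> = Emap \<C> (ide \<C> C \<cdot> c) (ide \<C> A' \<cdot> a) \<delta>" using assms by simp
  also have "\<dots> = pull \<C> A' c (push \<C> C a \<delta>)"
    by (rule emap_comp[where C = C and C' = C and C'' = C' and A = A and A' = A' and A'' = A']) (use assms in \<open>auto simp: arr_iff\<close>)
  finally show ?thesis .
qed

lemma pull_add:
  assumes "\<guillemotleft>c : C' \<rightarrow> C\<guillemotright>" "\<guillemotleft>d : C' \<rightarrow> C\<guillemotright>" "A \<in> Obj \<C>" "\<delta> \<in> E C A"
  shows "pull \<C> A (c \<boxplus> d) \<delta> = pull \<C> A c \<delta> \<otimes>\<^bsub>Ext \<C> C' A\<^esub> pull \<C> A d \<delta>"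
  using emap_add_left[of C C' A A c d "ide \<C> A" \<delta>] assms by (simp add: arr_iff add_def)

lemma push_add:
  assumes "\<guillemotleft>a : A \<rightarrow> A'\<guillemotright>" "\<guillemotleft>b : A \<rightarrow> A'\<guillemotright>" "C \<in> Obj \<C>" "\<delta> \<in> E C A"
  shows "push \<C> C (a \<boxplus> b) \<delta> = push \<C> C a \<delta> \<otimes>\<^bsub>Ext \<C> C A'\<^esub> push \<C> C b \<delta>"
  using emap_add_right[of C C A A' "ide \<C> C" a b \<delta>] assms by (simp add: arr_iff add_def)

lemma pull_zr [simp]:
  assumes "C \<in> Obj \<C>" "C' \<in> Obj \<C>" "A \<in> Obj \<C>" "\<delta> \<in> E C A"
  shows "pull \<C> A (zr C' C) \<delta> = ze C' A"
proof -
  interpret comm_group "Ext \<C> C' A" using ext_comm_group assms by simp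
  have "zr C' C \<boxplus> zr C' C = zr C' C" using assms by simp
  then have "pull \<C> A (zr C' C) \<delta> \<otimes>\<^bsub>Ext \<C> C' A\<^esub> pull \<C> A (zr C' C) \<delta> = pull \<C> A (zr C' C) \<delta>"
    using pull_add[of "zr C' C" C' C "zr C' C" A \<delta>] assms by simp
  then show ?thesis using assms l_cancel_one[of "pull \<C> A (zr C' C) \<delta>" "pull \<C> A (zr C' C) \<delta>"]
    by (simp add: ze_def)
qed

lemma push_zr [simp]:
  assumes "C \<in> Obj \<C>" "A' \<in> Obj \<C>" "A \<in> Obj \<C>" "\<delta> \<in> E C A"
  shows "push \<C> C (zr A A') \<delta> = ze C A'"
proof -
  interpret comm_group "Ext \<C> C A'" using ext_comm_group assms by simp
  have "zr A A' \<boxplus> zr A A' = zr A A'" using assms by simp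
  then have "push \<C> C (zr A A') \<delta> \<otimes>\<^bsub>Ext \<C> C A'\<^esub> push \<C> C (zr A A') \<delta> = push \<C> C (zr A A') \<delta>"
    using push_add[of "zr A A'" A A' "zr A A'" C \<delta>] assms by simp
  then show ?thesis using assms l_cancel_one[of "push \<C> C (zr A A') \<delta>" "push \<C> C (zr A A') \<delta>"]
    by (simp add: ze_def)
qed

text \<open>\<open>is_etri\<close> says nothing about \<open>B\<close>, \<open>x\<close> and
  \<open>y\<close> beyond membership in the class, and the axiom supplies only one generating
  sequence. As isomorphism over \<open>A\<close> and \<open>C\<close> is an equivalence, every
  member generates the same class, and the typing comes with it.\<close>

lemma tri_class:
  assumes "tri A B C x y \<delta>"
  shows "\<guillemotleft>x : A \<rightarrow> B\<guillemotright> \<and> \<guillemotleft>y : B \<rightarrow> C\<guillemotright> \<and> \<delta> \<in> E C A"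
    and "Realiz \<C> C A \<delta> = seq_class \<C> A B C x y"
proof -
  have *: "A \<in> Obj \<C>" "C \<in> Obj \<C>" "\<delta> \<in> E C A" "(B, x, y) \<in> Realiz \<C> C A \<delta>"
    using assms by (auto simp: is_etri.simps)
  obtain B0 x0 y0 where 0: "B0 \<in> Obj \<C>" "x0 \<in> arr \<C> A B0" "y0 \<in> arr \<C> B0 C"
    "Realiz \<C> C A \<delta> = seq_class \<C> A B0 C x0 y0"
    using realization_class[OF *(2,1,3)] by auto
  have 1: "B \<in> Obj \<C>" "x \<in> arr \<C> A B" "y \<in> arr \<C> B C"
    using *(4) 0 by (auto simp: seq_class_def)
  then show "\<guillemotleft>x : A \<rightarrow> B\<guillemotright> \<and> \<guillemotleft>y : B \<rightarrow> C\<guillemotright> \<and> \<delta> \<in> E C A" using * typed_iff by blast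
  obtain b b' where b: "inverse_arrows b b' B0 B" "b \<cdot> x0 = x" "y \<cdot> b = y0"
    using *(4) 0 1 by (auto simp: seq_class_def is_iso_arr_iff)
  have t: "\<guillemotleft>x0 : A \<rightarrow> B0\<guillemotright>" "\<guillemotleft>y0 : B0 \<rightarrow> C\<guillemotright>" using * 0 typed_iff by blast+
  have "seq_class \<C> A B0 C x0 y0 = seq_class \<C> A B C x y"
  proof -
    have "(\<exists>v. is_iso_arr \<C> B0 B' v \<and> v \<cdot> x0 = x' \<and> y' \<cdot> v = y0)
       \<longleftrightarrow> (\<exists>v. is_iso_arr \<C> B B' v \<and> v \<cdot> x = x' \<and> y' \<cdot> v = y)" (is "?L \<longleftrightarrow> ?R")
      if B': "B' \<in> Obj \<C>" "x' \<in> arr \<C> A B'" "y' \<in> arr \<C> B' C" for B' x' y'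
    proof -
      have t': "\<guillemotleft>x' : A \<rightarrow> B'\<guillemotright>" "\<guillemotleft>y' : B' \<rightarrow> C\<guillemotright>" using * B' typed_iff by blast+
      have bb: "\<guillemotleft>b : B0 \<rightarrow> B\<guillemotright>" "\<guillemotleft>b' : B \<rightarrow> B0\<guillemotright>" "b' \<cdot> b = ide \<C> B0" "b \<cdot> b' = ide \<C> B"
        using b by (auto simp: inverse_arrows_def)
      show ?thesis
      proof
        assume ?L
        then obtain v w where v: "inverse_arrows v w B0 B'" "v \<cdot> x0 = x'" "y' \<cdot> v = y0"
          using 0 B' by (auto simp: is_iso_arr_iff)
        then have vv: "\<guillemotleft>v : B0 \<rightarrow> B'\<guillemotright>" "\<guillemotleft>w : B' \<rightarrow> B0\<guillemotright>" "w \<cdot> v = ide \<C> B0" "v \<cdot> w = ide \<C> B'"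
          by (auto simp: inverse_arrows_def)
        have "inverse_arrows (v \<cdot> b') (b \<cdot> w) B B'"
          using vv bb comp_subst[of w v _ b'] comp_subst[of b' b _ w] unfolding inverse_arrows_def by auto
        moreover have "(v \<cdot> b') \<cdot> x = x'"
          using vv bb t v b comp_subst[of b' b _ x0] by auto
        moreover have "y' \<cdot> (v \<cdot> b') = y"
        proof -
          have "y' \<cdot> (v \<cdot> b') = (y' \<cdot> v) \<cdot> b'" using vv bb t' by simp
          also have "\<dots> = (y \<cdot> b) \<cdot> b'" using v b by simp
          also have "\<dots> = y" using bb 1 * typed_iff[of y B C] by auto
          finally show ?thesis .
        qed
        ultimately show ?R using 1 B' is_iso_arr_iff by blast
      next
        assume ?R
        then obtain v w where v: "inverse_arrows v w B B'" "v \<cdot> x = x'" "y' \<cdot> v = y"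
          using 1 B' by (auto simp: is_iso_arr_iff)
        then have vv: "\<guillemotleft>v : B \<rightarrow> B'\<guillemotright>" "\<guillemotleft>w : B' \<rightarrow> B\<guillemotright>" "w \<cdot> v = ide \<C> B" "v \<cdot> w = ide \<C> B'"
          by (auto simp: inverse_arrows_def)
        have "inverse_arrows (v \<cdot> b) (b' \<cdot> w) B0 B'"
          using vv bb comp_subst[of w v _ b] comp_subst[of b b' _ w] unfolding inverse_arrows_def by auto
        moreover have "(v \<cdot> b) \<cdot> x0 = x'" using vv bb t v b by auto
        moreover have "y' \<cdot> (v \<cdot> b) = y0"
        proof -
          have "y' \<cdot> (v \<cdot> b) = (y' \<cdot> v) \<cdot> b" using vv bb t' by simp
          then show ?thesis using v b by simp
        qed
        ultimately show ?L using 0 B' is_iso_arr_iff by blast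
      qed
    qed
    then show ?thesis unfolding seq_class_def by blast
  qed
  then show "Realiz \<C> C A \<delta> = seq_class \<C> A B C x y" using 0 by simp
qed

lemma triD:
  assumes "tri A B C x y \<delta>"
  shows "A \<in> Obj \<C>" "B \<in> Obj \<C>" "C \<in> Obj \<C>" "\<guillemotleft>x : A \<rightarrow> B\<guillemotright>" "\<guillemotleft>y : B \<rightarrow> C\<guillemotright>" "\<delta> \<in> E C A"
  using tri_class(1)[OF assms] by auto

lemma tri_exists:
  assumes "C \<in> Obj \<C>" "A \<in> Obj \<C>" "\<delta> \<in> E C A"
  obtains B x y where "tri A B C x y \<delta>"
proof -
  obtain B x y where B: "B \<in> Obj \<C>" "x \<in> arr \<C> A B" "y \<in> arr \<C> B C"
    "Realiz \<C> C A \<delta> = seq_class \<C> A B C x y"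
    using realization_class[OF assms] by auto
  have "inverse_arrows (ide \<C> B) (ide \<C> B) B B" using B by (auto simp: inverse_arrows_def)
  moreover have "\<guillemotleft>x : A \<rightarrow> B\<guillemotright>" "\<guillemotleft>y : B \<rightarrow> C\<guillemotright>" using assms B typed_iff by blast+
  ultimately have "(B, x, y) \<in> Realiz \<C> C A \<delta>"
    using B is_iso_arr_iff[of B B "ide \<C> B"] by (auto simp: seq_class_def intro!: exI[of _ "ide \<C> B"])
  then show ?thesis using assms that by (auto simp: is_etri.simps)
qed

lemma tri_middle_iso:
  assumes "tri A B C x y \<delta>" "inverse_arrows b b' B B'" "\<guillemotleft>x' : A \<rightarrow> B'\<guillemotright>" "\<guillemotleft>y' : B' \<rightarrow> C\<guillemotright>"
    "b \<cdot> x = x'" "y' \<cdot> b = y"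
  shows "tri A B' C x' y' \<delta>"
proof -
  have "(B', x', y') \<in> seq_class \<C> A B C x y"
    using assms typed_iff triD[OF assms(1)] is_iso_arr_iff[of B B' b] unfolding seq_class_def by blast
  then show ?thesis using tri_class[OF assms(1)] assms by (auto simp: is_etri.simps)
qed

lemma tri_unique:
  assumes "tri A B C x y \<delta>" "tri A B' C x' y' \<delta>"
  obtains b b' where "inverse_arrows b b' B B'" "b \<cdot> x = x'" "y' \<cdot> b = y"
proof -
  have "(B', x', y') \<in> seq_class \<C> A B C x y"
    using tri_class(2)[OF assms(1)] assms(2) by (auto simp: is_etri.simps)
  then show ?thesis
    using that is_iso_arr_iff triD[OF assms(1)] triD[OF assms(2)] by (auto simp: seq_class_def)
qed

text \<open>The hypotheses are the biproduct identities, and the zero extension is realized by any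
  biproduct of \<open>A\<close> and \<open>C\<close>.\<close>

lemma split_tri:
  assumes "\<guillemotleft>x : A \<rightarrow> B\<guillemotright>" "\<guillemotleft>y : B \<rightarrow> C\<guillemotright>" "\<guillemotleft>r : B \<rightarrow> A\<guillemotright>" "\<guillemotleft>s : C \<rightarrow> B\<guillemotright>"
    "r \<cdot> x = ide \<C> A" "y \<cdot> s = ide \<C> C" "y \<cdot> x = zr A C" "r \<cdot> s = zr C A"
    "x \<cdot> r \<boxplus> s \<cdot> y = ide \<C> B"
  shows "tri A B C x y (ze C A)"
proof -
  define S where "S = \<lparr>bobj = B, inj1 = x, inj2 = s, pr1 = r, pr2 = y\<rparr>"
  have "is_biproduct \<C> A C S"
    using assms by (auto simp: is_biproduct_def S_def arr_iff zr_def add_def)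
  from realization_zero[OF this] have "Realiz \<C> C A (ze C A) = seq_class \<C> A B C x y"
    by (simp add: S_def ze_def)
  moreover have "inverse_arrows (ide \<C> B) (ide \<C> B) B B" using assms by (simp add: inverse_arrows_def)
  then have "is_iso_arr \<C> B B (ide \<C> B)" using assms is_iso_arr_iff by blast
  ultimately show ?thesis
    using assms by (auto simp: is_etri.simps seq_class_def arr_iff)
qed

text \<open>Projection and injection of a biproduct, transported along the isomorphism of middle
  terms.\<close>

lemma tri_split:
  assumes "tri A B C x y (ze C A)"
  obtains r s where "\<guillemotleft>r : B \<rightarrow> A\<guillemotright>" "\<guillemotleft>s : C \<rightarrow> B\<guillemotright>"
    "r \<cdot> x = ide \<C> A" "y \<cdot> s = ide \<C> C" "y \<cdot> x = zr A C" "r \<cdot> s = zr C A"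
    "x \<cdot> r \<boxplus> s \<cdot> y = ide \<C> B"
proof -
  note T = triD[OF assms]
  obtain S where S: "is_biproduct \<C> A C S" using biproduct_exists T by blast
  define D i j p q where "D = bobj S" and "i = inj1 S" and "j = inj2 S" and "p = pr1 S" and "q = pr2 S"
  have D: "D \<in> Obj \<C>" "\<guillemotleft>i : A \<rightarrow> D\<guillemotright>" "\<guillemotleft>j : C \<rightarrow> D\<guillemotright>" "\<guillemotleft>p : D \<rightarrow> A\<guillemotright>" "\<guillemotleft>q : D \<rightarrow> C\<guillemotright>"
    and e: "p \<cdot> i = ide \<C> A" "q \<cdot> j = ide \<C> C" "p \<cdot> j = zr C A" "q \<cdot> i = zr A C"
    using S T by (auto simp: is_biproduct_def D_def i_def j_def p_def q_def arr_iff zr_def)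
  have e': "i \<cdot> p \<boxplus> j \<cdot> q = ide \<C> D"
    using S D by (auto simp: is_biproduct_def D_def i_def j_def p_def q_def add_def)
  have "Realiz \<C> C A (ze C A) = seq_class \<C> A D C i q"
    using realization_zero[OF S] by (simp add: D_def i_def q_def ze_def)
  then have "(B, x, y) \<in> seq_class \<C> A D C i q" using assms by (auto simp: is_etri.simps)
  then obtain b b' where b: "inverse_arrows b b' D B" "b \<cdot> i = x" "y \<cdot> b = q"
    using D T by (auto simp: seq_class_def is_iso_arr_iff)
  have bb: "\<guillemotleft>b : D \<rightarrow> B\<guillemotright>" "\<guillemotleft>b' : B \<rightarrow> D\<guillemotright>" "b' \<cdot> b = ide \<C> D" "b \<cdot> b' = ide \<C> B"
    using b by (auto simp: inverse_arrows_def)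
  have y: "y = q \<cdot> b'" using comp_assoc'[of b' b y] bb T b by simp
  have b1: "b' \<cdot> (b \<cdot> t) = t" if "isarr t" "cd t = D" for t
    using that bb comp_subst[of b' b _ t] by simp
  have "b \<cdot> (i \<cdot> (p \<cdot> b')) \<boxplus> b \<cdot> (j \<cdot> (q \<cdot> b')) = b \<cdot> (((i \<cdot> p) \<boxplus> (j \<cdot> q)) \<cdot> b')"
    using D bb by simp
  also have "\<dots> = ide \<C> B" using e' bb D by simp
  finally have sum: "b \<cdot> (i \<cdot> (p \<cdot> b')) \<boxplus> b \<cdot> (j \<cdot> (q \<cdot> b')) = ide \<C> B" .
  show ?thesis
  proof (rule that[of "p \<cdot> b'" "b \<cdot> j"])
    show "(p \<cdot> b') \<cdot> x = ide \<C> A" unfolding b(2)[symmetric] using D bb e b1 by simp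
    show "y \<cdot> (b \<cdot> j) = ide \<C> C" unfolding y using D bb e b1 by simp
    show "y \<cdot> x = zr A C" unfolding y b(2)[symmetric] using D bb e b1 by simp
    show "(p \<cdot> b') \<cdot> (b \<cdot> j) = zr C A" using D bb e b1 by simp
    show "x \<cdot> (p \<cdot> b') \<boxplus> (b \<cdot> j) \<cdot> y = ide \<C> B"
      unfolding y b(2)[symmetric] using D bb sum by simp
  qed (use D bb in auto)
qed

subsection \<open>Exact sequences of a triangle\<close>

lemma tri_morphism:
  assumes "tri A B C x y \<delta>" "tri A' B' C' x' y' \<delta>'" "\<guillemotleft>a : A \<rightarrow> A'\<guillemotright>" "\<guillemotleft>c : C \<rightarrow> C'\<guillemotright>"
    "push \<C> C a \<delta> = pull \<C> A' c \<delta>'"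
  obtains b where "\<guillemotleft>b : B \<rightarrow> B'\<guillemotright>" "b \<cdot> x = x' \<cdot> a" "y' \<cdot> b = c \<cdot> y"
  using realization_morphism[OF assms(1,2) _ _ assms(5)] assms(3,4) triD[OF assms(1)] triD[OF assms(2)]
  by (auto simp: arr_iff)

lemma tri_morphism_right:
  assumes "tri A B C x y \<delta>" "tri A' B' C' x' y' \<delta>'" "\<guillemotleft>a : A \<rightarrow> A'\<guillemotright>" "\<guillemotleft>b : B \<rightarrow> B'\<guillemotright>"
    "b \<cdot> x = x' \<cdot> a"
  obtains c where "\<guillemotleft>c : C \<rightarrow> C'\<guillemotright>" "c \<cdot> y = y' \<cdot> b" "push \<C> C a \<delta> = pull \<C> A' c \<delta>'"
  using ET3[OF assms(1,2) _ _ assms(5)] assms(3,4) triD[OF assms(1)] triD[OF assms(2)]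
  by (auto simp: arr_iff)

lemma tri_morphism_left:
  assumes "tri A B C x y \<delta>" "tri A' B' C' x' y' \<delta>'" "\<guillemotleft>b : B \<rightarrow> B'\<guillemotright>" "\<guillemotleft>c : C \<rightarrow> C'\<guillemotright>"
    "c \<cdot> y = y' \<cdot> b"
  obtains a where "\<guillemotleft>a : A \<rightarrow> A'\<guillemotright>" "b \<cdot> x = x' \<cdot> a" "push \<C> C a \<delta> = pull \<C> A' c \<delta>'"
  using ET3_op[OF assms(1,2) _ _ assms(5)] assms(3,4) triD[OF assms(1)] triD[OF assms(2)]
  by (auto simp: arr_iff)

text \<open>Degenerate triangles with a zero object at one end. Inserted into the morphism axioms,
  they turn these into the exactness statements below.\<close>

lemma iso_tri:
  assumes "inverse_arrows f g A B" "is_zero_obj \<C> Z"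
  shows "tri A B Z f (zr B Z) (ze Z A)" "tri Z A B (zr Z A) f (ze B Z)"
proof -
  note f = assms(1)[unfolded inverse_arrows_def] and Z = zero_obj_typed[OF assms(2)]
  show "tri A B Z f (zr B Z) (ze Z A)"
    by (rule split_tri[where r = g and s = "zr Z B"]) (use f Z in auto)
  show "tri Z A B (zr Z A) f (ze B Z)"
    by (rule split_tri[where r = "zr A Z" and s = g]) (use f Z in auto)
qed

lemma ide_tri:
  assumes "A \<in> Obj \<C>" "is_zero_obj \<C> Z"
  shows "tri A A Z (ide \<C> A) (zr A Z) (ze Z A)" "tri Z A A (zr Z A) (ide \<C> A) (ze A Z)"
  using iso_tri[of "ide \<C> A" "ide \<C> A" A A Z] assms by (auto simp: inverse_arrows_def)

lemma tri_comp_zr: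
  assumes T: "tri A B C x y \<delta>"
  shows "y \<cdot> x = zr A C"
proof -
  obtain Z where Z: "is_zero_obj \<C> Z" using zero_exists by auto
  note T' = triD[OF T] and z = zero_obj_typed[OF Z]
  obtain c where "\<guillemotleft>c : Z \<rightarrow> C\<guillemotright>" "c \<cdot> zr A Z = y \<cdot> x"
    by (rule tri_morphism_right[OF ide_tri(1)[OF T'(1) Z] T, of "ide \<C> A" x]) (use T' in auto)
  then show ?thesis using z T' by auto
qed

lemma pull_deflation:
  assumes T: "tri A B C x y \<delta>"
  shows "pull \<C> A y \<delta> = ze B A"
proof -
  obtain Z where Z: "is_zero_obj \<C> Z" using zero_exists by auto
  note T' = triD[OF T] and z = zero_obj_typed[OF Z]
  obtain a where "\<guillemotleft>a : Z \<rightarrow> A\<guillemotright>" "push \<C> B a (ze B Z) = pull \<C> A y \<delta>"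
    by (rule tri_morphism_left[OF ide_tri(2)[OF T'(2) Z] T, of "ide \<C> B" y]) (use T' in auto)
  then show ?thesis using T' by auto
qed

lemma push_inflation:
  assumes T: "tri A B C x y \<delta>"
  shows "push \<C> C x \<delta> = ze C B"
proof -
  obtain Z where Z: "is_zero_obj \<C> Z" using zero_exists by auto
  note T' = triD[OF T] and z = zero_obj_typed[OF Z]
  obtain c where "\<guillemotleft>c : C \<rightarrow> Z\<guillemotright>" "push \<C> C x \<delta> = pull \<C> B c (ze Z B)"
    by (rule tri_morphism_right[OF T ide_tri(1)[OF T'(2) Z], of x "ide \<C> B"]) (use T' in auto)
  then show ?thesis using T' by auto
qed

lemma factor_through_inflation:
  assumes T: "tri A B C x y \<delta>" and t: "\<guillemotleft>t : W \<rightarrow> B\<guillemotright>" "y \<cdot> t = zr W C"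
  obtains s where "\<guillemotleft>s : W \<rightarrow> A\<guillemotright>" "t = x \<cdot> s"
proof -
  obtain Z where Z: "is_zero_obj \<C> Z" using zero_exists by auto
  note T' = triD[OF T] and z = zero_obj_typed[OF Z]
  obtain a where "\<guillemotleft>a : W \<rightarrow> A\<guillemotright>" "t \<cdot> ide \<C> W = x \<cdot> a"
    by (rule tri_morphism_left[OF ide_tri(1)[of W, OF _ Z] T, of t "zr Z C"]) (use T' t z in auto)
  then show ?thesis using that t by auto
qed

lemma factor_through_deflation:
  assumes T: "tri A B C x y \<delta>" and t: "\<guillemotleft>t : B \<rightarrow> W\<guillemotright>" "t \<cdot> x = zr A W"
  obtains s where "\<guillemotleft>s : C \<rightarrow> W\<guillemotright>" "t = s \<cdot> y"
proof -
  obtain Z where Z: "is_zero_obj \<C> Z" using zero_exists by auto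
  note T' = triD[OF T] and z = zero_obj_typed[OF Z]
  obtain c where "\<guillemotleft>c : C \<rightarrow> W\<guillemotright>" "c \<cdot> y = ide \<C> W \<cdot> t"
    by (rule tri_morphism_right[OF T ide_tri(2)[of W, OF _ Z], of "zr A Z" t]) (use T' t z in auto)
  then show ?thesis using that t by auto
qed

text \<open>The pulled-back extension is the obstruction to a lift: a deflation kills its own
  extension, and conversely (ET2), applied to a morphism out of the triangle
  \<open>0 -> W -> W\<close>, produces the lift.\<close>

lemma lift_iff:
  assumes T: "tri A B C x y \<delta>" and t: "\<guillemotleft>t : W \<rightarrow> C\<guillemotright>"
  shows "(\<exists>s. \<guillemotleft>s : W \<rightarrow> B\<guillemotright> \<and> t = y \<cdot> s) \<longleftrightarrow> pull \<C> A t \<delta> = ze W A"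
proof
  note T' = triD[OF T]
  assume "\<exists>s. \<guillemotleft>s : W \<rightarrow> B\<guillemotright> \<and> t = y \<cdot> s"
  then show "pull \<C> A t \<delta> = ze W A"
    using T' pull_deflation[OF T] pull_comp by auto
next
  obtain Z where Z: "is_zero_obj \<C> Z" using zero_exists by auto
  note T' = triD[OF T] and z = zero_obj_typed[OF Z]
  assume d: "pull \<C> A t \<delta> = ze W A"
  obtain b where "\<guillemotleft>b : W \<rightarrow> B\<guillemotright>" "y \<cdot> b = t \<cdot> ide \<C> W"
    by (rule tri_morphism[OF ide_tri(2)[of W, OF _ Z] T, of "zr Z A" t])
      (use T' t z d in auto)
  then show "\<exists>s. \<guillemotleft>s : W \<rightarrow> B\<guillemotright> \<and> t = y \<cdot> s" using t by auto
qed

lemma extend_iff: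
  assumes T: "tri A B C x y \<delta>" and t: "\<guillemotleft>t : A \<rightarrow> W\<guillemotright>"
  shows "(\<exists>s. \<guillemotleft>s : B \<rightarrow> W\<guillemotright> \<and> t = s \<cdot> x) \<longleftrightarrow> push \<C> C t \<delta> = ze C W"
proof
  note T' = triD[OF T]
  assume "\<exists>s. \<guillemotleft>s : B \<rightarrow> W\<guillemotright> \<and> t = s \<cdot> x"
  then show "push \<C> C t \<delta> = ze C W"
    using T' push_inflation[OF T] push_comp by auto
next
  obtain Z where Z: "is_zero_obj \<C> Z" using zero_exists by auto
  note T' = triD[OF T] and z = zero_obj_typed[OF Z]
  assume d: "push \<C> C t \<delta> = ze C W"
  obtain b where "\<guillemotleft>b : B \<rightarrow> W\<guillemotright>" "b \<cdot> x = ide \<C> W \<cdot> t"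
    by (rule tri_morphism[OF T ide_tri(1)[of W, OF _ Z], of t "zr C Z"])
      (use T' t z d in auto)
  then show "\<exists>s. \<guillemotleft>s : B \<rightarrow> W\<guillemotright> \<and> t = s \<cdot> x" using t by auto
qed

text \<open>Exactness of \<open>\<C>(K, A) \<rightarrow> \<E>(C, A) \<rightarrow> \<E>(P, A)\<close>
  in the middle: the lift of \<open>p\<close> and the identity of \<open>C\<close> form a square,
  which the dual of (ET3) completes on the left.\<close>

lemma ext_from_lift:
  assumes T: "tri A B C x y \<delta>" and S: "tri K P C k p \<epsilon>" and "pull \<C> A p \<delta> = ze P A"
  obtains h where "\<guillemotleft>h : K \<rightarrow> A\<guillemotright>" "push \<C> C h \<epsilon> = \<delta>"
proof -
  note T' = triD[OF T] and S' = triD[OF S]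
  obtain q where q: "\<guillemotleft>q : P \<rightarrow> B\<guillemotright>" "p = y \<cdot> q" using lift_iff[OF T S'(5)] assms(3) by auto
  obtain h where "\<guillemotleft>h : K \<rightarrow> A\<guillemotright>" "push \<C> C h \<epsilon> = pull \<C> A (ide \<C> C) \<delta>"
    by (rule tri_morphism_left[OF S T, of q "ide \<C> C"]) (use T' S' q in auto)
  then show ?thesis using that T' by auto
qed

lemma ext_from_extension:
  assumes T: "tri A B C x y \<delta>" and S: "tri A I J i j \<epsilon>" and "push \<C> C i \<delta> = ze C I"
  obtains t where "\<guillemotleft>t : C \<rightarrow> J\<guillemotright>" "pull \<C> A t \<epsilon> = \<delta>"
proof -
  note T' = triD[OF T] and S' = triD[OF S]
  obtain q where q: "\<guillemotleft>q : B \<rightarrow> I\<guillemotright>" "i = q \<cdot> x" using extend_iff[OF T S'(4)] assms(3) by auto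
  obtain t where "\<guillemotleft>t : C \<rightarrow> J\<guillemotright>" "push \<C> C (ide \<C> A) \<delta> = pull \<C> A t \<epsilon>"
    by (rule tri_morphism_right[OF T S, of "ide \<C> A" q]) (use T' S' q in auto)
  then show ?thesis using that T' by auto
qed

lemma diff_through_inflation:
  assumes T: "tri A B C x y \<delta>" and t: "\<guillemotleft>t : W \<rightarrow> B\<guillemotright>" "\<guillemotleft>t' : W \<rightarrow> B\<guillemotright>" "y \<cdot> t = y \<cdot> t'"
  obtains s where "\<guillemotleft>s : W \<rightarrow> A\<guillemotright>" "t = t' \<boxplus> x \<cdot> s"
proof -
  note T' = triD[OF T]
  have "y \<cdot> (t \<boxplus> neg t') = zr W C" using t T' by simp
  then obtain s where s: "\<guillemotleft>s : W \<rightarrow> A\<guillemotright>" "t \<boxplus> neg t' = x \<cdot> s"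
    by (rule factor_through_inflation[OF T, rotated]) (use t in auto)
  have "t = x \<cdot> s \<boxplus> t'" using s t T' by (subst add_solve) auto
  then show ?thesis using that s t T' add_comm[of t' "x \<cdot> s"] by auto
qed

lemma diff_through_deflation:
  assumes T: "tri A B C x y \<delta>" and t: "\<guillemotleft>t : B \<rightarrow> W\<guillemotright>" "\<guillemotleft>t' : B \<rightarrow> W\<guillemotright>" "t \<cdot> x = t' \<cdot> x"
  obtains s where "\<guillemotleft>s : C \<rightarrow> W\<guillemotright>" "t = t' \<boxplus> s \<cdot> y"
proof -
  note T' = triD[OF T]
  have "(t \<boxplus> neg t') \<cdot> x = zr A W" using t T' by simp
  then obtain s where s: "\<guillemotleft>s : C \<rightarrow> W\<guillemotright>" "t \<boxplus> neg t' = s \<cdot> y"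
    by (rule factor_through_deflation[OF T, rotated]) (use t in auto)
  have "t = s \<cdot> y \<boxplus> t'" using s t T' by (subst add_solve) auto
  then show ?thesis using that s t T' add_comm[of t' "s \<cdot> y"] by auto
qed

lemma push_neg:
  assumes "\<guillemotleft>a : A \<rightarrow> A'\<guillemotright>" "C \<in> Obj \<C>" "\<delta> \<in> E C A"
  shows "push \<C> C (neg a) \<delta> = inv\<^bsub>Ext \<C> C A'\<^esub> push \<C> C a \<delta>"
proof -
  interpret comm_group "Ext \<C> C A'" using ext_comm_group assms by simp
  have "push \<C> C (neg a) \<delta> \<otimes>\<^bsub>Ext \<C> C A'\<^esub> push \<C> C a \<delta> = \<one>\<^bsub>Ext \<C> C A'\<^esub>"
    using push_add[of "neg a" A A' a C \<delta>] assms by (simp add: ze_def[symmetric])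
  then show ?thesis using assms inv_equality by simp
qed

text \<open>Exactness of \<open>\<C>(B, W) \<rightarrow> \<C>(A, W) \<rightarrow> \<E>(C, W)\<close>
  in the middle, applied to \<open>a - a'\<close>.\<close>

lemma diff_of_push_eq:
  assumes T: "tri A B C x y \<delta>" and a: "\<guillemotleft>a : A \<rightarrow> W\<guillemotright>" "\<guillemotleft>a' : A \<rightarrow> W\<guillemotright>" "push \<C> C a \<delta> = push \<C> C a' \<delta>"
  obtains u where "\<guillemotleft>u : B \<rightarrow> W\<guillemotright>" "a = a' \<boxplus> u \<cdot> x"
proof -
  note T' = triD[OF T]
  interpret comm_group "Ext \<C> C W" using ext_comm_group a T' by simp
  have "push \<C> C (a \<boxplus> neg a') \<delta> = ze C W"
    using push_add[of a A W "neg a'" C \<delta>] push_neg[of a' A W C \<delta>] a T'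
    by (simp add: ze_def)
  then obtain u where u: "\<guillemotleft>u : B \<rightarrow> W\<guillemotright>" "a \<boxplus> neg a' = u \<cdot> x"
    using extend_iff[OF T, of "a \<boxplus> neg a'" W] a by auto
  have "a = u \<cdot> x \<boxplus> a'" using u a T' by (subst add_solve) auto
  then show ?thesis using that u a T' add_comm[of a' "u \<cdot> x"] by auto
qed

text \<open>One inverse is built on each side. On the right, \<open>c' \<cdot> y'\<close> lifts
  along \<open>y\<close> to \<open>r\<close>, and the error of \<open>b \<cdot> r\<close> factors
  through \<open>x'\<close> and is absorbed; on the left, dually, \<open>x \<cdot> a'\<close>
  extends along \<open>x'\<close> and the error factors through \<open>y\<close>.\<close>

lemma five_lemma:
  assumes T: "tri A B C x y \<delta>" and T': "tri A' B' C' x' y' \<delta>'"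
    and a: "inverse_arrows a a' A A'" and c: "inverse_arrows c c' C C'" and b: "\<guillemotleft>b : B \<rightarrow> B'\<guillemotright>"
    and e: "b \<cdot> x = x' \<cdot> a" "y' \<cdot> b = c \<cdot> y" "push \<C> C a \<delta> = pull \<C> A' c \<delta>'"
  obtains b' where "inverse_arrows b b' B B'"
proof -
  note t = triD[OF T] and t' = triD[OF T']
  note a' = a[unfolded inverse_arrows_def] and c' = c[unfolded inverse_arrows_def]
  have "push \<C> B' a (pull \<C> A (c' \<cdot> y') \<delta>) = pull \<C> A' (c' \<cdot> y') (push \<C> C a \<delta>)"
    by (rule push_pull) (use t t' c' a' in auto)
  also have "\<dots> = pull \<C> A' (c \<cdot> (c' \<cdot> y')) \<delta>'"
    unfolding e using t t' c' a' by (subst pull_comp[of c]) auto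
  also have "\<dots> = ze B' A'"
    using comp_subst[of c c' _ y'] c' t' pull_deflation[OF T'] by simp
  finally have 1: "push \<C> B' a (pull \<C> A (c' \<cdot> y') \<delta>) = ze B' A'" .
  \<comment> \<open>Pushing along \<open>a\<close> was needed to bring in \<open>\<delta>'\<close>,
    which \<open>y'\<close> kills; pushing back along \<open>a'\<close> recovers the statement about
    \<open>\<delta>\<close>.\<close>
  have "pull \<C> A (c' \<cdot> y') \<delta> = push \<C> B' (a' \<cdot> a) (pull \<C> A (c' \<cdot> y') \<delta>)"
    using a' c' t t' by simp
  also have "\<dots> = push \<C> B' a' (push \<C> B' a (pull \<C> A (c' \<cdot> y') \<delta>))"
    by (rule push_comp) (use a' c' t t' in auto)
  also have "\<dots> = ze B' A" using 1 a' t' by simp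
  finally obtain r where r: "\<guillemotleft>r : B' \<rightarrow> B\<guillemotright>" "c' \<cdot> y' = y \<cdot> r"
    using lift_iff[OF T, of "c' \<cdot> y'" B'] t' c' by auto
  have "y' \<cdot> (b \<cdot> r) = (c \<cdot> y) \<cdot> r" unfolding e(2)[symmetric] using r b t' by simp
  also have "\<dots> = y' \<cdot> ide \<C> B'" using r c' t t' comp_subst[of c c' _ y'] by simp
  finally have "y' \<cdot> ide \<C> B' = y' \<cdot> (b \<cdot> r)" by simp
  then obtain s where s: "\<guillemotleft>s : B' \<rightarrow> A'\<guillemotright>" "ide \<C> B' = b \<cdot> r \<boxplus> x' \<cdot> s"
    by (rule diff_through_inflation[OF T', rotated 2]) (use r b t' in auto)
  have "x' \<cdot> s = b \<cdot> (x \<cdot> (a' \<cdot> s))"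
    using comp_subst[OF e(1), of "a' \<cdot> s"] comp_subst[of a a' _ s] a' s t t' b by simp
  then have right: "b \<cdot> (r \<boxplus> x \<cdot> (a' \<cdot> s)) = ide \<C> B'" using s r b a' t by simp
  have pe: "pull \<C> A' c' (push \<C> C a \<delta>) = \<delta>'"
    unfolding e using pull_comp[of c c' A' \<delta>'] c' t' emap_ide[of C' A' \<delta>'] by simp
  have "push \<C> C' (x \<cdot> a') \<delta>' = push \<C> C' (x \<cdot> a') (push \<C> C' a (pull \<C> A c' \<delta>))"
    using push_pull[of c' C' C a A A' \<delta>] pe a' c' t t' by simp
  also have "\<dots> = push \<C> C' ((x \<cdot> a') \<cdot> a) (pull \<C> A c' \<delta>)"
    by (rule push_comp[symmetric]) (use a' c' t t' in auto)
  also have "\<dots> = pull \<C> B c' (push \<C> C x \<delta>)"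
    using push_pull[of c' C' C x A B \<delta>] a' c' t t' by simp
  also have "\<dots> = ze C' B" using push_inflation[OF T] c' t by simp
  finally obtain v where v: "\<guillemotleft>v : B' \<rightarrow> B\<guillemotright>" "x \<cdot> a' = v \<cdot> x'"
    using extend_iff[OF T', of "x \<cdot> a'" B] t t' a' by auto
  have "(v \<cdot> b) \<cdot> x = (v \<cdot> x') \<cdot> a" using e(1) v b t t' a' by simp
  also have "\<dots> = ide \<C> B \<cdot> x" unfolding v(2)[symmetric] using a' t by simp
  finally have "ide \<C> B \<cdot> x = (v \<cdot> b) \<cdot> x" by simp
  then obtain w where w: "\<guillemotleft>w : C \<rightarrow> B\<guillemotright>" "ide \<C> B = v \<cdot> b \<boxplus> w \<cdot> y"
    by (rule diff_through_deflation[OF T, rotated 2]) (use v b t in auto)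
  have "w \<cdot> y = w \<cdot> (c' \<cdot> (y' \<cdot> b))"
    using comp_subst[of c' c _ y] e(2) c' w t by simp
  then have left: "(v \<boxplus> w \<cdot> (c' \<cdot> y')) \<cdot> b = ide \<C> B" using v b w c' t' by simp
  show ?thesis
    by (rule that, rule inverse_arrows_of_one_sided[OF _ _ _ left right])
      (use b v w c' t' r a' s t in auto)
qed

text \<open>Realize the transported extension by some sequence; the five lemma identifies its middle
  term with \<open>B\<close>.\<close>

lemma tri_iso_left:
  assumes T: "tri A B C x y \<delta>" and f: "inverse_arrows f g A' A"
  obtains \<delta>' where "tri A' B C (x \<cdot> f) y \<delta>'" "\<delta>' = push \<C> C g \<delta>"
proof -
  note t = triD[OF T] and f' = f[unfolded inverse_arrows_def]
  have d: "push \<C> C g \<delta> \<in> E C A'" using t f' by auto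
  obtain B' x' y' where T': "tri A' B' C x' y' (push \<C> C g \<delta>)"
    using tri_exists[OF _ _ d] t f' by auto
  note t' = triD[OF T']
  have e: "push \<C> C f (push \<C> C g \<delta>) = pull \<C> A (ide \<C> C) \<delta>"
    using push_comp[of g f C \<delta>] t f' by simp
  obtain b where b: "\<guillemotleft>b : B' \<rightarrow> B\<guillemotright>" "b \<cdot> x' = x \<cdot> f" "y \<cdot> b = ide \<C> C \<cdot> y'"
    by (rule tri_morphism[OF T' T _ _ e]) (use t f' in auto)
  have c: "inverse_arrows (ide \<C> C) (ide \<C> C) C C" using t by (auto simp: inverse_arrows_def)
  obtain b' where "inverse_arrows b b' B' B" by (rule five_lemma[OF T' T f c b e])
  then have "tri A' B C (x \<cdot> f) y (push \<C> C g \<delta>)"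
    by (rule tri_middle_iso[OF T']) (use t t' b f' in auto)
  then show ?thesis using that by auto
qed

lemma tri_iso_right:
  assumes T: "tri A B C x y \<delta>" and f: "inverse_arrows f g C C'"
  obtains \<delta>' where "tri A B C' x (f \<cdot> y) \<delta>'" "\<delta>' = pull \<C> A g \<delta>"
proof -
  note t = triD[OF T] and f' = f[unfolded inverse_arrows_def]
  have d: "pull \<C> A g \<delta> \<in> E C' A" using t f' by auto
  obtain B' x' y' where T': "tri A B' C' x' y' (pull \<C> A g \<delta>)"
    using tri_exists[OF _ _ d] t f' by auto
  note t' = triD[OF T']
  have e: "push \<C> C (ide \<C> A) \<delta> = pull \<C> A f (pull \<C> A g \<delta>)"
    using pull_comp[of g f A \<delta>] t f' by simp
  obtain b where b: "\<guillemotleft>b : B \<rightarrow> B'\<guillemotright>" "b \<cdot> x = x' \<cdot> ide \<C> A" "y' \<cdot> b = f \<cdot> y"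
    by (rule tri_morphism[OF T T' _ _ e]) (use t f' in auto)
  have c: "inverse_arrows (ide \<C> A) (ide \<C> A) A A" using t by (auto simp: inverse_arrows_def)
  obtain b' where b': "inverse_arrows b b' B B'" by (rule five_lemma[OF T T' c f b e])
  have "b' \<cdot> x' = x" "(f \<cdot> y) \<cdot> b' = y'"
    using b' comp_subst[of b' b _ x] comp_assoc'[of b' b y'] b t t' f' unfolding inverse_arrows_def by auto
  then have "tri A B C' x (f \<cdot> y) (pull \<C> A g \<delta>)"
    using tri_middle_iso[OF T' inverse_arrows_sym[OF b']] t t' f' by auto
  then show ?thesis using that by auto
qed

section \<open>Exactness of Hom sequences as lifting and extension properties\<close>

lemma comp_left_hom:
  assumes "\<guillemotleft>x : A \<rightarrow> B\<guillemotright>" "W \<in> Obj \<C>"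
  shows "group_hom (Hom \<C> W A) (Hom \<C> W B) (\<lambda>h. x \<cdot> h)"
proof -
  have "(\<lambda>h. x \<cdot> h) \<in> hom (Hom \<C> W A) (Hom \<C> W B)"
    using assms comp_add_right[of W A B _ _ x] by (auto simp: hom_def arr_iff)
  then show ?thesis using hom_comm_group[of W A] hom_comm_group[of W B] assms
    by (auto simp: group_hom_def group_hom_axioms_def comm_group_def)
qed

lemma comp_right_hom:
  assumes "\<guillemotleft>y : B \<rightarrow> C\<guillemotright>" "W \<in> Obj \<C>"
  shows "group_hom (Hom \<C> C W) (Hom \<C> B W) (\<lambda>h. h \<cdot> y)"
proof -
  have "(\<lambda>h. h \<cdot> y) \<in> hom (Hom \<C> C W) (Hom \<C> B W)"
    using assms comp_add_left[of B C W y] by (auto simp: hom_def arr_iff)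
  then show ?thesis using hom_comm_group[of C W] hom_comm_group[of B W] assms
    by (auto simp: group_hom_def group_hom_axioms_def comm_group_def)
qed

text \<open>Exactness in the middle holds for every \<open>\<E>\<close>-triangle, so only
  injectivity on the left and surjectivity on the right are conditions.\<close>

lemma covariant_exact_iff:
  assumes T: "tri A B C x y \<delta>" and W: "W \<in> Obj \<C>"
  shows "covariant_exact \<C> W (ETri A B C x y \<delta>) \<longleftrightarrow>
    (\<forall>t. \<guillemotleft>t : W \<rightarrow> A\<guillemotright> \<longrightarrow> x \<cdot> t = zr W B \<longrightarrow> t = zr W A) \<and>
    (\<forall>t. \<guillemotleft>t : W \<rightarrow> C\<guillemotright> \<longrightarrow> (\<exists>s. \<guillemotleft>s : W \<rightarrow> B\<guillemotright> \<and> t = y \<cdot> s))"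
proof -
  note t = triD[OF T]
  note gx = comp_left_hom[OF t(4) W] and gy = comp_left_hom[OF t(5) W]
  have "kernel (Hom \<C> W B) (Hom \<C> W C) (\<lambda>h. y \<cdot> h) = (\<lambda>h. x \<cdot> h) ` arr \<C> W A"
  proof
    show "kernel (Hom \<C> W B) (Hom \<C> W C) (\<lambda>h. y \<cdot> h) \<subseteq> (\<lambda>h. x \<cdot> h) ` arr \<C> W A"
    proof
      fix h assume "h \<in> kernel (Hom \<C> W B) (Hom \<C> W C) (\<lambda>h. y \<cdot> h)"
      then have "\<guillemotleft>h : W \<rightarrow> B\<guillemotright>" "y \<cdot> h = zr W C" using t W by (auto simp: kernel_def arr_iff zr_def)
      then obtain s where "\<guillemotleft>s : W \<rightarrow> A\<guillemotright>" "h = x \<cdot> s" by (rule factor_through_inflation[OF T])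
      then show "h \<in> (\<lambda>h. x \<cdot> h) ` arr \<C> W A" using t W by (auto simp: arr_iff)
    qed
    show "(\<lambda>h. x \<cdot> h) ` arr \<C> W A \<subseteq> kernel (Hom \<C> W B) (Hom \<C> W C) (\<lambda>h. y \<cdot> h)"
      using t W comp_subst[OF tri_comp_zr[OF T]] by (auto simp: kernel_def arr_iff zr_def[symmetric])
  qed
  moreover have "inj_on (\<lambda>h. x \<cdot> h) (arr \<C> W A) \<longleftrightarrow>
      (\<forall>t. \<guillemotleft>t : W \<rightarrow> A\<guillemotright> \<longrightarrow> x \<cdot> t = zr W B \<longrightarrow> t = zr W A)"
    unfolding group_hom.inj_iff_trivial_ker[OF gx]
    using t W by (auto simp: kernel_def arr_iff zr_def[symmetric])
  moreover have "(\<lambda>h. y \<cdot> h) ` arr \<C> W B = arr \<C> W C \<longleftrightarrow>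
      (\<forall>t. \<guillemotleft>t : W \<rightarrow> C\<guillemotright> \<longrightarrow> (\<exists>s. \<guillemotleft>s : W \<rightarrow> B\<guillemotright> \<and> t = y \<cdot> s))"
  proof -
    have "(\<lambda>h. y \<cdot> h) ` arr \<C> W B \<subseteq> arr \<C> W C" using t W by (auto simp: arr_iff)
    moreover have "arr \<C> W C \<subseteq> (\<lambda>h. y \<cdot> h) ` arr \<C> W B \<longleftrightarrow> (\<forall>t \<in> arr \<C> W C. \<exists>s \<in> arr \<C> W B. t = y \<cdot> s)"
      by (auto simp: image_iff subset_iff)
    ultimately show ?thesis
      unfolding set_eq_subset by (simp only: simp_thms Ball_def Bex_def arr_iff[OF W t(3)] arr_iff[OF W t(2)])
  qed
  ultimately show ?thesis using gx gy by (simp add: short_exact_iff)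
qed

lemma contravariant_exact_iff:
  assumes T: "tri A B C x y \<delta>" and W: "W \<in> Obj \<C>"
  shows "contravariant_exact \<C> W (ETri A B C x y \<delta>) \<longleftrightarrow>
    (\<forall>t. \<guillemotleft>t : C \<rightarrow> W\<guillemotright> \<longrightarrow> t \<cdot> y = zr B W \<longrightarrow> t = zr C W) \<and>
    (\<forall>t. \<guillemotleft>t : A \<rightarrow> W\<guillemotright> \<longrightarrow> (\<exists>s. \<guillemotleft>s : B \<rightarrow> W\<guillemotright> \<and> t = s \<cdot> x))"
proof -
  note t = triD[OF T]
  note gx = comp_right_hom[OF t(4) W] and gy = comp_right_hom[OF t(5) W]
  have "kernel (Hom \<C> B W) (Hom \<C> A W) (\<lambda>h. h \<cdot> x) = (\<lambda>h. h \<cdot> y) ` arr \<C> C W"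
  proof
    show "kernel (Hom \<C> B W) (Hom \<C> A W) (\<lambda>h. h \<cdot> x) \<subseteq> (\<lambda>h. h \<cdot> y) ` arr \<C> C W"
    proof
      fix h assume "h \<in> kernel (Hom \<C> B W) (Hom \<C> A W) (\<lambda>h. h \<cdot> x)"
      then have "\<guillemotleft>h : B \<rightarrow> W\<guillemotright>" "h \<cdot> x = zr A W" using t W by (auto simp: kernel_def arr_iff zr_def)
      then obtain s where "\<guillemotleft>s : C \<rightarrow> W\<guillemotright>" "h = s \<cdot> y" by (rule factor_through_deflation[OF T])
      then show "h \<in> (\<lambda>h. h \<cdot> y) ` arr \<C> C W" using t W by (auto simp: arr_iff)
    qed
    show "(\<lambda>h. h \<cdot> y) ` arr \<C> C W \<subseteq> kernel (Hom \<C> B W) (Hom \<C> A W) (\<lambda>h. h \<cdot> x)"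
      using t W tri_comp_zr[OF T] by (auto simp: kernel_def arr_iff zr_def[symmetric])
  qed
  moreover have "inj_on (\<lambda>h. h \<cdot> y) (arr \<C> C W) \<longleftrightarrow>
      (\<forall>t. \<guillemotleft>t : C \<rightarrow> W\<guillemotright> \<longrightarrow> t \<cdot> y = zr B W \<longrightarrow> t = zr C W)"
    unfolding group_hom.inj_iff_trivial_ker[OF gy]
    using t W by (auto simp: kernel_def arr_iff zr_def[symmetric])
  moreover have "(\<lambda>h. h \<cdot> x) ` arr \<C> B W = arr \<C> A W \<longleftrightarrow>
      (\<forall>t. \<guillemotleft>t : A \<rightarrow> W\<guillemotright> \<longrightarrow> (\<exists>s. \<guillemotleft>s : B \<rightarrow> W\<guillemotright> \<and> t = s \<cdot> x))"
  proof -
    have "(\<lambda>h. h \<cdot> x) ` arr \<C> B W \<subseteq> arr \<C> A W" using t W by (auto simp: arr_iff)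
    moreover have "arr \<C> A W \<subseteq> (\<lambda>h. h \<cdot> x) ` arr \<C> B W \<longleftrightarrow> (\<forall>t \<in> arr \<C> A W. \<exists>s \<in> arr \<C> B W. t = s \<cdot> x)"
      by (auto simp: image_iff subset_iff)
    ultimately show ?thesis
      unfolding set_eq_subset by (simp only: simp_thms Ball_def Bex_def arr_iff[OF t(1) W] arr_iff[OF t(2) W])
  qed
  ultimately show ?thesis using gx gy by (simp add: short_exact_iff)
qed

section \<open>Extensions that agree after a pushforward or pullback, and splittings\<close>

lemma Emap_inv:
  assumes "\<guillemotleft>c : C' \<rightarrow> C\<guillemotright>" "\<guillemotleft>a : A \<rightarrow> A'\<guillemotright>" "\<delta> \<in> E C A" "\<delta>' \<in> E C A"
  shows "Emap \<C> c a (\<delta> \<otimes>\<^bsub>Ext \<C> C A\<^esub> inv\<^bsub>Ext \<C> C A\<^esub> \<delta>') =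
    Emap \<C> c a \<delta> \<otimes>\<^bsub>Ext \<C> C' A'\<^esub> inv\<^bsub>Ext \<C> C' A'\<^esub> Emap \<C> c a \<delta>'"
proof -
  have h: "Emap \<C> c a \<in> hom (Ext \<C> C A) (Ext \<C> C' A')"
    using assms emap_hom typed_iff by metis
  interpret group_hom "Ext \<C> C A" "Ext \<C> C' A'" "Emap \<C> c a"
    using h ext_comm_group assms
    by (auto simp: group_hom_def group_hom_axioms_def comm_group_def)
  show ?thesis using assms by simp
qed

lemma ext_diff_pull:
  assumes S: "tri A I J i j \<epsilon>" and d: "C \<in> Obj \<C>" "\<delta> \<in> E C A" "\<delta>' \<in> E C A" "push \<C> C i \<delta> = push \<C> C i \<delta>'"
  obtains t where "\<guillemotleft>t : C \<rightarrow> J\<guillemotright>" "\<delta> = \<delta>' \<otimes>\<^bsub>Ext \<C> C A\<^esub> pull \<C> A t \<epsilon>"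
proof -
  note s = triD[OF S]
  interpret G: comm_group "Ext \<C> C A" using ext_comm_group s d by simp
  interpret H: comm_group "Ext \<C> C I" using ext_comm_group s d by simp
  let ?\<eta> = "\<delta> \<otimes>\<^bsub>Ext \<C> C A\<^esub> inv\<^bsub>Ext \<C> C A\<^esub> \<delta>'"
  have "push \<C> C i ?\<eta> = ze C I"
    using Emap_inv[of "ide \<C> C" C C i A I \<delta> \<delta>'] s d by (simp add: ze_def)
  moreover obtain B x y where T: "tri A B C x y ?\<eta>" using tri_exists[of C A ?\<eta>] s d by auto
  ultimately obtain t where "\<guillemotleft>t : C \<rightarrow> J\<guillemotright>" "pull \<C> A t \<epsilon> = ?\<eta>"
    using ext_from_extension[OF T S] by auto
  moreover have "\<delta>' \<otimes>\<^bsub>Ext \<C> C A\<^esub> ?\<eta> = \<delta>"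
    using d G.m_comm[of \<delta>' ?\<eta>] by (simp add: G.m_assoc)
  ultimately show ?thesis using that by metis
qed

lemma ext_diff_push:
  assumes S: "tri K P C k p \<epsilon>" and d: "A \<in> Obj \<C>" "\<delta> \<in> E C A" "\<delta>' \<in> E C A" "pull \<C> A p \<delta> = pull \<C> A p \<delta>'"
  obtains t where "\<guillemotleft>t : K \<rightarrow> A\<guillemotright>" "\<delta> = \<delta>' \<otimes>\<^bsub>Ext \<C> C A\<^esub> push \<C> C t \<epsilon>"
proof -
  note s = triD[OF S]
  interpret G: comm_group "Ext \<C> C A" using ext_comm_group s d by simp
  interpret H: comm_group "Ext \<C> P A" using ext_comm_group s d by simp
  let ?\<eta> = "\<delta> \<otimes>\<^bsub>Ext \<C> C A\<^esub> inv\<^bsub>Ext \<C> C A\<^esub> \<delta>'"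
  have "pull \<C> A p ?\<eta> = ze P A"
    using Emap_inv[of p P C "ide \<C> A" A A \<delta> \<delta>'] s d by (simp add: ze_def)
  moreover obtain B x y where T: "tri A B C x y ?\<eta>" using tri_exists[of C A ?\<eta>] s d by auto
  ultimately obtain t where "\<guillemotleft>t : K \<rightarrow> A\<guillemotright>" "push \<C> C t \<epsilon> = ?\<eta>"
    using ext_from_lift[OF T S] by auto
  moreover have "\<delta>' \<otimes>\<^bsub>Ext \<C> C A\<^esub> ?\<eta> = \<delta>"
    using d G.m_comm[of \<delta>' ?\<eta>] by (simp add: G.m_assoc)
  ultimately show ?thesis using that by metis
qed

text \<open>The section in \<open>tri_split\<close> comes with its own retraction; for a prescribed
  \<open>s\<close> a matching one is rebuilt. Since \<open>d\<close> is split monic, the remaining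
  biproduct identities follow by cancelling it.\<close>

lemma split_by_section:
  assumes T: "tri D G C d e (ze C D)" and s: "\<guillemotleft>s : C \<rightarrow> G\<guillemotright>" "e \<cdot> s = ide \<C> C"
  obtains r where "tri C G D s r (ze D C)" "r \<cdot> d = ide \<C> D"
proof -
  note t = triD[OF T]
  obtain r0 where r0: "\<guillemotleft>r0 : G \<rightarrow> D\<guillemotright>" "r0 \<cdot> d = ide \<C> D" using tri_split[OF T] by blast
  have mono: "u = v" if "\<guillemotleft>u : W \<rightarrow> D\<guillemotright>" "\<guillemotleft>v : W \<rightarrow> D\<guillemotright>" "d \<cdot> u = d \<cdot> v" for u v W
  proof -
    have "u = r0 \<cdot> (d \<cdot> u)" using comp_subst[OF r0(2), of u] that(1) r0(1) t by simp
    also have "\<dots> = v" unfolding that(3) using comp_subst[OF r0(2), of v] that(2) r0(1) t by simp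
    finally show ?thesis .
  qed
  \<comment> \<open>\<open>1 - s e\<close> is killed by \<open>e\<close>, so it factors through
    \<open>d\<close>; the factor is the retraction.\<close>
  have "e \<cdot> ide \<C> G = e \<cdot> (s \<cdot> e)" using t s comp_subst[of e s _ e] by simp
  then obtain r where r: "\<guillemotleft>r : G \<rightarrow> D\<guillemotright>" "ide \<C> G = s \<cdot> e \<boxplus> d \<cdot> r"
    by (rule diff_through_inflation[OF T, rotated 2]) (use t s in auto)
  have "d \<cdot> (r \<cdot> d) = (s \<cdot> e \<boxplus> d \<cdot> r) \<cdot> d" using t s r(1) tri_comp_zr[OF T] by simp
  also have "\<dots> = d \<cdot> ide \<C> D" unfolding r(2)[symmetric] using t by simp
  finally have q: "d \<cdot> (r \<cdot> d) = d \<cdot> ide \<C> D" .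
  have rd: "r \<cdot> d = ide \<C> D" by (rule mono[where W = D]) (use q t r(1) in auto)
  have "s = (s \<cdot> e \<boxplus> d \<cdot> r) \<cdot> s" unfolding r(2)[symmetric] using t s by simp
  also have "\<dots> = s \<boxplus> d \<cdot> (r \<cdot> s)" using t s r(1) by simp
  finally have q': "d \<cdot> (r \<cdot> s) = zr C G" using add_cancel[of "d \<cdot> (r \<cdot> s)" s] add_comm[of s "d \<cdot> (r \<cdot> s)"] t s r(1) by simp
  have rs: "r \<cdot> s = zr C D" by (rule mono[where W = C]) (use q' t r(1) s in auto)
  have "tri C G D s r (ze D C)"
    by (rule split_tri[where r = e and s = d]) (use t s r(1) r(2)[symmetric] rd rs tri_comp_zr[OF T] in auto)
  then show ?thesis using that rd by auto
qed

lemma split_by_retraction: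
  assumes T: "tri D G C d e (ze C D)" and r: "\<guillemotleft>r : G \<rightarrow> D\<guillemotright>" "r \<cdot> d = ide \<C> D"
  obtains s where "tri C G D s r (ze D C)" "e \<cdot> s = ide \<C> C"
proof -
  note t = triD[OF T]
  obtain s0 where s0: "\<guillemotleft>s0 : C \<rightarrow> G\<guillemotright>" "e \<cdot> s0 = ide \<C> C" using tri_split[OF T] by blast
  have epi: "u = v" if "\<guillemotleft>u : C \<rightarrow> W\<guillemotright>" "\<guillemotleft>v : C \<rightarrow> W\<guillemotright>" "u \<cdot> e = v \<cdot> e" for u v W
  proof -
    have "u = (u \<cdot> e) \<cdot> s0" using that(1) s0 t by simp
    also have "\<dots> = v" unfolding that(3) using that(2) s0 t by simp
    finally show ?thesis .
  qed
  have "ide \<C> G \<cdot> d = (d \<cdot> r) \<cdot> d" using t r by simp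
  then obtain s where s: "\<guillemotleft>s : C \<rightarrow> G\<guillemotright>" "ide \<C> G = d \<cdot> r \<boxplus> s \<cdot> e"
    by (rule diff_through_deflation[OF T, rotated 2]) (use t r in auto)
  have "e \<cdot> s \<cdot> e = e \<cdot> (d \<cdot> r \<boxplus> s \<cdot> e)"
    using t s(1) r comp_subst[OF tri_comp_zr[OF T], of r] by simp
  also have "\<dots> = e" unfolding s(2)[symmetric] using t by simp
  finally have q: "e \<cdot> s \<cdot> e = e" .
  have es: "e \<cdot> s = ide \<C> C" by (rule epi[where W = C]) (use q t s(1) in auto)
  have "r = r \<cdot> (d \<cdot> r \<boxplus> s \<cdot> e)" unfolding s(2)[symmetric] using t r by simp
  also have "\<dots> = r \<boxplus> r \<cdot> s \<cdot> e" using t s(1) r comp_subst[OF r(2), of r] by simp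
  finally have q': "r \<cdot> s \<cdot> e = zr G D"
    using add_cancel[of "r \<cdot> s \<cdot> e" r] add_comm[of r "r \<cdot> s \<cdot> e"] t s(1) r by simp
  have rs: "r \<cdot> s = zr C D" by (rule epi[where W = D]) (use q' t r s(1) in auto)
  have "tri C G D s r (ze D C)"
    by (rule split_tri[where r = e and s = d]) (use t s(1) s(2)[symmetric] r es rs tri_comp_zr[OF T] add_comm[of "d \<cdot> r" "s \<cdot> e"] in auto)
  then show ?thesis using that es by auto
qed

lemma split_if_section:
  assumes "tri A B C x y \<delta>" "\<guillemotleft>s : C \<rightarrow> B\<guillemotright>" "y \<cdot> s = ide \<C> C"
  shows "\<delta> = ze C A"
  using lift_iff[OF assms(1), of "ide \<C> C" C] triD[OF assms(1)] assms emap_ide[of C A \<delta>]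
  by auto

lemma split_if_retraction:
  assumes "tri A B C x y \<delta>" "\<guillemotleft>r : B \<rightarrow> A\<guillemotright>" "r \<cdot> x = ide \<C> A"
  shows "\<delta> = ze C A"
  using extend_iff[OF assms(1), of "ide \<C> A" A] triD[OF assms(1)] assms emap_ide[of C A \<delta>]
  by auto

end

section \<open>Proper classes with enough projectives\<close>

locale relative_projectives = extriangulated_category \<C> + proper_class \<C> \<xi>
  for \<C> :: "('o, 'm, 'e) extri" (structure) and \<xi> :: "('o, 'm, 'e) etri set" +
  assumes enough: "enough_proj \<C> \<xi>"
begin

abbreviation PP :: "'o set" where "PP \<equiv> Proj \<C> \<xi>"

text \<open>Relative extensions, tested on projectives: in this form stability under pullback and
  pushforward is immediate, without choosing realizations.\<close>

definition xext :: "'o \<Rightarrow> 'o \<Rightarrow> 'e set" where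
  "xext C A = {\<delta> \<in> E C A. \<forall>P \<in> PP. \<forall>t. \<guillemotleft>t : P \<rightarrow> C\<guillemotright> \<longrightarrow> pull \<C> A t \<delta> = ze P A}"

lemma xextD: "\<delta> \<in> xext C A \<Longrightarrow> P \<in> PP \<Longrightarrow> \<guillemotleft>t : P \<rightarrow> C\<guillemotright> \<Longrightarrow> pull \<C> A t \<delta> = ze P A"
  by (simp add: xext_def)

lemma xext_in_E: "\<delta> \<in> xext C A \<Longrightarrow> \<delta> \<in> E C A"
  by (simp add: xext_def)

abbreviation xtri :: "'o \<Rightarrow> 'o \<Rightarrow> 'o \<Rightarrow> 'm \<Rightarrow> 'm \<Rightarrow> 'e \<Rightarrow> bool" where
  "xtri A B C x y \<delta> \<equiv> ETri A B C x y \<delta> \<in> \<xi>"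

lemmas xtri_tri = etri

lemma PP_obj [simp]: "P \<in> PP \<Longrightarrow> P \<in> Obj \<C>"
  by (auto simp: Proj_def)

section \<open>Lifting properties of projectives\<close>

lemma PP_lift:
  assumes "P \<in> PP" "xtri A B C x y \<delta>" "\<guillemotleft>t : P \<rightarrow> C\<guillemotright>"
  obtains s where "\<guillemotleft>s : P \<rightarrow> B\<guillemotright>" "t = y \<cdot> s"
  using covariant_exact_iff[OF xtri_tri[OF assms(2)], of P] assms unfolding Proj_def by blast

lemma PP_mono:
  assumes "P \<in> PP" "xtri A B C x y \<delta>" "\<guillemotleft>t : P \<rightarrow> A\<guillemotright>" "x \<cdot> t = zr P B"
  shows "t = zr P A"
  using covariant_exact_iff[OF xtri_tri[OF assms(2)], of P] assms unfolding Proj_def by blast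

lemma PP_I:
  assumes "P \<in> Obj \<C>"
    and "\<And>A B C x y \<delta> t. xtri A B C x y \<delta> \<Longrightarrow> \<guillemotleft>t : P \<rightarrow> C\<guillemotright> \<Longrightarrow> \<exists>s. \<guillemotleft>s : P \<rightarrow> B\<guillemotright> \<and> t = y \<cdot> s"
    and "\<And>A B C x y \<delta> t. xtri A B C x y \<delta> \<Longrightarrow> \<guillemotleft>t : P \<rightarrow> A\<guillemotright> \<Longrightarrow> x \<cdot> t = zr P B \<Longrightarrow> t = zr P A"
  shows "P \<in> PP"
proof -
  have "covariant_exact \<C> P T" if "T \<in> \<xi>" for T
  proof (cases T)
    case (ETri A B C x y \<delta>)
    then have T: "xtri A B C x y \<delta>" using that by simp
    show ?thesis
      unfolding ETri covariant_exact_iff[OF xtri_tri[OF T] assms(1)]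
    proof (intro conjI allI impI)
      fix t assume "\<guillemotleft>t : P \<rightarrow> A\<guillemotright>" "x \<cdot> t = zr P B"
      then show "t = zr P A" using assms(3)[OF T, of t] by simp
    next
      fix t assume "\<guillemotleft>t : P \<rightarrow> C\<guillemotright>"
      then show "\<exists>s. \<guillemotleft>s : P \<rightarrow> B\<guillemotright> \<and> t = y \<cdot> s" using assms(2)[OF T, of t] by simp
    qed
  qed
  then show ?thesis using assms(1) unfolding Proj_def by blast
qed

lemma PP_cover:
  assumes "A \<in> Obj \<C>"
  obtains K P k p \<epsilon> where "P \<in> PP" "xtri K P A k p \<epsilon>"
  using enough assms unfolding enough_proj_def by blast

lemma split_xtri: "tri A B C x y (ze C A) \<Longrightarrow> xtri A B C x y (ze C A)"
  using split by (simp add: ze_def)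

text \<open>
  Membership in \<open>\<xi>\<close> depends on the extension alone; the converse direction is where saturation
  is used, with the second triangle a projective cover of \<open>C\<close>.
\<close>

lemma xtri_iff: "xtri A B C x y \<delta> \<longleftrightarrow> tri A B C x y \<delta> \<and> \<delta> \<in> xext C A"
proof
  assume T: "xtri A B C x y \<delta>"
  have "pull \<C> A t \<delta> = ze P A" if "P \<in> PP" "\<guillemotleft>t : P \<rightarrow> C\<guillemotright>" for P t
    using PP_lift[OF that(1) T that(2)] lift_iff[OF xtri_tri[OF T] that(2)] by blast
  then show "tri A B C x y \<delta> \<and> \<delta> \<in> xext C A"
    using xtri_tri[OF T] triD[OF xtri_tri[OF T]] unfolding xext_def by blast
next
  assume T: "tri A B C x y \<delta> \<and> \<delta> \<in> xext C A"
  then have t: "A \<in> Obj \<C>" "C \<in> Obj \<C>" using triD by blast+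
  obtain K P k p \<epsilon> where P: "P \<in> PP" "xtri K P C k p \<epsilon>" by (rule PP_cover[OF t(2)])
  have "pull \<C> A p \<delta> = ze P A" by (rule xextD[OF conjunct2[OF T] P(1)]) (use triD[OF xtri_tri[OF P(2)]] in auto)
  moreover obtain M m e where "tri A M P m e (ze P A)" using tri_exists[of P A "ze P A"] t P by auto
  ultimately have "xtri A M P m e (pull \<C> A p \<delta>)" using split_xtri by simp
  then show "xtri A B C x y \<delta>" by (rule saturated[OF conjunct1[OF T] P(2)])
qed

text \<open>Membership in \<open>\<xi>\<close> in the form in which it is verified below: by
  \<open>lift_iff\<close>, an extension dies on every projective as soon as projectives lift along
  the deflation.\<close>

lemma xtriI:
  assumes "tri A B C x y \<delta>"
    and "\<And>P t. P \<in> PP \<Longrightarrow> \<guillemotleft>t : P \<rightarrow> C\<guillemotright> \<Longrightarrow> \<exists>s. \<guillemotleft>s : P \<rightarrow> B\<guillemotright> \<and> t = y \<cdot> s"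
  shows "xtri A B C x y \<delta>"
  unfolding xtri_iff xext_def using assms lift_iff[OF assms(1)] triD[OF assms(1)] by blast

lemma xtriD:
  assumes "xtri A B C x y \<delta>"
  shows "A \<in> Obj \<C>" "B \<in> Obj \<C>" "C \<in> Obj \<C>" "\<guillemotleft>x : A \<rightarrow> B\<guillemotright>" "\<guillemotleft>y : B \<rightarrow> C\<guillemotright>" "\<delta> \<in> E C A" "\<delta> \<in> xext C A"
  using triD[OF xtri_tri[OF assms]] assms xtri_iff by blast+

lemma xtri_exists:
  assumes "C \<in> Obj \<C>" "A \<in> Obj \<C>" "\<delta> \<in> xext C A"
  obtains B x y where "xtri A B C x y \<delta>"
  using tri_exists[OF assms(1,2) xext_in_E[OF assms(3)]] assms(3) xtri_iff by metis

lemma xext_pull: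
  assumes "\<delta> \<in> xext C A" "\<guillemotleft>c : C' \<rightarrow> C\<guillemotright>" "A \<in> Obj \<C>"
  shows "pull \<C> A c \<delta> \<in> xext C' A"
  unfolding xext_def
proof (intro CollectI conjI ballI allI impI)
  show "pull \<C> A c \<delta> \<in> E C' A" using assms xext_in_E by auto
  fix P t assume P: "P \<in> PP" "\<guillemotleft>t : P \<rightarrow> C'\<guillemotright>"
  then have "\<guillemotleft>c \<cdot> t : P \<rightarrow> C\<guillemotright>" using assms by auto
  then have "pull \<C> A (c \<cdot> t) \<delta> = ze P A" by (rule xextD[OF assms(1) P(1)])
  then show "pull \<C> A t (pull \<C> A c \<delta>) = ze P A"
    using pull_comp[of c t A \<delta>] P assms xext_in_E by simp
qed

lemma xext_push:
  assumes "\<delta> \<in> xext C A" "\<guillemotleft>a : A \<rightarrow> A'\<guillemotright>" "C \<in> Obj \<C>"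
  shows "push \<C> C a \<delta> \<in> xext C A'"
  unfolding xext_def
proof (intro CollectI conjI ballI allI impI)
  show "push \<C> C a \<delta> \<in> E C A'" using assms xext_in_E by auto
  fix P t assume P: "P \<in> PP" "\<guillemotleft>t : P \<rightarrow> C\<guillemotright>"
  have "pull \<C> A' t (push \<C> C a \<delta>) = push \<C> P a (pull \<C> A t \<delta>)"
    using push_pull[of t P C a A A' \<delta>] P assms xext_in_E by simp
  also have "pull \<C> A t \<delta> = ze P A" by (rule xextD[OF assms(1) P])
  finally show "pull \<C> A' t (push \<C> C a \<delta>) = ze P A'" using P assms by simp
qed

section \<open>Closure properties of projectives\<close>

lemma PP_xext: "P \<in> PP \<Longrightarrow> \<delta> \<in> xext P A \<Longrightarrow> A \<in> Obj \<C> \<Longrightarrow> \<delta> = ze P A"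
  using xextD[of \<delta> P A P "ide \<C> P"] emap_ide[of P A \<delta>] xext_in_E by simp

lemma PP_retract:
  assumes "P \<in> PP" "\<guillemotleft>i : Q \<rightarrow> P\<guillemotright>" "\<guillemotleft>r : P \<rightarrow> Q\<guillemotright>" "r \<cdot> i = ide \<C> Q"
  shows "Q \<in> PP"
proof (rule PP_I)
  show "Q \<in> Obj \<C>" using assms by auto
next
  fix A B C x y \<delta> t assume T: "xtri A B C x y \<delta>" and t: "\<guillemotleft>t : Q \<rightarrow> C\<guillemotright>"
  obtain s where s: "\<guillemotleft>s : P \<rightarrow> B\<guillemotright>" "t \<cdot> r = y \<cdot> s"
    using PP_lift[OF assms(1) T, of "t \<cdot> r"] t assms by auto
  have "t = (t \<cdot> r) \<cdot> i" using t assms by simp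
  also have "\<dots> = y \<cdot> (s \<cdot> i)" unfolding s(2) using s(1) xtriD[OF T] assms by simp
  finally show "\<exists>s. \<guillemotleft>s : Q \<rightarrow> B\<guillemotright> \<and> t = y \<cdot> s" using s assms by (intro exI[of _ "s \<cdot> i"]) auto
next
  fix A B C x y \<delta> t assume T: "xtri A B C x y \<delta>" and t: "\<guillemotleft>t : Q \<rightarrow> A\<guillemotright>" "x \<cdot> t = zr Q B"
  have "x \<cdot> (t \<cdot> r) = zr P B" using comp_subst[OF t(2), of r] t(1) xtriD[OF T] assms by simp
  then have "t \<cdot> r = zr P A" using PP_mono[OF assms(1) T, of "t \<cdot> r"] t(1) assms by simp
  then have "t \<cdot> r \<cdot> i = zr Q A" using comp_assoc'[of i r t] t(1) assms xtriD[OF T] by simp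
  then show "t = zr Q A" using t(1) assms by simp
qed

text \<open>An arrow out of \<open>N\<close> is the sum of its parts on the summands
  \<open>P\<close> and \<open>Q\<close>, so lifting and injectivity are checked on these.\<close>

lemma PP_extension:
  assumes S: "tri P N Q i p (ze Q P)" and "P \<in> PP" "Q \<in> PP"
  shows "N \<in> PP"
proof (rule PP_I)
  note s = triD[OF S]
  obtain r q where rq: "\<guillemotleft>r : N \<rightarrow> P\<guillemotright>" "\<guillemotleft>q : Q \<rightarrow> N\<guillemotright>" "i \<cdot> r \<boxplus> q \<cdot> p = ide \<C> N"
    using tri_split[OF S] by blast
  have dec: "t = (t \<cdot> i) \<cdot> r \<boxplus> (t \<cdot> q) \<cdot> p" if "\<guillemotleft>t : N \<rightarrow> W\<guillemotright>" for t W
  proof -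
    have "t = t \<cdot> (i \<cdot> r \<boxplus> q \<cdot> p)" unfolding rq(3) using that by simp
    also have "\<dots> = (t \<cdot> i) \<cdot> r \<boxplus> (t \<cdot> q) \<cdot> p" using that rq(1,2) s by simp
    finally show ?thesis .
  qed
  show "N \<in> Obj \<C>" using s by auto
  show "\<exists>s. \<guillemotleft>s : N \<rightarrow> B\<guillemotright> \<and> t = y \<cdot> s" if T: "xtri A B C x y \<delta>" and t: "\<guillemotleft>t : N \<rightarrow> C\<guillemotright>" for A B C x y \<delta> t
  proof -
    obtain s1 where s1: "\<guillemotleft>s1 : P \<rightarrow> B\<guillemotright>" "t \<cdot> i = y \<cdot> s1"
      using PP_lift[OF assms(2) T, of "t \<cdot> i"] t s by auto
    obtain s2 where s2: "\<guillemotleft>s2 : Q \<rightarrow> B\<guillemotright>" "t \<cdot> q = y \<cdot> s2"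
      using PP_lift[OF assms(3) T, of "t \<cdot> q"] t rq s by auto
    have "t = (y \<cdot> s1) \<cdot> r \<boxplus> (y \<cdot> s2) \<cdot> p" using dec[OF t] s1(2) s2(2) by metis
    also have "\<dots> = y \<cdot> (s1 \<cdot> r \<boxplus> s2 \<cdot> p)" using s1(1) s2(1) rq(1,2) s xtriD[OF T] by simp
    finally show ?thesis using s1(1) s2(1) rq(1,2) s by (intro exI[of _ "s1 \<cdot> r \<boxplus> s2 \<cdot> p"]) auto
  qed
  show "t = zr N A" if T: "xtri A B C x y \<delta>" and t: "\<guillemotleft>t : N \<rightarrow> A\<guillemotright>" "x \<cdot> t = zr N B" for A B C x y \<delta> t
  proof -
    have "t \<cdot> i = zr P A" "t \<cdot> q = zr Q A"
      using PP_mono[OF assms(2) T, of "t \<cdot> i"] PP_mono[OF assms(3) T, of "t \<cdot> q"]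
        comp_subst[OF t(2), of i] comp_subst[OF t(2), of q] t(1) s rq(1,2) xtriD[OF T] by simp_all
    then show ?thesis using dec[OF t(1)] s rq(1,2) xtriD[OF T] by simp
  qed
qed

lemma zero_PP: "is_zero_obj \<C> Z \<Longrightarrow> Z \<in> PP"
proof (rule PP_I)
  assume Z: "is_zero_obj \<C> Z"
  note z = zero_obj_typed[OF Z]
  show "Z \<in> Obj \<C>" by (rule z)
  show "\<exists>s. \<guillemotleft>s : Z \<rightarrow> B\<guillemotright> \<and> t = y \<cdot> s" if "xtri A B C x y \<delta>" "\<guillemotleft>t : Z \<rightarrow> C\<guillemotright>" for A B C x y \<delta> t
    using z that xtriD[OF that(1)] by (intro exI[of _ "zr Z B"]) auto
  show "t = zr Z A" if "\<guillemotleft>t : Z \<rightarrow> A\<guillemotright>" for A t using z that by auto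
qed

section \<open>(ET4), pushouts and pullbacks inside \<open>\<xi>\<close>\<close>

lemma ET4_xi:
  assumes T: "xtri A B D f f' \<delta>" and S: "xtri B C F g g' \<delta>'"
  obtains G h' d e \<delta>'' \<eta> where "xtri A C G (g \<cdot> f) h' \<delta>''" "xtri D G F d e \<eta>"
    "h' \<cdot> g = d \<cdot> f'" "e \<cdot> h' = g'"
proof -
  obtain G \<delta>'' h' d e where G: "tri A C G (g \<cdot> f) h' \<delta>''" "tri D G F d e (push \<C> F f' \<delta>')"
    and e: "h' \<cdot> g = d \<cdot> f'" "e \<cdot> h' = g'"
    using ET4[OF xtri_tri[OF T] xtri_tri[OF S]] by blast
  note t = xtriD[OF T] and s = xtriD[OF S] and g = triD[OF G(1)] triD[OF G(2)]
  have "xtri D G F d e (push \<C> F f' \<delta>')"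
    using G xext_push[OF s(7)] t s xtri_iff by blast
  moreover have "xtri A C G (g \<cdot> f) h' \<delta>''"
  proof (rule xtriI[OF G(1)])
    fix P u assume P: "P \<in> PP" and u: "\<guillemotleft>u : P \<rightarrow> G\<guillemotright>"
    \<comment> \<open>Two-stage lift along \<open>h'\<close>: \<open>r\<close> is right after
      applying \<open>e\<close>, so \<open>u\<close> and \<open>h' \<cdot> r\<close> differ by an
      arrow through \<open>d\<close>, and that one lifts along \<open>f'\<close>.\<close>
    obtain r where r: "\<guillemotleft>r : P \<rightarrow> C\<guillemotright>" "e \<cdot> u = g' \<cdot> r" using PP_lift[OF P S, of "e \<cdot> u"] u g by auto
    have eu: "e \<cdot> u = e \<cdot> (h' \<cdot> r)" using r comp_subst[OF e(2), of r] g by simp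
    have hr: "\<guillemotleft>h' \<cdot> r : P \<rightarrow> G\<guillemotright>" using r(1) g by simp
    obtain q where q: "\<guillemotleft>q : P \<rightarrow> D\<guillemotright>" "u = h' \<cdot> r \<boxplus> d \<cdot> q"
      by (rule diff_through_inflation[OF G(2) u hr eu])
    obtain v where v: "\<guillemotleft>v : P \<rightarrow> B\<guillemotright>" "q = f' \<cdot> v" using PP_lift[OF P T q(1)] by blast
    have "h' \<cdot> (r \<boxplus> g \<cdot> v) = u"
      unfolding q(2) v(2) using comp_subst[OF e(1), of v] v(1) r(1) g s t by simp
    then show "\<exists>s. \<guillemotleft>s : P \<rightarrow> C\<guillemotright> \<and> u = h' \<cdot> s"
      using v(1) r(1) s by (intro exI[of _ "r \<boxplus> g \<cdot> v"]) auto
  qed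
  ultimately show ?thesis using that e by blast
qed

lemma ET4_op_xi:
  assumes T: "xtri D A B f' f \<delta>" and S: "xtri F B C g' g \<delta>'"
  obtains G h' d e \<delta>'' \<eta> where "xtri G A C h' (g \<cdot> f) \<delta>''" "xtri D G F d e \<eta>"
    "f \<cdot> h' = g' \<cdot> e" "h' \<cdot> d = f'"
proof -
  obtain G \<delta>'' h' d e where G: "tri G A C h' (g \<cdot> f) \<delta>''" "tri D G F d e (pull \<C> D g' \<delta>)"
    and e: "f \<cdot> h' = g' \<cdot> e" "h' \<cdot> d = f'"
    using ET4_op[OF xtri_tri[OF T] xtri_tri[OF S]] by blast
  note t = xtriD[OF T] and s = xtriD[OF S] and g = triD[OF G(1)] triD[OF G(2)]
  have "xtri D G F d e (pull \<C> D g' \<delta>)"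
    using G xext_pull[OF t(7)] t s xtri_iff by blast
  moreover have "xtri G A C h' (g \<cdot> f) \<delta>''"
  proof (rule xtriI[OF G(1)])
    fix P u assume P: "P \<in> PP" and u: "\<guillemotleft>u : P \<rightarrow> C\<guillemotright>"
    obtain r where r: "\<guillemotleft>r : P \<rightarrow> B\<guillemotright>" "u = g \<cdot> r" using PP_lift[OF P S u] by blast
    obtain q where q: "\<guillemotleft>q : P \<rightarrow> A\<guillemotright>" "r = f \<cdot> q" using PP_lift[OF P T r(1)] by blast
    show "\<exists>s. \<guillemotleft>s : P \<rightarrow> A\<guillemotright> \<and> u = (g \<cdot> f) \<cdot> s"
      using q r s t by (intro exI[of _ q]) auto
  qed
  ultimately show ?thesis using that e by blast
qed

text \<open>\<open>M\<close> realizes the pushforward of \<open>\<delta>\<close> along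
  \<open>a\<close>. For the second triangle, (ET4) produces \<open>D -> G -> C\<close>, which
  splits, and the dual of (ET4) is applied along a retraction \<open>r\<close> of \<open>d\<close>.
  The object it starts with realizes the pullback of \<open>\<delta>''\<close> along the
  complementary section, so the section must be chosen to return \<open>\<delta>\<close>.\<close>

lemma pushout_xi:
  assumes T: "xtri A B C x y \<delta>" and S: "xtri A A' D a p \<epsilon>"
  obtains M x' y' b q \<eta> \<theta> where "xtri A' M C x' y' \<eta>" "xtri B M D b q \<theta>"
proof -
  note t = xtriD[OF T] and s = xtriD[OF S]
  let ?\<delta>1 = "push \<C> C a \<delta>"
  have "?\<delta>1 \<in> xext C A'" using xext_push t s by blast
  then obtain M x' y' where M: "xtri A' M C x' y' ?\<delta>1" using xtri_exists t s by metis
  note m = xtriD[OF M]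
  obtain G \<delta>'' h' d e where G: "tri A M G (x' \<cdot> a) h' \<delta>''" "tri D G C d e (push \<C> C p ?\<delta>1)"
    and e: "h' \<cdot> x' = d \<cdot> p" "e \<cdot> h' = y'" "pull \<C> A d \<delta>'' = \<epsilon>" "push \<C> G a \<delta>'' = pull \<C> A' e ?\<delta>1"
    using ET4[OF xtri_tri[OF S] xtri_tri[OF M]] by blast
  note g = triD[OF G(1)] triD[OF G(2)]
  \<comment> \<open>Consecutive arrows of a triangle compose to zero, so this extension of
    \<open>C\<close> by \<open>D\<close> dies and \<open>G\<close> is a direct sum.\<close>
  have "push \<C> C p ?\<delta>1 = push \<C> C (p \<cdot> a) \<delta>" by (rule push_comp[symmetric]) (use t s in auto)
  also have "\<dots> = ze C D" unfolding tri_comp_zr[OF xtri_tri[OF S]] using t s by simp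
  finally have GS: "tri D G C d e (ze C D)" using G by simp
  obtain s0 where s0: "\<guillemotleft>s0 : C \<rightarrow> G\<guillemotright>" "e \<cdot> s0 = ide \<C> C" using tri_split[OF GS] by blast
  have "push \<C> C a (pull \<C> A s0 \<delta>'') = pull \<C> A' s0 (push \<C> G a \<delta>'')"
    by (rule push_pull[of s0 C G a A A' \<delta>'']) (use s0(1) g(1,3,6) s(4) in simp_all)
  also have "\<dots> = pull \<C> A' (e \<cdot> s0) ?\<delta>1"
    unfolding e(4) by (rule pull_comp[symmetric]) (use s0(1) g(11) m in simp_all)
  also have "\<dots> = ?\<delta>1" unfolding s0 using emap_ide m by simp
  finally have eq: "push \<C> C a \<delta> = push \<C> C a (pull \<C> A s0 \<delta>'')" by simp
  obtain u where u: "\<guillemotleft>u : C \<rightarrow> D\<guillemotright>" "\<delta> = pull \<C> A s0 \<delta>'' \<otimes>\<^bsub>Ext \<C> C A\<^esub> pull \<C> A u \<epsilon>"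
    by (rule ext_diff_pull[OF xtri_tri[OF S] _ _ _ eq]) (use t s0(1) g in simp_all)
  \<comment> \<open>An arbitrary section \<open>s0\<close> pulls \<open>\<delta>''\<close> back to \<open>\<delta>\<close> only up to \<open>u\<^sup>* \<epsilon>\<close>; this one does so exactly.\<close>
  let ?s = "s0 \<boxplus> d \<cdot> u"
  have st: "\<guillemotleft>?s : C \<rightarrow> G\<guillemotright>" using s0(1) u(1) g by simp
  have "pull \<C> A ?s \<delta>'' = pull \<C> A s0 \<delta>'' \<otimes>\<^bsub>Ext \<C> C A\<^esub> pull \<C> A (d \<cdot> u) \<delta>''"
    by (rule pull_add) (use s0(1) u(1) g in simp_all)
  also have "pull \<C> A (d \<cdot> u) \<delta>'' = pull \<C> A u \<epsilon>"
    unfolding e(3)[symmetric] by (rule pull_comp) (use u(1) g in simp_all)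
  finally have ps: "pull \<C> A ?s \<delta>'' = \<delta>" using u by simp
  have "e \<cdot> ?s = ide \<C> C" using s0 u(1) g comp_subst[OF tri_comp_zr[OF GS], of u] by simp
  then obtain r where r: "tri C G D ?s r (ze D C)" "r \<cdot> d = ide \<C> D"
    using split_by_section[OF GS st] by blast
  note r' = triD[OF r(1)]
  obtain B2 \<eta> h'' d2 e2 where B2: "tri B2 M D h'' (r \<cdot> h') \<eta>" "tri A B2 C d2 e2 (pull \<C> A ?s \<delta>'')"
    using ET4_op[OF G(1) r(1)] by blast
  \<comment> \<open>Realizations of the same extension have isomorphic middle terms, so
    \<open>B2\<close> can be replaced by \<open>B\<close>.\<close>
  obtain b b' where b: "inverse_arrows b b' B B2"
    using tri_unique[OF xtri_tri[OF T]] B2(2) ps by metis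
  obtain \<theta> where th: "tri B M D (h'' \<cdot> b) (r \<cdot> h') \<theta>" using tri_iso_left[OF B2(1) b] by blast
  have "xtri B M D (h'' \<cdot> b) (r \<cdot> h') \<theta>"
  proof (rule xtriI[OF th])
    fix P v assume P: "P \<in> PP" and v: "\<guillemotleft>v : P \<rightarrow> D\<guillemotright>"
    obtain w where w: "\<guillemotleft>w : P \<rightarrow> A'\<guillemotright>" "v = p \<cdot> w" using PP_lift[OF P S v] by blast
    have "r \<cdot> (h' \<cdot> (x' \<cdot> w)) = v"
      using comp_subst[OF e(1), of w] comp_subst[OF r(2), of "p \<cdot> w"] w m(4) g(5,10) r'(5) s(5) by simp
    then show "\<exists>s. \<guillemotleft>s : P \<rightarrow> M\<guillemotright> \<and> v = (r \<cdot> h') \<cdot> s"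
      using w(1) m g r' by (intro exI[of _ "x' \<cdot> w"]) auto
  qed
  then show ?thesis using that M by blast
qed

text \<open>The construction is dual to that of \<open>pushout_xi\<close>, but \<open>\<xi>\<close>
  is still recognised by lifting projectives, which makes the test for the second triangle
  longer.\<close>

lemma pullback_xi:
  assumes T1: "xtri A1 B1 C x1 y1 \<delta>1" and T2: "xtri A2 B2 C x2 y2 \<delta>2"
  obtains M m e k q \<eta> \<theta> where "xtri A1 M B2 m e \<eta>" "xtri A2 M B1 k q \<theta>"
proof -
  note t1 = xtriD[OF T1] and t2 = xtriD[OF T2]
  let ?\<eta> = "pull \<C> A1 y2 \<delta>1"
  have "?\<eta> \<in> xext B2 A1" using xext_pull t1 t2 by blast
  then obtain M m e where M: "xtri A1 M B2 m e ?\<eta>" using xtri_exists t1 t2 by metis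
  note m = xtriD[OF M]
  obtain G \<delta>'' h' d e' where G: "tri G M C h' (y2 \<cdot> e) \<delta>''" "tri A1 G A2 d e' (pull \<C> A1 x2 ?\<eta>)"
    and e: "e \<cdot> h' = x2 \<cdot> e'" "h' \<cdot> d = m" "push \<C> C e' \<delta>'' = \<delta>2" "push \<C> B2 d ?\<eta> = pull \<C> G y2 \<delta>''"
    using ET4_op[OF xtri_tri[OF M] xtri_tri[OF T2]] by blast
  note g = triD[OF G(1)] triD[OF G(2)]
  have "pull \<C> A1 x2 ?\<eta> = pull \<C> A1 (y2 \<cdot> x2) \<delta>1" by (rule pull_comp[symmetric]) (use t1 t2 in auto)
  also have "\<dots> = ze A2 A1" unfolding tri_comp_zr[OF xtri_tri[OF T2]] using t1 t2 by simp
  finally have GS: "tri A1 G A2 d e' (ze A2 A1)" using G by simp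
  obtain r0 where r0: "\<guillemotleft>r0 : G \<rightarrow> A1\<guillemotright>" "r0 \<cdot> d = ide \<C> A1" using tri_split[OF GS] by blast
  have "pull \<C> A1 y2 (push \<C> C r0 \<delta>'') = push \<C> B2 r0 (pull \<C> G y2 \<delta>'')"
    by (rule push_pull[of y2 B2 C r0 G A1 \<delta>'', symmetric]) (use r0(1) g(1,3,6) t2(5) in simp_all)
  also have "\<dots> = push \<C> B2 (r0 \<cdot> d) ?\<eta>"
    unfolding e(4)[symmetric] by (rule push_comp[symmetric]) (use r0(1) g m in simp_all)
  also have "\<dots> = ?\<eta>" unfolding r0 using emap_ide m by simp
  finally have eq: "pull \<C> A1 y2 \<delta>1 = pull \<C> A1 y2 (push \<C> C r0 \<delta>'')" by simp
  obtain u where u: "\<guillemotleft>u : A2 \<rightarrow> A1\<guillemotright>" "\<delta>1 = push \<C> C r0 \<delta>'' \<otimes>\<^bsub>Ext \<C> C A1\<^esub> push \<C> C u \<delta>2"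
    by (rule ext_diff_push[OF xtri_tri[OF T2] _ _ _ eq]) (use t1 r0(1) g in simp_all)
  \<comment> \<open>With the correction by \<open>u \<cdot> e'\<close> the retraction pushes
    \<open>\<delta>''\<close> forward to \<open>\<delta>1\<close> exactly, so that the cokernel
    object obtained from (ET4) is \<open>B1\<close> up to isomorphism.\<close>
  let ?r = "r0 \<boxplus> u \<cdot> e'"
  have rt: "\<guillemotleft>?r : G \<rightarrow> A1\<guillemotright>" using r0(1) u(1) g by simp
  have "push \<C> C ?r \<delta>'' = push \<C> C r0 \<delta>'' \<otimes>\<^bsub>Ext \<C> C A1\<^esub> push \<C> C (u \<cdot> e') \<delta>''"
    by (rule push_add) (use r0(1) u(1) g in simp_all)
  also have "push \<C> C (u \<cdot> e') \<delta>'' = push \<C> C u \<delta>2"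
    unfolding e(3)[symmetric] by (rule push_comp) (use u(1) g in simp_all)
  finally have ps: "push \<C> C ?r \<delta>'' = \<delta>1" using u by simp
  have "?r \<cdot> d = ide \<C> A1" using r0 u(1) g tri_comp_zr[OF GS] by simp
  then obtain s where s: "tri A2 G A1 s ?r (ze A1 A2)" "e' \<cdot> s = ide \<C> A2"
    using split_by_retraction[OF GS rt] by blast
  note s' = triD[OF s(1)]
  obtain B \<theta> h d2 e2 where B: "tri A2 M B (h' \<cdot> s) h \<theta>" "tri A1 B C d2 e2 (push \<C> C ?r \<delta>'')"
    and he: "h \<cdot> h' = d2 \<cdot> ?r" "e2 \<cdot> h = y2 \<cdot> e"
    using ET4[OF s(1) G(1)] by blast
  obtain b b' where b: "inverse_arrows b b' B B1" "b \<cdot> d2 = x1" "y1 \<cdot> b = e2"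
    using tri_unique[of A1 B C d2 e2 \<delta>1] xtri_tri[OF T1] B(2) ps by metis
  note b' = b(1)[unfolded inverse_arrows_def] and tb = triD[OF B(1)] triD[OF B(2)]
  obtain \<theta>' where th: "tri A2 M B1 (h' \<cdot> s) (b \<cdot> h) \<theta>'" using tri_iso_right[OF B(1) b(1)] by blast
  have "xtri A2 M B1 (h' \<cdot> s) (b \<cdot> h) \<theta>'"
  proof (rule xtriI[OF th])
    fix P v assume P: "P \<in> PP" and v: "\<guillemotleft>v : P \<rightarrow> B1\<guillemotright>"
    \<comment> \<open>Lift \<open>y1 \<cdot> v\<close> along \<open>y2\<close> and then to
      \<open>M\<close>. This reaches \<open>v\<close> up to some \<open>x1 \<cdot> i\<close>, which
      in turn comes from \<open>M\<close> because \<open>?r\<close> retracts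
      \<open>d\<close>.\<close>
    obtain w where w: "\<guillemotleft>w : P \<rightarrow> B2\<guillemotright>" "y1 \<cdot> v = y2 \<cdot> w" using PP_lift[OF P T2, of "y1 \<cdot> v"] v t1 by auto
    obtain z where z: "\<guillemotleft>z : P \<rightarrow> M\<guillemotright>" "w = e \<cdot> z" using PP_lift[OF P M w(1)] by blast
    have "y1 \<cdot> (b \<cdot> (h \<cdot> z)) = y2 \<cdot> (e \<cdot> z)"
      using comp_subst[OF b(3), of "h \<cdot> z"] comp_subst[OF he(2), of z] z(1) b' tb t1 t2 m by simp
    then have yv: "y1 \<cdot> v = y1 \<cdot> (b \<cdot> (h \<cdot> z))" using w z by simp
    have bz: "\<guillemotleft>b \<cdot> (h \<cdot> z) : P \<rightarrow> B1\<guillemotright>" using z(1) b' tb by simp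
    obtain i where i: "\<guillemotleft>i : P \<rightarrow> A1\<guillemotright>" "v = b \<cdot> (h \<cdot> z) \<boxplus> x1 \<cdot> i"
      by (rule diff_through_inflation[OF xtri_tri[OF T1] v bz yv])
    have rd: "?r \<cdot> (d \<cdot> i) = i" using comp_subst[OF \<open>?r \<cdot> d = ide \<C> A1\<close>, of i] i(1) rt g by simp
    have "b \<cdot> (h \<cdot> (h' \<cdot> (d \<cdot> i))) = b \<cdot> (d2 \<cdot> (?r \<cdot> (d \<cdot> i)))"
      using comp_subst[OF he(1), of "d \<cdot> i"] comp_assoc'[of "d \<cdot> i" ?r d2] i(1) rt tb g by simp
    also have "\<dots> = x1 \<cdot> i" unfolding rd using comp_subst[OF b(2), of i] i(1) b' tb by simp
    finally have "v = (b \<cdot> h) \<cdot> (z \<boxplus> h' \<cdot> (d \<cdot> i))"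
      unfolding i(2) using i(1) z(1) b' tb g by simp
    then show "\<exists>s. \<guillemotleft>s : P \<rightarrow> M\<guillemotright> \<and> v = (b \<cdot> h) \<cdot> s"
      using z(1) i(1) g by (intro exI[of _ "z \<boxplus> h' \<cdot> (d \<cdot> i)"]) auto
  qed
  then show ?thesis using that M by blast
qed

section \<open>Gorenstein projective objects\<close>

definition ext_zero :: "'o \<Rightarrow> 'o \<Rightarrow> bool" where
  "ext_zero B W \<longleftrightarrow> (\<forall>\<delta> \<in> xext B W. \<delta> = ze B W)"

text \<open>
  Deflations in \<open>\<xi>\<close> need not be epimorphisms: phantoms are what obstructs the exactness of
  \<open>0 \<rightarrow> \<C>(C, W) \<rightarrow> \<C>(B, W)\<close>.
\<close>

definition phantom :: "'o \<Rightarrow> 'o \<Rightarrow> 'm \<Rightarrow> bool" where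
  "phantom B W h \<longleftrightarrow> \<guillemotleft>h : B \<rightarrow> W\<guillemotright> \<and> (\<forall>P \<in> PP. \<forall>t. \<guillemotleft>t : P \<rightarrow> B\<guillemotright> \<longrightarrow> h \<cdot> t = zr P W)"

text \<open>What a complete resolution asks of a syzygy, made a property of the object:
  contravariant exactness of one triangle of \<open>\<xi>\<close> from a projective onto
  \<open>B\<close> implies it, and it implies exactness of every triangle of \<open>\<xi>\<close>
  ending in \<open>B\<close>.\<close>

definition left_acyclic :: "'o \<Rightarrow> bool" where
  "left_acyclic B \<longleftrightarrow>
     B \<in> Obj \<C> \<and> (\<forall>W \<in> PP. ext_zero B W \<and> (\<forall>h. phantom B W h \<longrightarrow> h = zr B W))"

lemma left_acyclicD:
  assumes "left_acyclic B"
  shows "B \<in> Obj \<C>" "W \<in> PP \<Longrightarrow> ext_zero B W" "W \<in> PP \<Longrightarrow> phantom B W h \<Longrightarrow> h = zr B W"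
  using assms by (auto simp: left_acyclic_def)

lemma phantomD: "phantom B W h \<Longrightarrow> P \<in> PP \<Longrightarrow> \<guillemotleft>t : P \<rightarrow> B\<guillemotright> \<Longrightarrow> h \<cdot> t = zr P W"
  by (simp add: phantom_def)

lemma phantom_typed: "phantom B W h \<Longrightarrow> \<guillemotleft>h : B \<rightarrow> W\<guillemotright>"
  by (simp add: phantom_def)

lemma phantomI:
  assumes "\<guillemotleft>h : B \<rightarrow> W\<guillemotright>" "\<And>P t. P \<in> PP \<Longrightarrow> \<guillemotleft>t : P \<rightarrow> B\<guillemotright> \<Longrightarrow> h \<cdot> t = zr P W"
  shows "phantom B W h"
  using assms(1) assms(2) unfolding phantom_def by (intro conjI ballI allI impI) simp_all

lemma ext_zero_extend:
  assumes T: "xtri A B C x y \<delta>" and "ext_zero C W" and h: "\<guillemotleft>h : A \<rightarrow> W\<guillemotright>"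
  obtains s where "\<guillemotleft>s : B \<rightarrow> W\<guillemotright>" "h = s \<cdot> x"
proof -
  note t = xtriD[OF T]
  have "push \<C> C h \<delta> \<in> xext C W" by (rule xext_push[OF t(7) h t(3)])
  then have "push \<C> C h \<delta> = ze C W" using assms(2) unfolding ext_zero_def by blast
  then have "\<exists>s. \<guillemotleft>s : B \<rightarrow> W\<guillemotright> \<and> h = s \<cdot> x" using extend_iff[OF xtri_tri[OF T] h] by simp
  then show ?thesis using that by blast
qed

text \<open>Pulled back to the projective \<open>P\<close>, a relative extension of \<open>B\<close>
  vanishes, so it is pushed forward from \<open>\<epsilon>\<close> along some \<open>h\<close>; an
  \<open>h\<close> that extends to \<open>P\<close> yields zero.\<close>

lemma ext_zero_of_cover:
  assumes T: "xtri K P B k p \<epsilon>" and P: "P \<in> PP" and W: "W \<in> Obj \<C>"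
    and ex: "\<And>h. \<guillemotleft>h : K \<rightarrow> W\<guillemotright> \<Longrightarrow> \<exists>s. \<guillemotleft>s : P \<rightarrow> W\<guillemotright> \<and> h = s \<cdot> k"
  shows "ext_zero B W"
  unfolding ext_zero_def
proof
  fix \<delta> assume d: "\<delta> \<in> xext B W"
  note t = xtriD[OF T]
  obtain Y x y where Y: "tri W Y B x y \<delta>" using tri_exists[OF t(3) W xext_in_E[OF d]] .
  have "pull \<C> W p \<delta> = ze P W" by (rule xextD[OF d P t(5)])
  then obtain h where h: "\<guillemotleft>h : K \<rightarrow> W\<guillemotright>" "push \<C> B h \<epsilon> = \<delta>"
    using ext_from_lift[OF Y xtri_tri[OF T]] by metis
  then show "\<delta> = ze B W" using extend_iff[OF xtri_tri[OF T] h(1)] ex[OF h(1)] by simp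
qed

lemma contravariant_exactI:
  assumes T: "xtri A B C x y \<delta>" and C: "left_acyclic C" and W: "W \<in> PP"
  shows "contravariant_exact \<C> W (ETri A B C x y \<delta>)"
  unfolding contravariant_exact_iff[OF xtri_tri[OF T] PP_obj[OF W]]
proof (intro conjI allI impI)
  note t = xtriD[OF T]
  fix h assume h: "\<guillemotleft>h : C \<rightarrow> W\<guillemotright>" "h \<cdot> y = zr B W"
  have "phantom C W h"
  proof (rule phantomI[OF h(1)])
    fix P u assume P: "P \<in> PP" "\<guillemotleft>u : P \<rightarrow> C\<guillemotright>"
    obtain s where s: "\<guillemotleft>s : P \<rightarrow> B\<guillemotright>" "u = y \<cdot> s" by (rule PP_lift[OF P(1) T P(2)])
    show "h \<cdot> u = zr P W" unfolding s(2) using comp_subst[OF h(2), of s] s(1) h(1) t W by simp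
  qed
  then show "h = zr C W" by (rule left_acyclicD(3)[OF C W])
next
  fix h assume h: "\<guillemotleft>h : A \<rightarrow> W\<guillemotright>"
  show "\<exists>s. \<guillemotleft>s : B \<rightarrow> W\<guillemotright> \<and> h = s \<cdot> x"
    by (rule ext_zero_extend[OF T left_acyclicD(2)[OF C W] h]) blast
qed

lemma left_acyclicI:
  assumes T: "xtri K P C k p \<epsilon>" and P: "P \<in> PP"
    and ex: "\<And>W. W \<in> PP \<Longrightarrow> contravariant_exact \<C> W (ETri K P C k p \<epsilon>)"
  shows "left_acyclic C"
  unfolding left_acyclic_def
proof (intro conjI ballI allI impI)
  note t = xtriD[OF T]
  show "C \<in> Obj \<C>" by (rule t)
  fix W assume W: "W \<in> PP"
  note ex' = ex[OF W, unfolded contravariant_exact_iff[OF xtri_tri[OF T] PP_obj[OF W]]]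
  show "ext_zero C W"
    by (rule ext_zero_of_cover[OF T P PP_obj[OF W]]) (use ex' in simp)
  fix h assume h: "phantom C W h"
  have "h \<cdot> p = zr P W" by (rule phantomD[OF h P t(5)])
  then show "h = zr C W" using ex' phantom_typed[OF h] by simp
qed

text \<open>Choosing one step on each side and iterating splices a doubly infinite complex with
  \<open>A\<close> as syzygy in degree 0. All syzygies stay in \<open>X\<close>, so their acyclicity
  supplies the exactness of every triangle.\<close>

lemma GP_coinduct:
  assumes A: "A \<in> X"
    and ac: "\<And>B. B \<in> X \<Longrightarrow> left_acyclic B"
    and left: "\<And>B. B \<in> X \<Longrightarrow> \<exists>K \<in> X. \<exists>P k p \<epsilon>. P \<in> PP \<and> xtri K P B k p \<epsilon>"
    and right: "\<And>B. B \<in> X \<Longrightarrow> \<exists>K \<in> X. \<exists>P k p \<epsilon>. P \<in> PP \<and> xtri B P K k p \<epsilon>"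
  shows "A \<in> GP \<C> \<xi>"
proof -
  obtain L where L: "\<And>B. B \<in> X \<Longrightarrow> L B \<in> X \<and> (\<exists>P k p \<epsilon>. P \<in> PP \<and> xtri (L B) P B k p \<epsilon>)"
    using left by metis
  obtain R where R: "\<And>B. B \<in> X \<Longrightarrow> R B \<in> X \<and> (\<exists>P k p \<epsilon>. P \<in> PP \<and> xtri B P (R B) k p \<epsilon>)"
    using right by metis
  \<comment> \<open>The two halves are indexed oppositely: \<open>K (n + 1) = L (K n)\<close> for
    \<open>n \<ge> 0\<close>, but \<open>K n = R (K (n + 1))\<close> for
    \<open>n < 0\<close>.\<close>
  define K where "K n = (if 0 \<le> n then (L ^^ nat n) A else (R ^^ nat (- n)) A)" for n :: int
  have "(L ^^ n) A \<in> X \<and> (R ^^ n) A \<in> X" for n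
    by (induction n) (use A L R in auto)
  then have KX: "K n \<in> X" for n by (simp add: K_def)
  have "\<exists>P k p \<epsilon>. P \<in> PP \<and> xtri (K (n + 1)) P (K n) k p \<epsilon>" for n
  proof (cases "0 \<le> n")
    case True
    then have "K (n + 1) = L (K n)" by (simp add: K_def nat_add_distrib)
    then show ?thesis using L[OF KX[of n]] by simp
  next
    case False
    define m where "m = nat (- (n + 1))"
    have n: "n = - int m - 1" using False by (simp add: m_def)
    have "K (n + 1) = (R ^^ m) A" by (cases "m = 0") (simp_all add: K_def n)
    moreover have "K n = (R ^^ Suc m) A"
      unfolding K_def n by (simp add: nat_add_distrib Suc_nat_eq_nat_zadd1)
    ultimately show ?thesis using R[OF KX[of "n + 1"]] by simp
  qed
  then obtain Y g f \<delta> where Y: "\<And>n. Y n \<in> PP \<and> xtri (K (n + 1)) (Y n) (K n) (g n) (f n) (\<delta> n)"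
    by metis
  have "complete_proj_resolution \<C> \<xi> Y (\<lambda>n. g (n - 1) \<cdot> f n) K g f \<delta>"
    unfolding complete_proj_resolution_def xi_exact_complex_def resolution_etri_def
    using Y contravariant_exactI[OF _ ac[OF KX]] by blast
  moreover have "A = K 0" by (simp add: K_def)
  ultimately show ?thesis unfolding GP_def by blast
qed

lemma GP_elim:
  assumes "A \<in> GP \<C> \<xi>"
  obtains K P k p \<epsilon> K' P' k' p' \<epsilon>'
  where "P \<in> PP" "xtri K P A k p \<epsilon>" "K \<in> GP \<C> \<xi>" "P' \<in> PP" "xtri A P' K' k' p' \<epsilon>'" "K' \<in> GP \<C> \<xi>"
    "left_acyclic A"
proof -
  obtain X d K g f \<delta> n where res: "complete_proj_resolution \<C> \<xi> X d K g f \<delta>" and A: "A = K n"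
    using assms unfolding GP_def by blast
  have K: "K m \<in> GP \<C> \<xi>" for m using res unfolding GP_def by blast
  have X: "X m \<in> PP" and T: "xtri (K (m + 1)) (X m) (K m) (g m) (f m) (\<delta> m)"
    and ex: "\<And>W. W \<in> PP \<Longrightarrow> contravariant_exact \<C> W (ETri (K (m + 1)) (X m) (K m) (g m) (f m) (\<delta> m))"
    for m
    using res unfolding complete_proj_resolution_def xi_exact_complex_def resolution_etri_def by auto
  have "left_acyclic A" unfolding A by (rule left_acyclicI[OF T X ex])
  then show ?thesis using that[OF X[of n] _ K[of "n + 1"] X[of "n - 1"] _ K[of "n - 1"]]
      T[of n] T[of "n - 1"] A by simp
qed

lemma GP_left_acyclic: "A \<in> GP \<C> \<xi> \<Longrightarrow> left_acyclic A"
  by (erule GP_elim)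

lemma GP_left:
  assumes "A \<in> GP \<C> \<xi>"
  obtains K P k p \<epsilon> where "P \<in> PP" "xtri K P A k p \<epsilon>" "K \<in> GP \<C> \<xi>"
  using assms by (rule GP_elim)

lemma GP_right:
  assumes "A \<in> GP \<C> \<xi>"
  obtains K P k p \<epsilon> where "P \<in> PP" "xtri A P K k p \<epsilon>" "K \<in> GP \<C> \<xi>"
  using assms by (rule GP_elim)

lemma GP_obj [simp]: "A \<in> GP \<C> \<xi> \<Longrightarrow> A \<in> Obj \<C>"
  using GP_left_acyclic left_acyclicD(1) by blast

text \<open>The inclusion \<open>K -> P\<close> factors through \<open>G\<close> with cokernels
  \<open>A\<close> and \<open>C\<close>, so an arrow out of \<open>K\<close> is extended in two
  stages. A phantom on \<open>B\<close> vanishes on \<open>A\<close> and hence descends to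
  \<open>C\<close>, where it is again a phantom because projectives lift along
  \<open>y\<close>.\<close>

lemma left_acyclic_extension:
  assumes T: "xtri A B C x y \<delta>" and A: "left_acyclic A" and C: "left_acyclic C"
  shows "left_acyclic B"
  unfolding left_acyclic_def
proof (intro conjI ballI allI impI)
  note t = xtriD[OF T]
  show B: "B \<in> Obj \<C>" by (rule t)
  fix W assume W: "W \<in> PP"
  obtain K P k p \<epsilon> where P: "P \<in> PP" "xtri K P B k p \<epsilon>" by (rule PP_cover[OF B])
  obtain G h' d e \<delta>'' \<eta> where G: "xtri G P C h' (y \<cdot> p) \<delta>''" "xtri K G A d e \<eta>" and k: "h' \<cdot> d = k"
    using ET4_op_xi[OF P(2) T] by metis
  show "ext_zero B W"
  proof (rule ext_zero_of_cover[OF P(2,1) PP_obj[OF W]])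
    fix h assume h: "\<guillemotleft>h : K \<rightarrow> W\<guillemotright>"
    obtain h1 where h1: "\<guillemotleft>h1 : G \<rightarrow> W\<guillemotright>" "h = h1 \<cdot> d"
      by (rule ext_zero_extend[OF G(2) left_acyclicD(2)[OF A W] h])
    obtain h2 where h2: "\<guillemotleft>h2 : P \<rightarrow> W\<guillemotright>" "h1 = h2 \<cdot> h'"
      by (rule ext_zero_extend[OF G(1) left_acyclicD(2)[OF C W] h1(1)])
    show "\<exists>s. \<guillemotleft>s : P \<rightarrow> W\<guillemotright> \<and> h = s \<cdot> k"
      unfolding h1(2) h2(2) k[symmetric]
      using h2(1) xtriD[OF G(1)] xtriD[OF G(2)] by (intro exI[of _ h2]) simp
  qed
  fix h assume h: "phantom B W h"
  note h' = phantom_typed[OF h]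
  have "phantom A W (h \<cdot> x)"
  proof (rule phantomI)
    show "\<guillemotleft>h \<cdot> x : A \<rightarrow> W\<guillemotright>" using h' t by simp
    fix P u assume P: "P \<in> PP" "\<guillemotleft>u : P \<rightarrow> A\<guillemotright>"
    have "h \<cdot> (x \<cdot> u) = zr P W" by (rule phantomD[OF h P(1)]) (use P t in simp)
    then show "(h \<cdot> x) \<cdot> u = zr P W" using h' P t by simp
  qed
  then have "h \<cdot> x = zr A W" by (rule left_acyclicD(3)[OF A W])
  then obtain s where s: "\<guillemotleft>s : C \<rightarrow> W\<guillemotright>" "h = s \<cdot> y"
    by (rule factor_through_deflation[OF xtri_tri[OF T] h'])
  have "phantom C W s"
  proof (rule phantomI[OF s(1)])
    fix P u assume P: "P \<in> PP" "\<guillemotleft>u : P \<rightarrow> C\<guillemotright>"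
    obtain v where v: "\<guillemotleft>v : P \<rightarrow> B\<guillemotright>" "u = y \<cdot> v" by (rule PP_lift[OF P(1) T P(2)])
    have "s \<cdot> u = h \<cdot> v" unfolding v(2) s(2) using v(1) s(1) t by simp
    then show "s \<cdot> u = zr P W" using phantomD[OF h P(1) v(1)] by simp
  qed
  then have "s = zr C W" by (rule left_acyclicD(3)[OF C W])
  then show "h = zr B W" unfolding s(2) using t W by simp
qed

lemma left_acyclic_retract:
  assumes G: "left_acyclic G" and i: "\<guillemotleft>i : M \<rightarrow> G\<guillemotright>" and r: "\<guillemotleft>r : G \<rightarrow> M\<guillemotright>" "r \<cdot> i = ide \<C> M"
  shows "left_acyclic M"
  unfolding left_acyclic_def
proof (intro conjI ballI allI impI)
  show "M \<in> Obj \<C>" using i by simp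
  fix W assume W: "W \<in> PP"
  show "ext_zero M W"
    unfolding ext_zero_def
  proof
    fix \<delta> assume d: "\<delta> \<in> xext M W"
    have "pull \<C> W r \<delta> \<in> xext G W" using xext_pull[OF d r(1)] W by simp
    then have 0: "pull \<C> W r \<delta> = ze G W" using left_acyclicD(2)[OF G W] unfolding ext_zero_def by blast
    have "\<delta> = pull \<C> W (r \<cdot> i) \<delta>" unfolding r(2) using emap_ide xext_in_E[OF d] i W by simp
    also have "\<dots> = pull \<C> W i (pull \<C> W r \<delta>)"
      by (rule pull_comp) (use r(1) i W xext_in_E[OF d] in simp_all)
    finally show "\<delta> = ze M W" unfolding 0 using i W by simp
  qed
  fix h assume h: "phantom M W h"
  note h' = phantom_typed[OF h]
  have "phantom G W (h \<cdot> r)"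
  proof (rule phantomI)
    show "\<guillemotleft>h \<cdot> r : G \<rightarrow> W\<guillemotright>" using h' r(1) by simp
    fix P u assume P: "P \<in> PP" "\<guillemotleft>u : P \<rightarrow> G\<guillemotright>"
    have "h \<cdot> (r \<cdot> u) = zr P W" by (rule phantomD[OF h P(1)]) (use P r(1) in simp)
    then show "(h \<cdot> r) \<cdot> u = zr P W" using h' P r(1) by simp
  qed
  then have hr: "h \<cdot> r = zr G W" by (rule left_acyclicD(3)[OF G W])
  have "h = (h \<cdot> r) \<cdot> i" using h' r i by simp
  then show "h = zr M W" unfolding hr using i W by simp
qed

section \<open>Closure properties of Gorenstein projectives\<close>

lemma split_reverse:
  assumes T: "tri D G C d e (ze C D)"
  obtains s r where "xtri C G D s r (ze D C)" "e \<cdot> s = ide \<C> C" "r \<cdot> d = ide \<C> D"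
proof -
  obtain s where s: "\<guillemotleft>s : C \<rightarrow> G\<guillemotright>" "e \<cdot> s = ide \<C> C" using tri_split[OF T] by blast
  obtain r where "tri C G D s r (ze D C)" "r \<cdot> d = ide \<C> D" by (rule split_by_section[OF T s])
  then show ?thesis using that s split_xtri by blast
qed

text \<open>Coinduction on the class of all middle terms. In place of a horseshoe diagram, each end
  of the triangle is replaced by a projective through one pullback or pushout; the composite step
  then has as its kernel or cokernel an extension of the two syzygies, again a member of the
  class.\<close>

lemma GP_extension:
  assumes "xtri A B C x y \<delta>" "A \<in> GP \<C> \<xi>" "C \<in> GP \<C> \<xi>"
  shows "B \<in> GP \<C> \<xi>"
proof -
  let ?X = "{B. \<exists>A C x y \<delta>. A \<in> GP \<C> \<xi> \<and> C \<in> GP \<C> \<xi> \<and> xtri A B C x y \<delta>}"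
  show ?thesis
  proof (rule GP_coinduct[of B ?X])
    show "B \<in> ?X" using assms by blast
  next
    fix B assume "B \<in> ?X"
    then show "left_acyclic B" using left_acyclic_extension GP_left_acyclic by blast
  next
    fix B assume "B \<in> ?X"
    then obtain A C x y \<delta> where A: "A \<in> GP \<C> \<xi>" and C: "C \<in> GP \<C> \<xi>" and T: "xtri A B C x y \<delta>" by blast
    obtain KA PA ka pa \<epsilon>a where LA: "PA \<in> PP" "xtri KA PA A ka pa \<epsilon>a" "KA \<in> GP \<C> \<xi>" by (rule GP_left[OF A])
    obtain KC PC kc pc \<epsilon>c where LC: "PC \<in> PP" "xtri KC PC C kc pc \<epsilon>c" "KC \<in> GP \<C> \<xi>" by (rule GP_left[OF C])
    obtain M m e k q \<eta> \<theta> where M: "xtri A M PC m e \<eta>" "xtri KC M B k q \<theta>" by (rule pullback_xi[OF T LC(2)])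
    \<comment> \<open>\<open>M\<close> is the direct sum of \<open>A\<close> and \<open>PC\<close>;
      exchanging the summands exposes \<open>A\<close> for the second pullback.\<close>
    have "\<eta> = ze PC A" by (rule PP_xext[OF LC(1)]) (use xtriD[OF M(1)] in simp_all)
    then obtain s r where S: "xtri PC M A s r (ze A PC)" using split_reverse xtri_tri M(1) by metis
    obtain N m' e' k' q' \<eta>' \<theta>' where N: "xtri PC N PA m' e' \<eta>'" "xtri KA N M k' q' \<theta>'"
      by (rule pullback_xi[OF S LA(2)])
    have "\<eta>' = ze PA PC" by (rule PP_xext[OF LA(1)]) (use xtriD[OF N(1)] in simp_all)
    then have "N \<in> PP" using PP_extension xtri_tri[OF N(1)] LC LA by metis
    moreover obtain G h' d e \<delta>'' \<eta>'' where "xtri G N B h' (q \<cdot> q') \<delta>''" "xtri KA G KC d e \<eta>''"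
      using ET4_op_xi[OF N(2) M(2)] by metis
    ultimately show "\<exists>K \<in> ?X. \<exists>P k p \<epsilon>. P \<in> PP \<and> xtri K P B k p \<epsilon>" using LA(3) LC(3) by blast
  next
    fix B assume "B \<in> ?X"
    then obtain A C x y \<delta> where A: "A \<in> GP \<C> \<xi>" and C: "C \<in> GP \<C> \<xi>" and T: "xtri A B C x y \<delta>" by blast
    obtain KA PA ka pa \<epsilon>a where RA: "PA \<in> PP" "xtri A PA KA ka pa \<epsilon>a" "KA \<in> GP \<C> \<xi>" by (rule GP_right[OF A])
    obtain KC PC kc pc \<epsilon>c where RC: "PC \<in> PP" "xtri C PC KC kc pc \<epsilon>c" "KC \<in> GP \<C> \<xi>" by (rule GP_right[OF C])
    obtain M m e k q \<eta> \<theta> where M: "xtri PA M C m e \<eta>" "xtri B M KA k q \<theta>" by (rule pushout_xi[OF T RA(2)])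
    \<comment> \<open>On this side the splitting is not due to a projective end term: it uses that
      \<open>C\<close>, being left acyclic, has no relative extensions by projectives.\<close>
    have "\<eta> = ze C PA"
      using left_acyclicD(2)[OF GP_left_acyclic[OF C] RA(1)] xtriD[OF M(1)] unfolding ext_zero_def by blast
    then obtain s r where S: "xtri C M PA s r (ze PA C)" using split_reverse xtri_tri M(1) by metis
    obtain N m' e' k' q' \<eta>' \<theta>' where N: "xtri PC N PA m' e' \<eta>'" "xtri M N KC k' q' \<theta>'"
      by (rule pushout_xi[OF S RC(2)])
    have "\<eta>' = ze PA PC" by (rule PP_xext[OF RA(1)]) (use xtriD[OF N(1)] in simp_all)
    then have "N \<in> PP" using PP_extension xtri_tri[OF N(1)] RC RA by metis
    moreover obtain G h' d e \<delta>'' \<eta>'' where "xtri B N G (k' \<cdot> k) h' \<delta>''" "xtri KA G KC d e \<eta>''"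
      using ET4_xi[OF M(2) N(2)] by metis
    ultimately show "\<exists>K \<in> ?X. \<exists>P k p \<epsilon>. P \<in> PP \<and> xtri B P K k p \<epsilon>" using RA(3) RC(3) by blast
  qed
qed

lemma zero_tris:
  assumes "A \<in> Obj \<C>"
  obtains Z where "Z \<in> PP" "xtri Z A A (zr Z A) (ide \<C> A) (ze A Z)" "xtri A A Z (ide \<C> A) (zr A Z) (ze Z A)"
proof -
  obtain Z where Z: "is_zero_obj \<C> Z" using zero_exists by blast
  show ?thesis using that[of Z] zero_PP[OF Z] ide_tri[OF assms Z] split_xtri by blast
qed

lemma PP_GP:
  assumes "P \<in> PP"
  shows "P \<in> GP \<C> \<xi>"
proof (rule GP_coinduct[OF assms])
  fix B assume B: "B \<in> PP"
  have h: "h = zr B W" if "phantom B W h" for W h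
    using phantomD[OF that B, of "ide \<C> B"] phantom_typed[OF that] B by simp
  show "left_acyclic B"
    unfolding left_acyclic_def ext_zero_def using B PP_xext h by (simp add: Ball_def)
  show "\<exists>K \<in> PP. \<exists>P k p \<epsilon>. P \<in> PP \<and> xtri K P B k p \<epsilon>"
    by (rule zero_tris[OF PP_obj[OF B]]) (use B in blast)
  show "\<exists>K \<in> PP. \<exists>P k p \<epsilon>. P \<in> PP \<and> xtri B P K k p \<epsilon>"
    by (rule zero_tris[OF PP_obj[OF B]]) (use B in blast)
qed

text \<open>The complement \<open>P\<close> of \<open>M\<close> in \<open>G\<close> is itself
  Gorenstein projective. Hence the kernel of \<open>Q -> G -> M\<close> is an extension of
  \<open>P\<close> by \<open>K\<close>, and the cokernel of \<open>M -> G -> Q'\<close> one of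
  \<open>K'\<close> by \<open>P\<close>: one step on either side lands in \<open>GP\<close>, and
  only \<open>M\<close> has to be adjoined for the coinduction.\<close>

lemma GP_cokernel:
  assumes T: "tri P G M x y (ze M P)" and P: "P \<in> PP" and G: "G \<in> GP \<C> \<xi>"
  shows "M \<in> GP \<C> \<xi>"
proof -
  obtain s r where S: "xtri M G P s r (ze P M)" "y \<cdot> s = ide \<C> M" by (rule split_reverse[OF T])
  have T': "xtri P G M x y (ze M P)" by (rule split_xtri[OF T])
  have ac: "left_acyclic M"
    by (rule left_acyclic_retract[OF GP_left_acyclic[OF G] xtriD(4)[OF S(1)] xtriD(5)[OF T'] S(2)])
  obtain K Q k p \<epsilon> where L: "Q \<in> PP" "xtri K Q G k p \<epsilon>" "K \<in> GP \<C> \<xi>" by (rule GP_left[OF G])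
  obtain E1 h1 d1 e1 \<delta>1 \<eta>1 where L1: "xtri E1 Q M h1 (y \<cdot> p) \<delta>1" "xtri K E1 P d1 e1 \<eta>1"
    using ET4_op_xi[OF L(2) T'] by metis
  have L2: "E1 \<in> GP \<C> \<xi>" by (rule GP_extension[OF L1(2) L(3) PP_GP[OF P]])
  obtain K' Q' k' p' \<epsilon>' where R: "Q' \<in> PP" "xtri G Q' K' k' p' \<epsilon>'" "K' \<in> GP \<C> \<xi>" by (rule GP_right[OF G])
  obtain E2 h2 d2 e2 \<delta>2 \<eta>2 where R1: "xtri M Q' E2 (k' \<cdot> s) h2 \<delta>2" "xtri P E2 K' d2 e2 \<eta>2"
    using ET4_xi[OF S(1) R(2)] by metis
  have R2: "E2 \<in> GP \<C> \<xi>" by (rule GP_extension[OF R1(2) PP_GP[OF P] R(3)])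
  show ?thesis
  proof (rule GP_coinduct[of M "insert M (GP \<C> \<xi>)"])
    fix B assume "B \<in> insert M (GP \<C> \<xi>)"
    then consider "B = M" | "B \<in> GP \<C> \<xi>" by blast
    note cs = this
    show "left_acyclic B" using cs ac GP_left_acyclic by cases auto
    show "\<exists>K \<in> insert M (GP \<C> \<xi>). \<exists>P k p \<epsilon>. P \<in> PP \<and> xtri K P B k p \<epsilon>"
      using cs
    proof cases
      case 1 then show ?thesis using L(1) L1(1) L2 by blast
    next
      case 2 then show ?thesis by (rule GP_left) blast
    qed
    show "\<exists>K \<in> insert M (GP \<C> \<xi>). \<exists>P k p \<epsilon>. P \<in> PP \<and> xtri B P K k p \<epsilon>"
      using cs
    proof cases
      case 1 then show ?thesis using R(1) R1(1) R2 by blast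
    next
      case 2 then show ?thesis by (rule GP_right) blast
    qed
  qed simp
qed

subsection \<open>Auslander--Buchweitz approximations\<close>

primrec pd_le :: "nat \<Rightarrow> 'o \<Rightarrow> bool" where
  "pd_le 0 K \<longleftrightarrow> K \<in> PP"
| "pd_le (Suc n) K \<longleftrightarrow> (\<exists>L P x y \<delta>. P \<in> PP \<and> pd_le n L \<and> xtri L P K x y \<delta>)"

lemma pd_le_obj: "pd_le n K \<Longrightarrow> K \<in> Obj \<C>"
  by (cases n) (auto dest: xtriD(3))

lemma PP_pd_le: "K \<in> PP \<Longrightarrow> pd_le n K"
proof (induction n arbitrary: K)
  case (Suc n)
  obtain Z where "Z \<in> PP" "xtri Z K K (zr Z K) (ide \<C> K) (ze K Z)" by (rule zero_tris[OF PP_obj[OF Suc.prems]])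
  then show ?case using Suc unfolding pd_le.simps by blast
qed simp

text \<open>The Auslander--Buchweitz form of \<open>\<xi>-\<G>pd M \<le> n\<close>.\<close>

fun gpd_approx :: "nat \<Rightarrow> 'o \<Rightarrow> bool" where
  "gpd_approx 0 M \<longleftrightarrow> M \<in> GP \<C> \<xi>"
| "gpd_approx (Suc n) M \<longleftrightarrow> (\<exists>K G x y \<delta>. G \<in> GP \<C> \<xi> \<and> pd_le n K \<and> xtri K G M x y \<delta>)"

lemma GP_gpd_approx:
  assumes "M \<in> GP \<C> \<xi>"
  shows "gpd_approx n M"
proof (cases n)
  case (Suc k)
  obtain Z where "Z \<in> PP" "xtri Z M M (zr Z M) (ide \<C> M) (ze M Z)" by (rule zero_tris[OF GP_obj[OF assms]])
  then show ?thesis using assms PP_pd_le unfolding Suc gpd_approx.simps by blast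
qed (use assms in simp)

text \<open>The second Auslander--Buchweitz approximation: embed \<open>G'\<close> into a projective
  \<open>P\<close> with Gorenstein projective cokernel; the cokernel of \<open>K' -> P\<close> is
  the required \<open>L\<close>.\<close>

lemma gpd_approx_embed:
  assumes "gpd_approx n K"
  obtains L G x y \<delta> where "pd_le n L" "G \<in> GP \<C> \<xi>" "xtri K L G x y \<delta>"
proof (cases n)
  case 0
  then have "K \<in> GP \<C> \<xi>" using assms by simp
  then obtain G P k p \<epsilon> where "P \<in> PP" "xtri K P G k p \<epsilon>" "G \<in> GP \<C> \<xi>" by (rule GP_right)
  then show ?thesis using that 0 by simp
next
  case (Suc m)
  then obtain K' G' x y \<delta> where K': "G' \<in> GP \<C> \<xi>" "pd_le m K'" "xtri K' G' K x y \<delta>" using assms by auto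
  obtain G P k p \<epsilon> where G: "P \<in> PP" "xtri G' P G k p \<epsilon>" "G \<in> GP \<C> \<xi>" by (rule GP_right[OF K'(1)])
  obtain L h' d e \<delta>'' \<eta> where L: "xtri K' P L (k \<cdot> x) h' \<delta>''" "xtri K L G d e \<eta>"
    using ET4_xi[OF K'(3) G(2)] by metis
  have "pd_le n L" using L(1) G(1) K'(2) unfolding Suc pd_le.simps by blast
  then show ?thesis using that G(3) L(2) by blast
qed

text \<open>Pushing out along \<open>K -> L\<close> trades the kernel for one of finite projective
  dimension; the new middle term is an extension of \<open>G'\<close> by \<open>G\<close>.\<close>

lemma gpd_approx_step:
  assumes T: "xtri K G M x y \<delta>" and G: "G \<in> GP \<C> \<xi>" and "gpd_approx n K"
  shows "gpd_approx (Suc n) M"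
proof -
  obtain L G' x' y' \<epsilon> where L: "pd_le n L" "G' \<in> GP \<C> \<xi>" "xtri K L G' x' y' \<epsilon>"
    by (rule gpd_approx_embed[OF assms(3)])
  obtain X u v b q \<eta> \<theta> where X: "xtri L X M u v \<eta>" "xtri G X G' b q \<theta>" by (rule pushout_xi[OF T L(3)])
  have "X \<in> GP \<C> \<xi>" by (rule GP_extension[OF X(2) G L(2)])
  then show ?thesis using X(1) L(1) unfolding gpd_approx.simps by blast
qed

text \<open>The first two conjuncts carry the convention for -1 through the induction: in rule
  \<open>step\<close> with bound 0 the kernel has bound -1, where \<open>gpd_approx\<close> has no
  index, and must be known to be a zero object.\<close>

lemma Gpd_le_imp_gpd_approx:
  assumes "Gpd_le \<C> \<xi> M n"
  shows "- 1 \<le> n \<and> (n = - 1 \<longrightarrow> is_zero_obj \<C> M) \<and> (\<forall>k. n \<le> int k \<longrightarrow> gpd_approx k M)"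
  using assms
proof (induction rule: Gpd_le.induct)
  case (zero A n)
  then show ?case using GP_gpd_approx[OF PP_GP[OF zero_PP]] by (cases "n = - 1") auto
next
  case (GP A n)
  then show ?case using GP_gpd_approx by auto
next
  case (step K G A x y \<delta> n)
  have "gpd_approx k A" if k: "n \<le> int k" for k
  proof (cases "n = 0")
    case True
    then have Z: "is_zero_obj \<C> K" using step by simp
    note z = zero_obj_typed[OF Z] and t = xtriD[OF step.hyps(1)]
    \<comment> \<open>The identity of a zero object is the zero arrow, so \<open>\<delta>\<close>
      vanishes and \<open>GP_cokernel\<close> applies with the projective \<open>K\<close>.\<close>
    have "\<delta> = push \<C> A (zr K K) \<delta>" unfolding z(4) using emap_ide t by simp
    also have "\<dots> = ze A K" by (rule push_zr) (use t in simp_all)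
    finally have "tri K G A x y (ze A K)" using xtri_tri[OF step.hyps(1)] by simp
    then show ?thesis using GP_gpd_approx[OF GP_cokernel] zero_PP[OF Z] step.hyps(2) by blast
  next
    case False
    then obtain j where j: "k = Suc j" using k step by (cases k) auto
    have "n - 1 \<le> int j" using k j by simp
    then have "gpd_approx j K" using step by blast
    then show ?thesis unfolding j by (rule gpd_approx_step[OF step.hyps(1,2)])
  qed
  then show ?case using step by auto
qed

lemma pd_le_imp_Gpd_le: "pd_le n K \<Longrightarrow> Gpd_le \<C> \<xi> K (int n)"
proof (induction n arbitrary: K)
  case 0
  then show ?case by (auto intro: Gpd_le.GP PP_GP)
next
  case (Suc n)
  then obtain L P x y \<delta> where "P \<in> PP" "pd_le n L" "xtri L P K x y \<delta>" by auto
  then show ?case using Suc.IH[of L] by (intro Gpd_le.step[of L P K x y \<delta>]) (auto intro: PP_GP)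
qed

lemma gpd_approx_imp_Gpd_le:
  assumes "gpd_approx n M"
  shows "Gpd_le \<C> \<xi> M (int n)"
proof (cases n)
  case 0
  then show ?thesis using assms by (auto intro: Gpd_le.GP)
next
  case (Suc k)
  then obtain K G x y \<delta> where K: "G \<in> GP \<C> \<xi>" "pd_le k K" "xtri K G M x y \<delta>" using assms by auto
  show ?thesis unfolding Suc
    by (rule Gpd_le.step[OF K(3,1)]) (use pd_le_imp_Gpd_le[OF K(2)] in simp)
qed

text \<open>Dimension shifting without higher extension groups: an arrow from the syzygy
  \<open>V\<close> of \<open>W\<close> to \<open>K\<close> lifts to \<open>P\<close> by the
  induction hypothesis for \<open>V\<close> and \<open>L\<close>, and the lift extends to
  \<open>Q\<close> because \<open>W\<close> is left acyclic.\<close>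

lemma GP_ext_zero_pd_le: "pd_le n K \<Longrightarrow> W \<in> GP \<C> \<xi> \<Longrightarrow> ext_zero W K"
proof (induction n arbitrary: K W)
  case 0
  then show ?case using left_acyclicD(2)[OF GP_left_acyclic[OF 0(2)]] by simp
next
  case (Suc n)
  then obtain L P x y \<delta> where L: "P \<in> PP" "pd_le n L" "xtri L P K x y \<delta>" by auto
  note l = xtriD[OF L(3)]
  obtain V Q k p \<epsilon> where V: "Q \<in> PP" "xtri V Q W k p \<epsilon>" "V \<in> GP \<C> \<xi>" by (rule GP_left[OF Suc.prems(2)])
  note v = xtriD[OF V(2)]
  show ?case
  proof (rule ext_zero_of_cover[OF V(2,1) pd_le_obj[OF Suc.prems(1)]])
    fix h assume h: "\<guillemotleft>h : V \<rightarrow> K\<guillemotright>"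
    have "pull \<C> L h \<delta> \<in> xext V L" by (rule xext_pull[OF l(7) h l(1)])
    then have "pull \<C> L h \<delta> = ze V L" using Suc.IH[OF L(2) V(3)] unfolding ext_zero_def by blast
    then obtain h1 where h1: "\<guillemotleft>h1 : V \<rightarrow> P\<guillemotright>" "h = y \<cdot> h1" using lift_iff[OF xtri_tri[OF L(3)] h] by blast
    obtain h2 where h2: "\<guillemotleft>h2 : Q \<rightarrow> P\<guillemotright>" "h1 = h2 \<cdot> k"
      by (rule ext_zero_extend[OF V(2) left_acyclicD(2)[OF GP_left_acyclic[OF Suc.prems(2)] L(1)] h1(1)])
    show "\<exists>s. \<guillemotleft>s : Q \<rightarrow> K\<guillemotright> \<and> h = s \<cdot> k"
      unfolding h1(2) h2(2) using h2(1) l v by (intro exI[of _ "y \<cdot> h2"]) simp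
  qed
qed

end

section \<open>Comparison of resolutions\<close>

lemma (in normal) trivial_Mod_iff: "trivial_group (G Mod H) \<longleftrightarrow> carrier G \<subseteq> H"
proof -
  have "trivial_group (G Mod H) \<longleftrightarrow> rcosets H = {H}"
    using factorgroup_is_group by (simp add: trivial_group_def FactGroup_def)
  also have "\<dots> \<longleftrightarrow> carrier G \<subseteq> H"
  proof
    assume H: "rcosets H = {H}"
    show "carrier G \<subseteq> H"
    proof
      fix x assume x: "x \<in> carrier G"
      then have "H #> x \<in> rcosets H" using rcosetsI subset by blast
      then show "x \<in> H" using coset_join1 x H subgroup_axioms by blast
    qed
  next
    assume "carrier G \<subseteq> H"
    then have "H #> x = H" if "x \<in> carrier G" for x
      using coset_join2[OF that subgroup_axioms] that by blast
    then show "rcosets H = {H}" unfolding RCOSETS_def using one_closed by blast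
  qed
  finally show ?thesis .
qed

lemma (in comm_group) trivial_subquotient_iff:
  assumes "subgroup Z G" "subgroup B G" "B \<subseteq> Z"
  shows "trivial_group (G\<lparr>carrier := Z\<rparr> Mod B) \<longleftrightarrow> Z \<subseteq> B"
proof -
  interpret Z0: group "G\<lparr>carrier := Z\<rparr>"
    by (rule subgroup.subgroup_is_group[OF assms(1) is_group])
  interpret Z: comm_group "G\<lparr>carrier := Z\<rparr>"
    by (rule Z0.group_comm_groupI) (use subgroup.subset[OF assms(1)] m_comm in auto)
  interpret normal B "G\<lparr>carrier := Z\<rparr>"
    by (rule Z.subgroup_imp_normal) (rule subgroup_incl[OF assms(2,1,3)])
  show ?thesis using trivial_Mod_iff by simp
qed

context relative_projectives
begin

text \<open>Index \<open>m\<close> refers to cohomology in degree \<open>m + 1\<close>: the theorem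
  concerns positive degrees, where coboundaries are given by a differential.\<close>

definition acyclic_at :: "(nat \<Rightarrow> 'o) \<Rightarrow> (nat \<Rightarrow> 'm) \<Rightarrow> 'o \<Rightarrow> nat \<Rightarrow> bool" where
  "acyclic_at G d N m \<longleftrightarrow>
     (\<forall>h. \<guillemotleft>h : G (Suc m) \<rightarrow> N\<guillemotright> \<longrightarrow> h \<cdot> d (Suc (Suc m)) = zr (G (Suc (Suc m))) N \<longrightarrow>
        (\<exists>h'. \<guillemotleft>h' : G m \<rightarrow> N\<guillemotright> \<and> h = h' \<cdot> d (Suc m)))"

lemma trivial_cohomology_iff:
  assumes d: "\<And>n. \<guillemotleft>d (Suc n) : G (Suc n) \<rightarrow> G n\<guillemotright>" "\<And>n. d (Suc n) \<cdot> d (Suc (Suc n)) = zr (G (Suc (Suc n))) (G n)"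
    and N: "N \<in> Obj \<C>"
  shows "trivial_group (hom_cohomology \<C> G d N (Suc m)) \<longleftrightarrow> acyclic_at G d N m"
proof -
  have G: "G n \<in> Obj \<C>" for n using d(1)[of n] by simp
  interpret H: comm_group "Hom \<C> (G (Suc m)) N" by (rule hom_comm_group[OF G N])
  interpret d1: group_hom "Hom \<C> (G m) N" "Hom \<C> (G (Suc m)) N" "\<lambda>h. h \<cdot> d (Suc m)"
    by (rule comp_right_hom[OF d(1) N])
  interpret d2: group_hom "Hom \<C> (G (Suc m)) N" "Hom \<C> (G (Suc (Suc m))) N" "\<lambda>h. h \<cdot> d (Suc (Suc m))"
    by (rule comp_right_hom[OF d(1) N])
  let ?Z = "hom_cocycles \<C> G d N (Suc m)" and ?B = "hom_coboundaries \<C> G d N (Suc m)"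
  have "subgroup ?Z (Hom \<C> (G (Suc m)) N)" unfolding hom_cocycles_def by (rule d2.subgroup_kernel)
  moreover have "subgroup ?B (Hom \<C> (G (Suc m)) N)" using d1.img_is_subgroup by simp
  moreover have "?B \<subseteq> ?Z"
  proof
    fix h assume "h \<in> ?B"
    then obtain s where s: "\<guillemotleft>s : G m \<rightarrow> N\<guillemotright>" "h = s \<cdot> d (Suc m)" using arr_iff[OF G N] by auto
    have "h \<cdot> d (Suc (Suc m)) = zr (G (Suc (Suc m))) N" "\<guillemotleft>h : G (Suc m) \<rightarrow> N\<guillemotright>"
      unfolding s(2) using s(1) d(1)[of m] d(1)[of "Suc m"] d(2)[of m] by simp_all
    then show "h \<in> ?Z" unfolding hom_cocycles_def kernel_def using arr_iff[OF G N] by (simp add: zr_def)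
  qed
  ultimately have "trivial_group (hom_cohomology \<C> G d N (Suc m)) \<longleftrightarrow> ?Z \<subseteq> ?B"
    unfolding hom_cohomology_def by (rule H.trivial_subquotient_iff)
  also have "\<dots> \<longleftrightarrow> acyclic_at G d N m"
    unfolding hom_cocycles_def kernel_def hom_coboundaries.simps acyclic_at_def subset_iff image_iff
      Bex_def mem_Collect_eq arr_iff[OF G N] zr_def by blast
  finally show ?thesis .
qed

text \<open>Here \<open>y\<close> is a precover of \<open>M\<close> by Gorenstein projectives. The
  proper resolution consists of such triangles, and so do the Auslander--Buchweitz approximations;
  the comparison treats both alike.\<close>

definition gp_tri :: "'o \<Rightarrow> 'o \<Rightarrow> 'o \<Rightarrow> 'm \<Rightarrow> 'm \<Rightarrow> 'e \<Rightarrow> bool" where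
  "gp_tri K G M x y \<delta> \<longleftrightarrow> xtri K G M x y \<delta> \<and> G \<in> GP \<C> \<xi> \<and>
     (\<forall>W \<in> GP \<C> \<xi>. \<forall>t. \<guillemotleft>t : W \<rightarrow> M\<guillemotright> \<longrightarrow> (\<exists>s. \<guillemotleft>s : W \<rightarrow> G\<guillemotright> \<and> t = y \<cdot> s))"

lemma gp_triD:
  assumes "gp_tri K G M x y \<delta>"
  shows "xtri K G M x y \<delta>" "G \<in> GP \<C> \<xi>"
  using assms by (auto simp: gp_tri_def)

lemma gp_tri_lift:
  assumes "gp_tri K G M x y \<delta>" "W \<in> GP \<C> \<xi>" "\<guillemotleft>t : W \<rightarrow> M\<guillemotright>"
  obtains s where "\<guillemotleft>s : W \<rightarrow> G\<guillemotright>" "t = y \<cdot> s"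
  using assms unfolding gp_tri_def by blast

lemma gp_triI:
  assumes T: "xtri K G M x y \<delta>" and G: "G \<in> GP \<C> \<xi>" and K: "pd_le n K"
  shows "gp_tri K G M x y \<delta>"
  unfolding gp_tri_def
proof (intro conjI ballI allI impI)
  note t = xtriD[OF T]
  fix W u assume W: "W \<in> GP \<C> \<xi>" and u: "\<guillemotleft>u : W \<rightarrow> M\<guillemotright>"
  have "pull \<C> K u \<delta> \<in> xext W K" by (rule xext_pull[OF t(7) u t(1)])
  then have "pull \<C> K u \<delta> = ze W K" using GP_ext_zero_pd_le[OF K W] unfolding ext_zero_def by blast
  then show "\<exists>s. \<guillemotleft>s : W \<rightarrow> G\<guillemotright> \<and> u = y \<cdot> s" using lift_iff[OF xtri_tri[OF T] u] by blast
qed (use T G in simp_all)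

text \<open>The equation between extensions is recorded together with the square, since it controls
  the composite of two comparisons.\<close>

lemma gp_tri_compare:
  assumes T: "gp_tri K1 G K0 g f \<delta>" and S: "gp_tri L1 H L0 g' f' \<delta>'" and a: "\<guillemotleft>a : K0 \<rightarrow> L0\<guillemotright>"
  obtains \<alpha> a1 where "\<guillemotleft>\<alpha> : G \<rightarrow> H\<guillemotright>" "\<guillemotleft>a1 : K1 \<rightarrow> L1\<guillemotright>" "\<alpha> \<cdot> g = g' \<cdot> a1"
    "push \<C> K0 a1 \<delta> = pull \<C> L1 a \<delta>'"
proof -
  note t = xtriD[OF gp_triD(1)[OF T]] and s = xtriD[OF gp_triD(1)[OF S]]
  have af: "\<guillemotleft>a \<cdot> f : G \<rightarrow> L0\<guillemotright>" using a t by simp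
  obtain \<alpha> where al: "\<guillemotleft>\<alpha> : G \<rightarrow> H\<guillemotright>" "a \<cdot> f = f' \<cdot> \<alpha>"
    by (rule gp_tri_lift[OF S gp_triD(2)[OF T] af])
  obtain a1 where "\<guillemotleft>a1 : K1 \<rightarrow> L1\<guillemotright>" "\<alpha> \<cdot> g = g' \<cdot> a1" "push \<C> K0 a1 \<delta> = pull \<C> L1 a \<delta>'"
    by (rule tri_morphism_left[OF xtri_tri[OF gp_triD(1)[OF T]] xtri_tri[OF gp_triD(1)[OF S]] al(1) a al(2)])
  then show ?thesis using that al(1) by blast
qed

text \<open>Pushing \<open>\<delta>\<close> along \<open>b1 \<cdot> a1\<close> equals pulling it
  back along \<open>b \<cdot> a\<close>; the summand \<open>f \<cdot> w\<close> contributes zero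
  because \<open>f\<close> kills \<open>\<delta>\<close>. So \<open>b1 \<cdot> a1\<close> and the
  identity push \<open>\<delta>\<close> to the same extension and differ by an arrow that extends
  over \<open>G\<close>.\<close>

lemma gp_tri_homotopy:
  assumes T: "gp_tri K1 G K0 g f \<delta>" and S: "gp_tri L1 H L0 g' f' \<delta>'"
    and a: "\<guillemotleft>a : K0 \<rightarrow> L0\<guillemotright>" "\<guillemotleft>a1 : K1 \<rightarrow> L1\<guillemotright>" "push \<C> K0 a1 \<delta> = pull \<C> L1 a \<delta>'"
    and b: "\<guillemotleft>b : L0 \<rightarrow> K0\<guillemotright>" "\<guillemotleft>b1 : L1 \<rightarrow> K1\<guillemotright>" "push \<C> L0 b1 \<delta>' = pull \<C> K1 b \<delta>"
    and w: "\<guillemotleft>w : K0 \<rightarrow> G\<guillemotright>" "b \<cdot> a = ide \<C> K0 \<boxplus> f \<cdot> w"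
  obtains u where "\<guillemotleft>u : G \<rightarrow> K1\<guillemotright>" "b1 \<cdot> a1 = ide \<C> K1 \<boxplus> u \<cdot> g"
proof -
  note T' = gp_triD(1)[OF T]
  note t = xtriD[OF T'] and s = xtriD[OF gp_triD(1)[OF S]]
  have "push \<C> K0 (b1 \<cdot> a1) \<delta> = push \<C> K0 b1 (push \<C> K0 a1 \<delta>)"
    by (rule push_comp) (use a(1,2) b(1,2) t in simp_all)
  also have "\<dots> = pull \<C> K1 a (push \<C> L0 b1 \<delta>')"
    unfolding a(3) by (rule push_pull) (use a(1) b(2) s(6) in simp_all)
  also have "\<dots> = pull \<C> K1 (b \<cdot> a) \<delta>"
    unfolding b(3) by (rule pull_comp[symmetric]) (use a(1) b(1) t in simp_all)
  also have "\<dots> = pull \<C> K1 (ide \<C> K0) \<delta> \<otimes>\<^bsub>Ext \<C> K0 K1\<^esub> pull \<C> K1 (f \<cdot> w) \<delta>"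
    unfolding w(2) by (rule pull_add) (use w(1) t in simp_all)
  also have "pull \<C> K1 (f \<cdot> w) \<delta> = pull \<C> K1 w (pull \<C> K1 f \<delta>)"
    by (rule pull_comp) (use w(1) t in simp_all)
  also have "\<dots> = ze K0 K1" using pull_deflation[OF xtri_tri[OF T']] w(1) t by simp
  also have "pull \<C> K1 (ide \<C> K0) \<delta> = \<delta>" using emap_ide t by simp
  also have "\<delta> \<otimes>\<^bsub>Ext \<C> K0 K1\<^esub> ze K0 K1 = \<delta>"
    using ext_comm_group[OF t(3,1)] t(6) by (simp add: ze_def comm_group_def comm_monoid_def monoid.r_one)
  also have "\<delta> = push \<C> K0 (ide \<C> K1) \<delta>" using emap_ide t by simp
  finally have eq: "push \<C> K0 (b1 \<cdot> a1) \<delta> = push \<C> K0 (ide \<C> K1) \<delta>" .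
  have "\<guillemotleft>b1 \<cdot> a1 : K1 \<rightarrow> K1\<guillemotright>" "\<guillemotleft>ide \<C> K1 : K1 \<rightarrow> K1\<guillemotright>" using a(2) b(2) t by simp_all
  then show ?thesis by (rule diff_of_push_eq[OF xtri_tri[OF T'] _ _ eq that])
qed

section \<open>Resolutions by precovers, and the effect of finite length\<close>

definition gp_resolution ::
  "(nat \<Rightarrow> 'm) \<Rightarrow> (nat \<Rightarrow> 'o) \<Rightarrow> (nat \<Rightarrow> 'o) \<Rightarrow> (nat \<Rightarrow> 'm) \<Rightarrow> (nat \<Rightarrow> 'm) \<Rightarrow> (nat \<Rightarrow> 'e) \<Rightarrow> bool" where
  "gp_resolution d K G g f \<delta> \<longleftrightarrow>
     (\<forall>n. gp_tri (K (Suc n)) (G n) (K n) (g n) (f n) (\<delta> n) \<and> d (Suc n) = g n \<cdot> f (Suc n))"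

lemma gp_resolutionD:
  assumes "gp_resolution d K G g f \<delta>"
  shows "gp_tri (K (Suc n)) (G n) (K n) (g n) (f n) (\<delta> n)" "d (Suc n) = g n \<cdot> f (Suc n)"
  using assms by (auto simp: gp_resolution_def)

text \<open>For the vanishing direction an approximation is remembered only through its liftings and
  the Gorenstein projective at its end.\<close>

primrec gp_length_le :: "nat \<Rightarrow> 'o \<Rightarrow> bool" where
  "gp_length_le 0 M \<longleftrightarrow> M \<in> GP \<C> \<xi>"
| "gp_length_le (Suc n) M \<longleftrightarrow> (\<exists>K G x y \<delta>. gp_tri K G M x y \<delta> \<and> gp_length_le n K)"

lemma pd_le_gp_length_le: "pd_le n K \<Longrightarrow> gp_length_le n K"
proof (induction n arbitrary: K)
  case (Suc n)
  then obtain L P x y \<delta> where "P \<in> PP" "pd_le n L" "xtri L P K x y \<delta>" by auto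
  then show ?case using gp_triI PP_GP Suc.IH unfolding gp_length_le.simps by blast
qed (simp add: PP_GP)

lemma gpd_approx_gp_length_le: "gpd_approx n M \<Longrightarrow> gp_length_le n M"
  using gp_triI pd_le_gp_length_le by (cases n) (simp, fastforce)

text \<open>Both complexes are descended in parallel. Once the end \<open>K'\<close> is Gorenstein
  projective, \<open>b\<close> lifts along \<open>f j\<close> to some \<open>\<beta>\<close>, and
  \<open>b a = 1 + f w\<close> becomes \<open>f (\<beta> a - w) = 1\<close>.\<close>

lemma comparison_split:
  assumes res: "gp_resolution d K G g f \<delta>"
  shows "\<lbrakk>gp_length_le n K'; \<guillemotleft>a : K j \<rightarrow> K'\<guillemotright>; \<guillemotleft>b : K' \<rightarrow> K j\<guillemotright>; \<guillemotleft>w : K j \<rightarrow> G j\<guillemotright>;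
      b \<cdot> a = ide \<C> (K j) \<boxplus> f j \<cdot> w\<rbrakk>
    \<Longrightarrow> \<exists>s. \<guillemotleft>s : K (j + n) \<rightarrow> G (j + n)\<guillemotright> \<and> f (j + n) \<cdot> s = ide \<C> (K (j + n))"
proof (induction n arbitrary: j K' a b w)
  case 0
  note R = gp_resolutionD(1)[OF res]
  note t = xtriD[OF gp_triD(1)[OF R[of j]]]
  obtain \<beta> where be: "\<guillemotleft>\<beta> : K' \<rightarrow> G j\<guillemotright>" "b = f j \<cdot> \<beta>"
    by (rule gp_tri_lift[OF R[of j] 0(1)[unfolded gp_length_le.simps] 0(3)])
  have "f j \<cdot> (\<beta> \<cdot> a) = ide \<C> (K j) \<boxplus> f j \<cdot> w"
    using 0(5) unfolding be(2) using be(1) 0(2) t by simp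
  then have "f j \<cdot> (\<beta> \<cdot> a) \<boxplus> neg (f j \<cdot> w) = ide \<C> (K j)"
    by (subst (asm) add_solve) (use be(1) 0(2,4) t in simp_all)
  then have "f j \<cdot> (\<beta> \<cdot> a \<boxplus> neg w) = ide \<C> (K j)" using be(1) 0(2,4) t by simp
  then show ?case using be(1) 0(2,4) by (intro exI[of _ "\<beta> \<cdot> a \<boxplus> neg w"]) simp
next
  case (Suc n)
  note R = gp_resolutionD(1)[OF res]
  obtain L H x y \<epsilon> where S: "gp_tri L H K' x y \<epsilon>" and L: "gp_length_le n L" using Suc.prems(1) by auto
  obtain \<alpha> a1 where a: "\<guillemotleft>a1 : K (Suc j) \<rightarrow> L\<guillemotright>" "push \<C> (K j) a1 (\<delta> j) = pull \<C> L a \<epsilon>"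
    using gp_tri_compare[OF R[of j] S Suc.prems(2)] by metis
  obtain \<beta> b1 where b: "\<guillemotleft>b1 : L \<rightarrow> K (Suc j)\<guillemotright>" "push \<C> K' b1 \<epsilon> = pull \<C> (K (Suc j)) b (\<delta> j)"
    using gp_tri_compare[OF S R[of j] Suc.prems(3)] by metis
  obtain u where u: "\<guillemotleft>u : G j \<rightarrow> K (Suc j)\<guillemotright>" "b1 \<cdot> a1 = ide \<C> (K (Suc j)) \<boxplus> u \<cdot> g j"
    by (rule gp_tri_homotopy[OF R[of j] S Suc.prems(2) a Suc.prems(3) b Suc.prems(4,5)])
  \<comment> \<open>The source of \<open>u\<close> is Gorenstein projective, so \<open>u\<close>
    factors through the next deflation and the hypothesis on \<open>b \<cdot> a\<close> is restored
    one degree further.\<close>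
  obtain v where v: "\<guillemotleft>v : G j \<rightarrow> G (Suc j)\<guillemotright>" "u = f (Suc j) \<cdot> v"
    by (rule gp_tri_lift[OF R[of "Suc j"] gp_triD(2)[OF R[of j]] u(1)])
  note t = xtriD[OF gp_triD(1)[OF R[of j]]] and t' = xtriD[OF gp_triD(1)[OF R[of "Suc j"]]]
  have "b1 \<cdot> a1 = ide \<C> (K (Suc j)) \<boxplus> f (Suc j) \<cdot> (v \<cdot> g j)"
    using u(2) unfolding v(2) using v(1) t t' by simp
  then show ?case using Suc.IH[OF L a(1) b(1), of "v \<cdot> g j"] v(1) t by simp
qed

text \<open>A section of \<open>f m\<close> splits its triangle; the resulting retraction onto
  \<open>K (Suc m)\<close> starts in the Gorenstein projective \<open>G m\<close>, so it lifts along
  \<open>f (Suc m)\<close>.\<close>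

lemma split_propagate:
  assumes res: "gp_resolution d K G g f \<delta>"
    and s: "\<guillemotleft>s : K m \<rightarrow> G m\<guillemotright>" "f m \<cdot> s = ide \<C> (K m)"
  obtains r s' where "\<guillemotleft>r : G m \<rightarrow> K (Suc m)\<guillemotright>" "r \<cdot> g m = ide \<C> (K (Suc m))"
    "\<guillemotleft>s' : K (Suc m) \<rightarrow> G (Suc m)\<guillemotright>" "f (Suc m) \<cdot> s' = ide \<C> (K (Suc m))"
proof -
  note R = gp_resolutionD(1)[OF res] and d = gp_resolutionD(2)[OF res]
  note T = xtri_tri[OF gp_triD(1)[OF R[of m]]]
  note t = triD[OF T] and t' = xtriD[OF gp_triD(1)[OF R[of "Suc m"]]]
  have "\<delta> m = ze (K m) (K (Suc m))" by (rule split_if_section[OF T s])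
  then obtain r where r: "\<guillemotleft>r : G m \<rightarrow> K (Suc m)\<guillemotright>" "r \<cdot> g m = ide \<C> (K (Suc m))"
    using tri_split[of "K (Suc m)" "G m" "K m" "g m" "f m"] T by metis
  obtain v where v: "\<guillemotleft>v : G m \<rightarrow> G (Suc m)\<guillemotright>" "r = f (Suc m) \<cdot> v"
    by (rule gp_tri_lift[OF R[of "Suc m"] gp_triD(2)[OF R[of m]] r(1)])
  have "f (Suc m) \<cdot> (v \<cdot> g m) = ide \<C> (K (Suc m))"
    using r(2) unfolding v(2) using v(1) t t' by simp
  then show ?thesis using that[OF r, of "v \<cdot> g m"] v(1) t by simp
qed

lemma acyclic_of_split:
  assumes res: "gp_resolution d K G g f \<delta>"
    and s: "\<guillemotleft>s : K n \<rightarrow> G n\<guillemotright>" "f n \<cdot> s = ide \<C> (K n)" and m: "n \<le> m" and N: "N \<in> Obj \<C>"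
  shows "acyclic_at G d N m"
  unfolding acyclic_at_def
proof (intro allI impI)
  note R = gp_resolutionD(1)[OF res] and d = gp_resolutionD(2)[OF res]
  note tt = xtriD[OF gp_triD(1)[OF R]]
  have sec: "\<exists>s. \<guillemotleft>s : K m \<rightarrow> G m\<guillemotright> \<and> f m \<cdot> s = ide \<C> (K m)"
    using m
  proof (induction m rule: dec_induct)
    case base
    show ?case using s by blast
  next
    case (step m)
    then show ?case using split_propagate[OF res] by metis
  qed
  then obtain s0 where s0: "\<guillemotleft>s0 : K m \<rightarrow> G m\<guillemotright>" "f m \<cdot> s0 = ide \<C> (K m)" by blast
  obtain r s1 where r: "\<guillemotleft>r : G m \<rightarrow> K (Suc m)\<guillemotright>" "r \<cdot> g m = ide \<C> (K (Suc m))"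
    and s1: "\<guillemotleft>s1 : K (Suc m) \<rightarrow> G (Suc m)\<guillemotright>" "f (Suc m) \<cdot> s1 = ide \<C> (K (Suc m))"
    by (rule split_propagate[OF res s0])
  obtain r2 s2 where s2: "\<guillemotleft>s2 : K (Suc (Suc m)) \<rightarrow> G (Suc (Suc m))\<guillemotright>"
      "f (Suc (Suc m)) \<cdot> s2 = ide \<C> (K (Suc (Suc m)))"
    by (rule split_propagate[OF res s1])
  note t0 = tt[of m] and t1 = tt[of "Suc m"] and t2 = tt[of "Suc (Suc m)"]
  fix h assume h: "\<guillemotleft>h : G (Suc m) \<rightarrow> N\<guillemotright>" and 0: "h \<cdot> d (Suc (Suc m)) = zr (G (Suc (Suc m))) N"
  \<comment> \<open>A cocycle vanishes on \<open>g (Suc m) \<cdot> f (Suc (Suc m))\<close>; the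
    section \<open>s2\<close> cancels the second factor, so the cocycle factors through
    \<open>f (Suc m)\<close>.\<close>
  have "h \<cdot> g (Suc m) = (h \<cdot> d (Suc (Suc m))) \<cdot> s2"
    unfolding d using h s2 t1 t2 by simp
  also have "\<dots> = zr (K (Suc (Suc m))) N" unfolding 0 using s2(1) N by simp
  finally obtain h1 where h1: "\<guillemotleft>h1 : K (Suc m) \<rightarrow> N\<guillemotright>" "h = h1 \<cdot> f (Suc m)"
    by (rule factor_through_deflation[OF xtri_tri[OF gp_triD(1)[OF R[of "Suc m"]]] h])
  \<comment> \<open>The retraction \<open>r\<close> of \<open>g m\<close> extends \<open>h1\<close>
    from \<open>K (Suc m)\<close> to \<open>G m\<close>.\<close>
  have "h = (h1 \<cdot> r) \<cdot> d (Suc m)"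
    unfolding d h1(2) using h1(1) r(1) t0 t1 comp_subst[OF r(2), of "f (Suc m)"] by simp
  then show "\<exists>h'. \<guillemotleft>h' : G m \<rightarrow> N\<guillemotright> \<and> h = h' \<cdot> d (Suc m)"
    using h1(1) r(1) by (intro exI[of _ "h1 \<cdot> r"]) simp
qed

text \<open>Here the composite near the identity is \<open>a \<cdot> b\<close>, on the side of the
  approximation. The descent keeps \<open>j + k\<close> fixed, so vanishing is used in a single
  degree. At the last kernel it gives a retraction of \<open>g'\<close>; every earlier level reports
  that the bound on \<open>L\<close> has dropped by one.\<close>

lemma shorten_step:
  assumes res: "gp_resolution d K G g f \<delta>"
  shows "\<lbrakk>gp_tri L H K' g' f' \<delta>'; pd_le k L; \<guillemotleft>a : K j \<rightarrow> K'\<guillemotright>; \<guillemotleft>b : K' \<rightarrow> K j\<guillemotright>; \<guillemotleft>w : K' \<rightarrow> H\<guillemotright>;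
      a \<cdot> b = ide \<C> K' \<boxplus> f' \<cdot> w; \<And>W. W \<in> PP \<Longrightarrow> acyclic_at G d W (j + k)\<rbrakk>
    \<Longrightarrow> (k = 0 \<and> (\<exists>r. \<guillemotleft>r : H \<rightarrow> L\<guillemotright> \<and> r \<cdot> g' = ide \<C> L)) \<or> (\<exists>i. k = Suc i \<and> pd_le i L)"
proof (induction k arbitrary: j K' L H g' f' \<delta>' a b w)
  case (0 j K' L H g' f' \<delta>' a b w)
  note R = gp_resolutionD(1)[OF res] and d = gp_resolutionD(2)[OF res]
  note S = 0(1) and L = 0(2) and a = 0(3) and b = 0(4) and w = 0(5,6) and ac = 0(7)
  obtain \<alpha> a1 where a1: "\<guillemotleft>a1 : K (Suc j) \<rightarrow> L\<guillemotright>" "push \<C> (K j) a1 (\<delta> j) = pull \<C> L a \<delta>'"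
    using gp_tri_compare[OF R[of j] S a] by metis
  obtain \<beta> b1 where b1: "\<guillemotleft>\<beta> : H \<rightarrow> G j\<guillemotright>" "\<guillemotleft>b1 : L \<rightarrow> K (Suc j)\<guillemotright>" "\<beta> \<cdot> g' = g j \<cdot> b1"
      "push \<C> K' b1 \<delta>' = pull \<C> (K (Suc j)) b (\<delta> j)"
    by (rule gp_tri_compare[OF S R[of j] b])
  obtain u where u: "\<guillemotleft>u : H \<rightarrow> L\<guillemotright>" "a1 \<cdot> b1 = ide \<C> L \<boxplus> u \<cdot> g'"
    by (rule gp_tri_homotopy[OF S R[of j] b b1(2,4) a a1 w])
  note t0 = xtriD[OF gp_triD(1)[OF R[of j]]] and t1 = xtriD[OF gp_triD(1)[OF R[of "Suc j"]]]
    and t2 = xtriD[OF gp_triD(1)[OF R[of "Suc (Suc j)"]]] and s = xtriD[OF gp_triD(1)[OF S]]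
  have LP: "L \<in> PP" using L by simp
  have fg: "f (Suc j) \<cdot> g (Suc j) = zr (K (Suc (Suc j))) (K (Suc j))"
    by (rule tri_comp_zr[OF xtri_tri[OF gp_triD(1)[OF R[of "Suc j"]]]])
  \<comment> \<open>The cocycle to be bounded; its coefficient object \<open>L\<close> is projective
    because the approximation ends here.\<close>
  have "(a1 \<cdot> f (Suc j)) \<cdot> d (Suc (Suc j)) = zr (G (Suc (Suc j))) L"
    unfolding d using a1(1) t1 t2 comp_subst[OF fg, of "f (Suc (Suc j))"] by simp
  moreover have "\<guillemotleft>a1 \<cdot> f (Suc j) : G (Suc j) \<rightarrow> L\<guillemotright>" using a1(1) t1 by simp
  ultimately obtain h where h: "\<guillemotleft>h : G j \<rightarrow> L\<guillemotright>" "a1 \<cdot> f (Suc j) = h \<cdot> d (Suc j)"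
    using ac[OF LP] unfolding acyclic_at_def by (metis add_0_right)
  obtain \<gamma> where ga: "\<guillemotleft>\<gamma> : L \<rightarrow> G (Suc j)\<guillemotright>" "b1 = f (Suc j) \<cdot> \<gamma>"
    by (rule gp_tri_lift[OF R[of "Suc j"] PP_GP[OF LP] b1(2)])
  \<comment> \<open>Since \<open>b1\<close> factors through \<open>f (Suc j)\<close>, bounding the
    cocycle by \<open>h\<close> exhibits \<open>h \<cdot> \<beta>\<close> as an extension of
    \<open>a1 \<cdot> b1\<close> to \<open>H\<close>; subtracting \<open>u\<close> leaves an
    extension of the identity of \<open>L\<close>.\<close>
  have "a1 \<cdot> b1 = (a1 \<cdot> f (Suc j)) \<cdot> \<gamma>" unfolding ga(2) using a1(1) ga(1) t1 by simp
  also have "\<dots> = h \<cdot> (g j \<cdot> b1)" unfolding h(2) d ga(2) using h(1) ga(1) t0 t1 by simp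
  also have "\<dots> = (h \<cdot> \<beta>) \<cdot> g'" unfolding b1(3)[symmetric] using h(1) b1(1) s by simp
  finally have "(h \<cdot> \<beta>) \<cdot> g' = ide \<C> L \<boxplus> u \<cdot> g'" using u(2) by simp
  then have "(h \<cdot> \<beta>) \<cdot> g' \<boxplus> neg (u \<cdot> g') = ide \<C> L"
    by (subst (asm) add_solve) (use h(1) b1(1) u(1) s in simp_all)
  then have "(h \<cdot> \<beta> \<boxplus> neg u) \<cdot> g' = ide \<C> L" using h(1) b1(1) u(1) s by simp
  then show ?case using h(1) b1(1) u(1) by (intro disjI1 conjI exI[of _ "h \<cdot> \<beta> \<boxplus> neg u"]) simp_all
next
  case (Suc i j K' L H g' f' \<delta>' a b w)
  note R = gp_resolutionD(1)[OF res] and d = gp_resolutionD(2)[OF res]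
  note S = Suc(2) and L = Suc(3) and a = Suc(4) and b = Suc(5) and w = Suc(6,7) and ac = Suc(8)
  obtain \<alpha> a1 where a1: "\<guillemotleft>a1 : K (Suc j) \<rightarrow> L\<guillemotright>" "push \<C> (K j) a1 (\<delta> j) = pull \<C> L a \<delta>'"
    using gp_tri_compare[OF R[of j] S a] by metis
  obtain \<beta> b1 where b1: "\<guillemotleft>b1 : L \<rightarrow> K (Suc j)\<guillemotright>" "push \<C> K' b1 \<delta>' = pull \<C> (K (Suc j)) b (\<delta> j)"
    using gp_tri_compare[OF S R[of j] b] by metis
  obtain u where u: "\<guillemotleft>u : H \<rightarrow> L\<guillemotright>" "a1 \<cdot> b1 = ide \<C> L \<boxplus> u \<cdot> g'"
    by (rule gp_tri_homotopy[OF S R[of j] b b1 a a1 w])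
  obtain L2 P x y \<epsilon> where P: "P \<in> PP" "pd_le i L2" "xtri L2 P L x y \<epsilon>" using L by auto
  have T: "gp_tri L2 P L x y \<epsilon>" by (rule gp_triI[OF P(3) PP_GP[OF P(1)] P(2)])
  obtain v where v: "\<guillemotleft>v : H \<rightarrow> P\<guillemotright>" "u = y \<cdot> v" by (rule gp_tri_lift[OF T gp_triD(2)[OF S] u(1)])
  note s = xtriD[OF gp_triD(1)[OF S]] and p = xtriD[OF P(3)]
  have "a1 \<cdot> b1 = ide \<C> L \<boxplus> y \<cdot> (v \<cdot> g')" using u(2) unfolding v(2) using v(1) s p by simp
  then have "(i = 0 \<and> (\<exists>r. \<guillemotleft>r : P \<rightarrow> L2\<guillemotright> \<and> r \<cdot> x = ide \<C> L2)) \<or> (\<exists>i'. i = Suc i' \<and> pd_le i' L2)"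
    using v(1) s ac by (intro Suc.IH[OF T P(2) a1(1) b1(1), of "v \<cdot> g'"]) simp_all
  then have "pd_le i L"
  proof (elim disjE)
    assume "i = 0 \<and> (\<exists>r. \<guillemotleft>r : P \<rightarrow> L2\<guillemotright> \<and> r \<cdot> x = ide \<C> L2)"
    then obtain r where i: "i = 0" and r: "\<guillemotleft>r : P \<rightarrow> L2\<guillemotright>" "r \<cdot> x = ide \<C> L2" by blast
    \<comment> \<open>The last inflation splits, so \<open>L\<close> is a direct summand of the
      projective \<open>P\<close> and can itself end the resolution.\<close>
    have "\<epsilon> = ze L L2" by (rule split_if_retraction[OF xtri_tri[OF P(3)] r])
    then obtain q where "\<guillemotleft>q : L \<rightarrow> P\<guillemotright>" "y \<cdot> q = ide \<C> L"
      using tri_split[of L2 P L x y] xtri_tri[OF P(3)] by metis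
    then have "L \<in> PP" using PP_retract[OF P(1) _ p(5)] by blast
    then show ?thesis using i by simp
  next
    assume "\<exists>i'. i = Suc i' \<and> pd_le i' L2"
    then show ?thesis using P(1,3) by fastforce
  qed
  then show ?case by blast
qed

text \<open>The comparison starts from identities with zero correction. For \<open>k = 0\<close> the
  kernel is projective and a direct summand, which \<open>GP_cokernel\<close> removes; otherwise the
  bound on the kernel drops by one.\<close>

lemma gpd_approx_shorten:
  assumes res: "gp_resolution d K G g f \<delta>"
    and M: "gpd_approx (Suc k) (K 0)" and ac: "\<And>W. W \<in> PP \<Longrightarrow> acyclic_at G d W k"
  shows "gpd_approx k (K 0)"
proof -
  obtain L H x y \<epsilon> where H: "H \<in> GP \<C> \<xi>" "pd_le k L" "xtri L H (K 0) x y \<epsilon>" using M by auto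
  note t = xtriD[OF H(3)]
  have T: "gp_tri L H (K 0) x y \<epsilon>" by (rule gp_triI[OF H(3,1,2)])
  have "(k = 0 \<and> (\<exists>r. \<guillemotleft>r : H \<rightarrow> L\<guillemotright> \<and> r \<cdot> x = ide \<C> L)) \<or> (\<exists>i. k = Suc i \<and> pd_le i L)"
    by (rule shorten_step[OF res T H(2), of "ide \<C> (K 0)" 0 "ide \<C> (K 0)" "zr (K 0) H"])
      (use t ac in simp_all)
  then show ?thesis
  proof (elim disjE)
    assume "k = 0 \<and> (\<exists>r. \<guillemotleft>r : H \<rightarrow> L\<guillemotright> \<and> r \<cdot> x = ide \<C> L)"
    then obtain r where k: "k = 0" and r: "\<guillemotleft>r : H \<rightarrow> L\<guillemotright>" "r \<cdot> x = ide \<C> L" by blast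
    have "\<epsilon> = ze (K 0) L" by (rule split_if_retraction[OF xtri_tri[OF H(3)] r])
    then have "tri L H (K 0) x y (ze (K 0) L)" using xtri_tri[OF H(3)] by simp
    then show ?thesis using GP_cokernel H(1,2) k by simp
  next
    assume "\<exists>i. k = Suc i \<and> pd_le i L"
    then show ?thesis using H(1,3) by fastforce
  qed
qed

section \<open>Numerical dimensions and the equivalence\<close>

lemma Gpd_le_iff: "Gpd \<C> \<xi> M \<le> ereal (real n) \<longleftrightarrow> gpd_approx n M"
proof
  assume "Gpd \<C> \<xi> M \<le> ereal (real n)"
  \<comment> \<open>The strict bound \<open>n + 1\<close> extracts a member of the set below it
    without arguing that the infimum is attained; being an integer, it is at most
    \<open>n\<close>.\<close>
  then have "Gpd \<C> \<xi> M < ereal (real n + 1)" by (rule le_less_trans) simp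
  then obtain k where "Gpd_le \<C> \<xi> M k" "real_of_int k < real n + 1"
    unfolding Gpd_def INF_less_iff by auto
  then show "gpd_approx n M" using Gpd_le_imp_gpd_approx[of M k] by (simp add: of_int_less_iff)
next
  assume "gpd_approx n M"
  then have "Gpd_le \<C> \<xi> M (int n)" by (rule gpd_approx_imp_Gpd_le)
  then show "Gpd \<C> \<xi> M \<le> ereal (real n)" unfolding Gpd_def by (intro INF_lower2[of "int n"]) auto
qed

lemma finite_Gpd_approx:
  assumes "M \<in> finite_Gpd \<C> \<xi>"
  obtains k where "n \<le> k" "gpd_approx k M"
proof -
  have "Gpd \<C> \<xi> M < \<infinity>" using assms by (simp add: finite_Gpd_def)
  then obtain k where "Gpd_le \<C> \<xi> M k" unfolding Gpd_def INF_less_iff by auto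
  \<comment> \<open>The bound \<open>k\<close> may be negative or below \<open>n\<close>; it is
    weakened so that the descent has a starting point at or above \<open>n\<close>.\<close>
  then have "gpd_approx (max n (nat k)) M" using Gpd_le_imp_gpd_approx[of M k] by auto
  then show ?thesis by (rule that[rotated]) simp
qed

lemma proper_resolution_gp_tri:
  assumes "proper_GP_resolution \<C> \<xi> M G d"
  obtains K g f \<delta> where "K 0 = M" "gp_resolution d K G g f \<delta>"
proof -
  obtain K g f \<delta> where K: "K 0 = M" "\<And>n. d (Suc n) = g n \<cdot> f (Suc n)"
    and T: "\<And>n. xtri (K (Suc n)) (G n) (K n) (g n) (f n) (\<delta> n)" and G: "\<And>n. G n \<in> GP \<C> \<xi>"
    and ex: "\<And>n W. W \<in> GP \<C> \<xi> \<Longrightarrow>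
      covariant_exact \<C> W (ETri (K (Suc n)) (G n) (K n) (g n) (f n) (\<delta> n))"
    using assms unfolding proper_GP_resolution_def by blast
  have "gp_tri (K (Suc n)) (G n) (K n) (g n) (f n) (\<delta> n)" for n
    unfolding gp_tri_def
  proof (intro conjI ballI T G)
    fix W assume W: "W \<in> GP \<C> \<xi>"
    show "\<forall>t. \<guillemotleft>t : W \<rightarrow> K n\<guillemotright> \<longrightarrow> (\<exists>s. \<guillemotleft>s : W \<rightarrow> G n\<guillemotright> \<and> t = f n \<cdot> s)"
      using ex[OF W, of n] unfolding covariant_exact_iff[OF xtri_tri[OF T] GP_obj[OF W]] by (rule conjunct2)
  qed
  then show ?thesis using that K unfolding gp_resolution_def by blast
qed

theorem Gpd_le_iff_xi_xt_vanishing: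
  assumes M: "M \<in> Res_GP \<C> \<xi>" "M \<in> finite_Gpd \<C> \<xi>"
  shows "Gpd \<C> \<xi> M \<le> ereal (real n) \<longleftrightarrow>
      (\<forall>i \<ge> 1. \<forall>N \<in> Obj \<C>. trivial_group (xi_xt \<C> \<xi> (n + i) M N))"
    and "Gpd \<C> \<xi> M \<le> ereal (real n) \<longleftrightarrow>
      (\<forall>i \<ge> 1. \<forall>P \<in> PP. trivial_group (xi_xt \<C> \<xi> (n + i) M P))"
proof -
  \<comment> \<open>The choice in \<open>xi_xt\<close> depends on neither the degree nor the second
    argument, so one fixed resolution serves throughout.\<close>
  define GD where "GD = (SOME (G, d). proper_GP_resolution \<C> \<xi> M G d)"
  obtain G d where Gd: "GD = (G, d)" by (cases GD)
  have ex: "\<exists>p. case p of (G, d) \<Rightarrow> proper_GP_resolution \<C> \<xi> M G d" using M(1) by (auto simp: Res_GP_def)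
  have pr: "proper_GP_resolution \<C> \<xi> M G d"
    using someI_ex[OF ex] Gd by (simp add: GD_def)
  obtain K g f \<delta> where K: "K 0 = M" and res: "gp_resolution d K G g f \<delta>"
    by (rule proper_resolution_gp_tri[OF pr])
  note R = gp_resolutionD(1)[OF res] and d = gp_resolutionD(2)[OF res]
  note t = xtriD[OF gp_triD(1)[OF R]]
  have d1: "\<guillemotleft>d (Suc n) : G (Suc n) \<rightarrow> G n\<guillemotright>" for n
    unfolding d using t(4,5)[of n] t(4,5)[of "Suc n"] by simp
  have d2: "d (Suc n) \<cdot> d (Suc (Suc n)) = zr (G (Suc (Suc n))) (G n)" for n
    unfolding d using t(4)[of n] t(4,5)[of "Suc n"] t(5)[of "Suc (Suc n)"]
      comp_subst[OF tri_comp_zr[OF xtri_tri[OF gp_triD(1)[OF R[of "Suc n"]]]], of "f (Suc (Suc n))"] by simp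
  have xt: "trivial_group (xi_xt \<C> \<xi> (Suc m) M N) \<longleftrightarrow> acyclic_at G d N m" if "N \<in> Obj \<C>" for m N
    using trivial_cohomology_iff[of d G, OF d1 d2 that] Gd by (simp add: xi_xt_def GD_def)
  have 12: "acyclic_at G d N m" if "gpd_approx n M" "n \<le> m" "N \<in> Obj \<C>" for m N
  proof -
    \<comment> \<open>Both resolutions resolve the same \<open>M\<close>, so the comparison starts
      in degree 0 with identities and zero correction.\<close>
    have "\<exists>s. \<guillemotleft>s : K (0 + n) \<rightarrow> G (0 + n)\<guillemotright> \<and> f (0 + n) \<cdot> s = ide \<C> (K (0 + n))"
      by (rule comparison_split[OF res gpd_approx_gp_length_le[OF that(1)],
            of "ide \<C> M" 0 "ide \<C> M" "zr M (G 0)"]) (use K t[of 0] in simp_all)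
    then obtain s where s: "\<guillemotleft>s : K n \<rightarrow> G n\<guillemotright>" "f n \<cdot> s = ide \<C> (K n)" by auto
    show ?thesis by (rule acyclic_of_split[OF res s that(2,3)])
  qed
  have 31: "gpd_approx n M" if "\<And>m W. n \<le> m \<Longrightarrow> W \<in> PP \<Longrightarrow> acyclic_at G d W m"
  proof -
    obtain k where k: "n \<le> k" "gpd_approx k M" by (rule finite_Gpd_approx[OF M(2)])
    from k show ?thesis
    proof (induction k rule: dec_induct)
      case (step k)
      \<comment> \<open>The induction hypothesis already leads from \<open>k\<close> down to
        \<open>n\<close>, so a single shortening is needed, using vanishing in degree
        \<open>k + 1\<close>.\<close>
      have "gpd_approx k (K 0)"
        by (rule gpd_approx_shorten[OF res]) (use step that K in simp_all)
      then show ?case using step.IH K by simp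
    qed
  qed
  \<comment> \<open>Degrees above \<open>n\<close> are written as \<open>Suc m\<close> with
    \<open>m \<ge> n\<close> to match the index of \<open>acyclic_at\<close>.\<close>
  have shift: "(\<forall>i \<ge> 1. Q (n + i)) \<longleftrightarrow> (\<forall>m \<ge> n. Q (Suc m))" for Q :: "nat \<Rightarrow> bool"
    by (metis Suc_le_D add_Suc_right le_add1 le_iff_add plus_1_eq_Suc)
  have PO: "PP \<subseteq> Obj \<C>" using PP_obj by blast
  show "Gpd \<C> \<xi> M \<le> ereal (real n) \<longleftrightarrow>
      (\<forall>i \<ge> 1. \<forall>N \<in> Obj \<C>. trivial_group (xi_xt \<C> \<xi> (n + i) M N))"
    unfolding Gpd_le_iff shift[of "\<lambda>m. \<forall>N \<in> Obj \<C>. trivial_group (xi_xt \<C> \<xi> m M N)"]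
    using 12 31 xt PO by blast
  show "Gpd \<C> \<xi> M \<le> ereal (real n) \<longleftrightarrow>
      (\<forall>i \<ge> 1. \<forall>P \<in> PP. trivial_group (xi_xt \<C> \<xi> (n + i) M P))"
    unfolding Gpd_le_iff shift[of "\<lambda>m. \<forall>P \<in> PP. trivial_group (xi_xt \<C> \<xi> m M P)"]
    using 12 31 xt PO by blast
qed

end
theorem proposition3p26:
  fixes \<C> :: "('o, 'm, 'e) extri"
    and \<xi> :: "('o, 'm, 'e) etri set"
    and n :: nat
    and M :: 'o
  assumes "extriangulated_category \<C>"
    and "WIC \<C>"
    and "proper_class \<C> \<xi>"
    and "enough_proj \<C> \<xi>"
    and "enough_inj \<C> \<xi>"
    and "(SUP A \<in> Obj \<C>. Gid \<C> \<xi> A) < \<infinity>"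
    and "M \<in> Res_GP \<C> \<xi> \<inter> finite_Gpd \<C> \<xi>"
  shows "(Gpd \<C> \<xi> M \<le> ereal (real n) \<longleftrightarrow>
           (\<forall>i \<ge> 1. \<forall>N \<in> Obj \<C>. trivial_group (xi_xt \<C> \<xi> (n + i) M N))) \<and>
         (Gpd \<C> \<xi> M \<le> ereal (real n) \<longleftrightarrow>
           (\<forall>i \<ge> 1. \<forall>P \<in> Proj \<C> \<xi>. trivial_group (xi_xt \<C> \<xi> (n + i) M P)))"
proof -
  interpret relative_projectives \<C> \<xi>
    using assms(1,3,4) by (simp add: relative_projectives_def relative_projectives_axioms_def)
  show ?thesis using Gpd_le_iff_xi_xt_vanishing assms(7) by blast
qed

end
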